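(* Let $g\ge0$, $k\ge1$, $n=2$, let $\sigma$ be the involution $g\mapsto\mathscr{J}\,{}^tg^{-1}\mathscr{J}^{-1}$ of $\mathrm{GL}_2$ over $\mathbb{C}$ with $\mathscr{J}=\begin{pmatrix}0&1\\-1&0\end{pmatrix}$, and let $\mathcal{C}=(C_j)_{1\le j\le2k}$ be the tuple of conjugacy classes of $\mathrm{diag}(a_j,a_j^{-1})\sigma$, where $a_j\in\mathbb{C}^*$ and $a_j^2\neq-1$. Suppose $\mathcal{C}$ is generic, i.e. $\prod_{j=1}^{2k}a_j^{2e_j}\ne1$ for all signs $e_j\in\{\pm1\}$. Put $\mu_j=(2)$ if $a_j^2=1$ and $\mu_j=(1,1)$ if $a_j^4\ne1$, and $\boldsymbol\mu=(\mu_1,\dots,\mu_{2k})$. Let $\mathbb{H}_{\mathbf{B}}(z,w)$ be the rational function attached to $\mathcal{C}$ and $\mathbb{H}_{\boldsymbol\mu}(z,w)$ the Hausel–Letellier–Rodriguez-Villegas rational function attached to genus $g$, $2k$ punctures and $\boldsymbol\mu$ (both defined in the context). Then $$\mathbb{H}_{\mathbf{B}}(z,w)=2\,(z-w)^{2k-2}\,\mathbb{H}_{\boldsymbol\mu}(z,w).$$ (Equivalently: under the isomorphism $\mathrm{Ch}_{\mathcal{C}}\cong(\mathrm{Ch}^+_{\mathcal{C}'}\sqcup\mathrm{Ch}^-_{\mathcal{C}'})\times\mathbb{G}_m^{2k-2}$, where $\mathcal{C}'$ is the tuple of conjugacy classes of $\mathrm{diag}(a_j,a_j^{-1})$ in $\mathrm{SL}_2$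 and $\mathrm{Ch}^\pm_{\mathcal{C}'}$ are the corresponding $\mathrm{GL}_2$-character varieties with defining equation $\prod_i[A_i,B_i]\prod_jX_j'=\pm1$, the two conjectural formulas predict the same mixed Hodge polynomial.)
   Context: **Partitions.** $\mathcal{P}$ = set of all partitions, $\mathcal{P}^2=\mathcal{P}\times\mathcal{P}$ = 2-partitions $\boldsymbol\alpha=(\alpha^{(0)},\alpha^{(1)})$, $|\boldsymbol\alpha|=|\alpha^{(0)}|+|\alpha^{(1)}|$. $\lambda^*$ is the dual partition; $\boldsymbol\alpha^*=(\alpha^{(1)*},\alpha^{(0)*})$. For $\lambda$ with empty 2-core (i.e. reducible to the empty partition by removing dominoes), choose $r\ge l(\lambda)$ odd; let $2y_1>\dots>2y_{l_0}$ and $2y_1'+1>\dots>2y'_{l_1}+1$ be the even and odd parts of $\lambda+(r-1,r-2,\dots,0)$; the 2-quotient is $(\lambda^{(0)},\lambda^{(1)})$, $\lambda^{(0)}_i=y_i-l_0+i$, $\lambda^{(1)}_i=y_i'-l_1+i$. $\{\boldsymbol\alpha\}_0$ is the unique partition with empty 2-core and 2-quotient $\boldsymbol\alpha$. For a box $x$, $a(x),l(x),h(x)$ are arm length, leg length, hook length. **Symmetric functions.** Let $\mathbf{x}=(\mathbf{x}^{(0)},\mathbf{x}^{(1)})$ be two infinite families of variables; in $\mathbf{Sym}[\mathbf{x}^{(0)}]\otimes\mathbf{Sym}[\mathbf{x}^{(1)}]$ over $\mathbb{Q}(z,w)$ put $s_{\boldsymbol\alpha}(\mathbf{x})=s_{\alpha^{(0)}}(\mathbf{x}^{(0)})s_{\alpha^{(1)}}(\mathbf{x}^{(1)})$;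 the Hall inner product makes the $s_{\boldsymbol\alpha}$ orthonormal. For a $2\times2$ matrix $M$ over $\mathbb{Q}(z,w)$, $F[M\mathbf{x}]$ is obtained by substituting $p_r(\mathbf{x}^{(i)})\mapsto\sum_kM_{ik}(z^r,w^r)p_r(\mathbf{x}^{(k)})$. $F(\mathbf{x}^{(0)}+\mathbf{x}^{(1)})$ means $F$ evaluated in the union of both families. $M_z=\begin{pmatrix}1&-z\\-z&1\end{pmatrix}$, $M_w=\begin{pmatrix}1&-w\\-w&1\end{pmatrix}$. Macdonald polynomials (modified): $H_\lambda(\mathbf{z};z,w)$, $|\lambda|=m$, are the unique symmetric functions with $H_\lambda[(1-z)\mathbf{z}]\in\mathrm{span}\{s_\mu:\mu\ge\lambda\}$, $H_\lambda[(1-w)\mathbf{z}]\in\mathrm{span}\{s_\mu:\mu\ge\lambda^*\}$ (dominance order), $\langle H_\lambda,s_{(m)}\rangle=1$. $N_\lambda(u,z,w)=\prod_{x\in\lambda}(z^{a(x)+1}-uw^{l(x)})(z^{a(x)}-u^{-1}w^{l(x)+1})$, $N_\lambda(z,w)=N_\lambda(1,z,w)$. Wreath Macdonald polynomials for the empty 2-core: order 2-partitions of size $m$ by $\boldsymbol\beta\ge\boldsymbol\alpha$ iff $\{\boldsymbol\beta\}_0\ge\{\boldsymbol\alpha\}_0$ in dominance order. $\tilde H_{\boldsymbol\alpha}(\mathbf{x};z,w)$, $|\boldsymbol\alpha|=m$, are the unique elements with $\tilde H_{\boldsymbol\alpha}[M_z\mathbf{x}]\in\mathrm{span}\{s_{\boldsymbol\beta}:\boldsymbol\beta\ge\boldsymbol\alpha\}$,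 $\tilde H_{\boldsymbol\alpha}[M_w\mathbf{x}]\in\mathrm{span}\{s_{\boldsymbol\beta}:\boldsymbol\beta\ge\boldsymbol\alpha^*\}$, $\langle\tilde H_{\boldsymbol\alpha},s_{((m),\varnothing)}\rangle=1$. Let $\langle F,G\rangle_{z,w}=\langle F[\mathbf{x}],G[\begin{pmatrix}0&-1\\-1&0\end{pmatrix}M_zM_w\mathbf{x}]\rangle$, $\tilde N_{\boldsymbol\alpha}(z,w)=\langle\tilde H_{\boldsymbol\alpha},\tilde H_{\boldsymbol\alpha}\rangle_{z,w}$, $\tilde N^{cot}_{\boldsymbol\alpha}(u,z,w)=\prod_{x\in\{\boldsymbol\alpha\}_0,\,h(x)\text{ even}}(z^{a(x)+1}-uw^{l(x)})(z^{a(x)}-u^{-1}w^{l(x)+1})$, $\tilde N^{\nabla}_{\boldsymbol\alpha}(z,w)=\tilde N_{\boldsymbol\alpha}(z,w)/\tilde N^{cot}_{\boldsymbol\alpha}(1,z,w)$, $\tilde N_{\boldsymbol\alpha}(u,z,w)=\tilde N^{\nabla}_{\boldsymbol\alpha}(z,w)\tilde N^{cot}_{\boldsymbol\alpha}(u,z,w)$. **The function $\mathbb{H}_{\mathbf{B}}$ for $n=2$.** Let $\mathbf{x}_j=(\mathbf{x}_j^{(0)},\mathbf{x}_j^{(1)})$, $1\le j\le2k$, be independent, $$\Omega_0=\sum_{\boldsymbol\alpha\in\mathcal{P}^2}\frac{N_{\{\boldsymbol\alpha\}_0}(zw,z^2,w^2)^{g+k-1}}{\tilde N_{\boldsymbol\alpha}(z^2,w^2)\tilde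 N_{\boldsymbol\alpha}(zw,z^2,w^2)^{k-1}}\prod_{j=1}^{2k}\tilde H_{\boldsymbol\alpha}(\mathbf{x}_j;z^2,w^2),$$ $$\Omega_*=\sum_{\alpha\in\mathcal{P}}\frac{N_\alpha(zw,z^2,w^2)^{2g+k-1}}{N_\alpha(z^2,w^2)}\prod_{j=1}^{2k}H_\alpha(\mathbf{x}_j^{(0)}+\mathbf{x}_j^{(1)};z^2,w^2).$$ Put $h_{\boldsymbol\beta_j^*}(\mathbf{x}_j)=h_1(\mathbf{x}_j^{(0)})$ if $a_j^2=1$ and $h_1(\mathbf{x}_j^{(0)}+\mathbf{x}_j^{(1)})$ if $a_j^4\neq1$. Then $\mathbb{H}_{\mathbf{B}}(z,w)=\langle\Omega_0^2/\Omega_*,\prod_jh_{\boldsymbol\beta_j^*}(\mathbf{x}_j)\rangle$ (Hall inner product in all $\mathbf{x}_j$). **The function $\mathbb{H}_{\boldsymbol\mu}$.** With independent families $\mathbf{z}_1,\dots,\mathbf{z}_{2k}$, $\Omega_{HLRV}=\sum_{\lambda\in\mathcal{P}}\frac{N_\lambda(zw,z^2,w^2)^g}{N_\lambda(z^2,w^2)}\prod_{j=1}^{2k}H_\lambda(\mathbf{z}_j;z^2,w^2)$ and $\mathbb{H}_{\boldsymbol\mu}(z,w)=(z^2-1)(1-w^2)\langle\mathrm{Log}\,\Omega_{HLRV},\prod_jh_{\mu_j}(\mathbf{z}_j)\rangle$, with $h_{(2)}=h_2$, $h_{(1,1)}=h_1^2$. Here $\mathrm{Log}$ is the inverse of the plethystic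 exponential $\mathrm{Exp}(V)=\exp(\sum_{r\ge1}\psi_r(V)/r)$, where $\psi_r$ raises $z$, $w$ and all variables of the $\mathbf{z}_j$ to the $r$-th power. The conjectural mixed Hodge polynomials are $(t\sqrt q)^{d}\,\mathbb{H}_{\mathbf{B}}(-t\sqrt q,1/\sqrt q)$ for $\mathrm{Ch}_{\mathcal{C}}$ ($d$ its dimension) and $(t\sqrt q)^{d_{\boldsymbol\mu}}\mathbb{H}_{\boldsymbol\mu}(-t\sqrt q,1/\sqrt q)$ for each of $\mathrm{Ch}^{\pm}_{\mathcal{C}'}$ ($d_{\boldsymbol\mu}$ its dimension); that of $\mathbb{G}_m$ is $t+qt^2$. *)

theory Defs
  imports
    "HOL-Analysis.Determinants"
    "HOL-Computational_Algebra.Computational_Algebra"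
    "HOL-Library.More_List"
    "HOL-Library.Poly_Mapping"
begin

section \<open>The field of rational functions in \<open>z\<close> and \<open>w\<close>\<close>

type_synonym rf = "rat poly poly fract"

definition zz :: rf where "zz = Fraction_Field.Fract [:[:0, 1:]:] 1"
definition ww :: rf where "ww = Fraction_Field.Fract [:0, 1:] 1"

definition adams_poly :: "nat \<Rightarrow> rat poly poly \<Rightarrow> rat poly poly" where
  "adams_poly r p = pcompose (map_poly (\<lambda>c. pcompose c (monom 1 r)) p) (monom 1 r)"

text \<open>The field endomorphism \<open>f(z,w) \<mapsto> f(z^r,w^r)\<close>, for \<open>r > 0\<close>.\<close>

definition adams_rf :: "nat \<Rightarrow> rf \<Rightarrow> rf" where
  "adams_rf r x = (THE y. \<exists>a b. b \<noteq> 0 \<and> x = Fraction_Field.Fract a b \<and>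
     y = Fraction_Field.Fract (adams_poly r a) (adams_poly r b))"


section \<open>Formal power series in arbitrarily many commuting variables\<close>

text \<open>
  A monomial in variables indexed by \<open>'v\<close> is a finite multiset over \<open>'v\<close>; a series is an
  arbitrary function from monomials to coefficients.
\<close>

typedef ('v, 'a) mseries = "UNIV :: ('v multiset \<Rightarrow> 'a) set"
  morphisms coeff_of Series ..

setup_lifting type_definition_mseries

lemma mseries_eqI: "(\<And>M. coeff_of F M = coeff_of G M) \<Longrightarrow> F = G"
  by transfer auto

definition splits :: "'v multiset \<Rightarrow> ('v multiset \<times> 'v multiset) set" where
  "splits M = {(A, B). A + B = M}"

lemma finite_splits [simp]: "finite (splits M)"
proof -
  have fin: "finite {A. A \<subseteq># M}"
  proof (rule finite_subset)
    show "{A. A \<subseteq># M} \<subseteq> (\<Union>n\<le>size M. multisets_of_size (set_mset M) n)"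
      by (auto simp: multisets_of_size_def dest: size_mset_mono mset_subset_eqD)
    show "finite (\<Union>n\<le>size M. multisets_of_size (set_mset M) n)"
      by auto
  qed
  have "splits M \<subseteq> {A. A \<subseteq># M} \<times> {A. A \<subseteq># M}"
    by (auto simp: splits_def)
  then show ?thesis
    using fin by (meson finite_SigmaI finite_subset)
qed

instantiation mseries :: (type, zero) zero
begin
lift_definition zero_mseries :: "('a, 'b) mseries" is "\<lambda>_. 0" .
instance ..
end

instantiation mseries :: (type, zero_neq_one) one
begin
lift_definition one_mseries :: "('a, 'b) mseries" is "\<lambda>M. if M = {#} then 1 else 0" .
instance ..
end

instantiation mseries :: (type, plus) plus
begin
lift_definition plus_mseries :: "('a, 'b) mseries \<Rightarrow> ('a, 'b) mseries \<Rightarrow> ('a, 'b) mseries"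
  is "\<lambda>F G M. F M + G M" .
instance ..
end

instantiation mseries :: (type, minus) minus
begin
lift_definition minus_mseries :: "('a, 'b) mseries \<Rightarrow> ('a, 'b) mseries \<Rightarrow> ('a, 'b) mseries"
  is "\<lambda>F G M. F M - G M" .
instance ..
end

instantiation mseries :: (type, uminus) uminus
begin
lift_definition uminus_mseries :: "('a, 'b) mseries \<Rightarrow> ('a, 'b) mseries" is "\<lambda>F M. - F M" .
instance ..
end

instantiation mseries :: (type, comm_semiring_0) times
begin
lift_definition times_mseries :: "('a, 'b) mseries \<Rightarrow> ('a, 'b) mseries \<Rightarrow> ('a, 'b) mseries"
  is "\<lambda>F G M. \<Sum>(A, B)\<in>splits M. F A * G B" .
instance ..
end

lemma splits_sum_swap:
  "(\<Sum>(A, B)\<in>splits M. f A B) = (\<Sum>(A, B)\<in>splits M. f B A)"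
  by (rule sum.reindex_bij_witness[of _ prod.swap prod.swap])
     (auto simp: splits_def add.commute)

lemma splits_sum_assoc:
  fixes f :: "'v multiset \<Rightarrow> 'v multiset \<Rightarrow> 'v multiset \<Rightarrow> 'a::comm_monoid_add"
  shows "(\<Sum>(A, B)\<in>splits M. \<Sum>(C, D)\<in>splits A. f C D B)
       = (\<Sum>(C, E)\<in>splits M. \<Sum>(D, B)\<in>splits E. f C D B)"
proof -
  have "(\<Sum>x\<in>splits M. \<Sum>y\<in>splits (fst x). f (fst y) (snd y) (snd x))
      = (\<Sum>x\<in>splits M. \<Sum>y\<in>splits (snd x). f (fst x) (fst y) (snd y))"
    unfolding sum.Sigma[OF finite_splits ballI[OF finite_splits]]
    by (rule sum.reindex_bij_witness[of _
          "\<lambda>((C, E), (D, B)). ((C + D, B), (C, D))"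
          "\<lambda>((A, B), (C, D)). ((C, D + B), (D, B))"])
       (auto simp: splits_def add.assoc)
  then show ?thesis
    by (simp add: case_prod_unfold)
qed

instance mseries :: (type, comm_ring_1) comm_ring_1
proof
  fix F G H :: "('a, 'b) mseries"
  show "F * G * H = F * (G * H)"
  proof (transfer, rule ext)
    fix F G H :: "'a multiset \<Rightarrow> 'b" and M
    show "(\<Sum>(A, B)\<in>splits M. (\<Sum>(C, D)\<in>splits A. F C * G D) * H B)
        = (\<Sum>(A, B)\<in>splits M. F A * (\<Sum>(C, D)\<in>splits B. G C * H D))"
      using splits_sum_assoc[of "\<lambda>C D B. F C * G D * H B" M]
      by (simp add: case_prod_unfold sum_distrib_left sum_distrib_right mult.assoc)
  qed
  show "F * G = G * F"
    by transfer (auto simp: fun_eq_iff mult.commute intro: splits_sum_swap)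
  show "1 * F = F"
  proof (transfer, rule ext)
    fix F :: "'a multiset \<Rightarrow> 'b" and M
    have "(\<Sum>(A, B)\<in>splits M. (if A = {#} then 1 else 0) * F B)
        = (\<Sum>(A :: 'a multiset, B)\<in>{({#}, M)}. (if A = {#} then 1 else 0) * F B)"
      by (rule sum.mono_neutral_right[OF finite_splits])
         (auto simp: splits_def split: if_splits)
    then show "(\<Sum>(A, B)\<in>splits M. (if A = {#} then 1 else 0) * F B) = F M"
      by simp
  qed
  show "(F + G) * H = F * H + G * H"
    by transfer (simp add: fun_eq_iff case_prod_unfold distrib_right sum.distrib)
  show "F + G + H = F + (G + H)" "F + G = G + F" "0 + F = F" "- F + F = 0" "F - G = F + - G"
    by (transfer, simp add: fun_eq_iff algebra_simps)+
  show "(0 :: ('a, 'b) mseries) \<noteq> 1"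
    by transfer (auto simp: fun_eq_iff)
qed

definition mscale :: "'a::comm_ring_1 \<Rightarrow> ('v, 'a) mseries \<Rightarrow> ('v, 'a) mseries" where
  "mscale c F = Series (\<lambda>M. c * coeff_of F M)"

interpretation mseries: vector_space "mscale :: 'a::field \<Rightarrow> ('v, 'a) mseries \<Rightarrow> ('v, 'a) mseries"
  unfolding mscale_def
  by unfold_locales
     (auto intro!: mseries_eqI
        simp: Series_inverse plus_mseries.rep_eq algebra_simps)

text \<open>
  A possibly infinite sum of series, computed coefficientwise. It is only meaningful if every
  monomial occurs in finitely many summands.
\<close>

definition formal_sum :: "'i set \<Rightarrow> ('i \<Rightarrow> ('v, 'a::comm_ring_1) mseries) \<Rightarrow> ('v, 'a) mseries" where
  "formal_sum I f = Series (\<lambda>M. \<Sum>i\<in>{i \<in> I. coeff_of (f i) M \<noteq> 0}. coeff_of (f i) M)"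

definition mseries_inverse :: "('v, 'a::comm_ring_1) mseries \<Rightarrow> ('v, 'a) mseries" where
  "mseries_inverse F = (THE G. F * G = 1)"

text \<open>Renaming of variables along an injective map.\<close>

definition rename :: "('v \<Rightarrow> 'u) \<Rightarrow> ('v, 'a::zero) mseries \<Rightarrow> ('u, 'a) mseries" where
  "rename f F = Series (\<lambda>N.
     if set_mset N \<subseteq> f ` UNIV then coeff_of F (image_mset (inv f) N) else 0)"

definition map_coeffs :: "('a \<Rightarrow> 'b) \<Rightarrow> ('v, 'a) mseries \<Rightarrow> ('v, 'b) mseries" where
  "map_coeffs f F = Series (\<lambda>M. f (coeff_of F M))"

text \<open>\<open>adams r\<close> (for \<open>r > 0\<close>) raises \<open>z\<close>, \<open>w\<close> and all variables to the \<open>r\<close>-th power.\<close>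

definition adams :: "nat \<Rightarrow> ('v, rf) mseries \<Rightarrow> ('v, rf) mseries" where
  "adams r F = Series (\<lambda>N.
     if \<exists>M. N = repeat_mset r M
     then adams_rf r (coeff_of F (THE M. N = repeat_mset r M)) else 0)"

definition mseries_exp :: "('v, rf) mseries \<Rightarrow> ('v, rf) mseries" where
  "mseries_exp U = formal_sum UNIV (\<lambda>n. mscale (1 / of_nat (fact n)) (U ^ n))"

text \<open>\<open>Exp\<close> and \<open>mseries_exp\<close> are meant for series without constant term.\<close>

definition Exp :: "('v, rf) mseries \<Rightarrow> ('v, rf) mseries" where
  "Exp V = mseries_exp (formal_sum {1..} (\<lambda>r. mscale (1 / of_nat r) (adams r V)))"

definition Log :: "('v, rf) mseries \<Rightarrow> ('v, rf) mseries" where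
  "Log F = (THE V. coeff_of V {#} = 0 \<and> Exp V = F)"


section \<open>Partitions\<close>

text \<open>
  A partition is the weakly decreasing list of its positive parts. Rows and columns are numbered
  from 0, and \<open>nth_default 0 \<nu> i\<close> is the part in row \<open>i\<close>.
\<close>

type_synonym partition = "nat list"

definition Par :: "partition set" where
  "Par = {\<nu>. sorted_wrt (\<ge>) \<nu> \<and> 0 \<notin> set \<nu>}"

abbreviation part :: "partition \<Rightarrow> nat \<Rightarrow> nat" where
  "part \<nu> i \<equiv> nth_default 0 \<nu> i"

definition diagram :: "partition \<Rightarrow> (nat \<times> nat) set" where
  "diagram \<nu> = {(i, j). j < part \<nu> i}"

definition dual :: "partition \<Rightarrow> partition" where
  "dual \<nu> = map (\<lambda>j. card {i. j < part \<nu> i}) [0..<part \<nu> 0]"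

definition arm :: "partition \<Rightarrow> nat \<times> nat \<Rightarrow> nat" where
  "arm \<nu> x = part \<nu> (fst x) - snd x - 1"

definition leg :: "partition \<Rightarrow> nat \<times> nat \<Rightarrow> nat" where
  "leg \<nu> x = part (dual \<nu>) (snd x) - fst x - 1"

definition hook :: "partition \<Rightarrow> nat \<times> nat \<Rightarrow> nat" where
  "hook \<nu> x = arm \<nu> x + leg \<nu> x + 1"

definition dominates :: "partition \<Rightarrow> partition \<Rightarrow> bool" where
  "dominates \<mu> \<nu> \<longleftrightarrow>
     sum_list \<mu> = sum_list \<nu> \<and> (\<forall>n. (\<Sum>i<n. part \<nu> i) \<le> (\<Sum>i<n. part \<mu> i))"

text \<open>The one-row partition \<open>(m)\<close>; it is empty for \<open>m = 0\<close>.\<close>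

definition row :: "nat \<Rightarrow> partition" where
  "row m = (if m = 0 then [] else [m])"

definition domino :: "(nat \<times> nat) set \<Rightarrow> bool" where
  "domino D \<longleftrightarrow> (\<exists>i j. D = {(i, j), (i, j + 1)} \<or> D = {(i, j), (i + 1, j)})"

definition remove_domino :: "partition \<Rightarrow> partition \<Rightarrow> bool" where
  "remove_domino \<nu> \<mu> \<longleftrightarrow> \<nu> \<in> Par \<and> \<mu> \<in> Par \<and> diagram \<mu> \<subseteq> diagram \<nu> \<and>
     domino (diagram \<nu> - diagram \<mu>)"

definition empty_2core :: "partition \<Rightarrow> bool" where
  "empty_2core \<nu> \<longleftrightarrow> remove_domino\<^sup>*\<^sup>* \<nu> []"

text \<open>
  The 2-quotient, with the least odd \<open>r\<close> not below the length of \<open>\<nu>\<close>; the result is the same for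
  every such \<open>r\<close>. Halving by \<open>div\<close> recovers \<open>y\<close> from \<open>2 y\<close> and \<open>y'\<close> from \<open>2 y' + 1\<close>, and with
  0-based indices \<open>y_i - l_0 + i\<close> becomes \<open>ys ! i + i + 1 - l\<close>.
\<close>

definition beta_numbers :: "partition \<Rightarrow> nat list" where
  "beta_numbers \<nu> = (let r = (LEAST r. odd r \<and> length \<nu> \<le> r) in
     map (\<lambda>i. part \<nu> i + (r - 1 - i)) [0..<r])"

definition quotient_component :: "nat list \<Rightarrow> partition" where
  "quotient_component bs = (let ys = map (\<lambda>b. b div 2) bs; l = length ys in
     filter (\<lambda>p. p \<noteq> 0) (map (\<lambda>i. ys ! i + i + 1 - l) [0..<l]))"

text \<open>A 2-partition is a pair of partitions indexed by \<open>0, 1 :: 2\<close>.\<close>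

type_synonym partition2 = "2 \<Rightarrow> partition"

definition Par2 :: "partition2 set" where
  "Par2 = {\<alpha>. \<forall>i. \<alpha> i \<in> Par}"

definition size2 :: "partition2 \<Rightarrow> nat" where
  "size2 \<alpha> = (\<Sum>i\<in>UNIV. sum_list (\<alpha> i))"

definition dual2 :: "partition2 \<Rightarrow> partition2" where
  "dual2 \<alpha> = (\<lambda>i. dual (\<alpha> (1 - i)))"

definition quotient2 :: "partition \<Rightarrow> partition2" where
  "quotient2 \<nu> = (\<lambda>i. if i = 0
     then quotient_component (filter even (beta_numbers \<nu>))
     else quotient_component (filter odd (beta_numbers \<nu>)))"

text \<open>\<open>{\<alpha>}_0\<close>\<close>

definition from_quotient :: "partition2 \<Rightarrow> partition" where
  "from_quotient \<alpha> = (THE \<nu>. \<nu> \<in> Par \<and> empty_2core \<nu> \<and> quotient2 \<nu> = \<alpha>)"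

definition dominates2 :: "partition2 \<Rightarrow> partition2 \<Rightarrow> bool" where
  "dominates2 \<beta> \<alpha> \<longleftrightarrow>
     size2 \<beta> = size2 \<alpha> \<and> dominates (from_quotient \<beta>) (from_quotient \<alpha>)"


section \<open>Symmetric functions\<close>

text \<open>
  For a family of alphabets indexed by \<open>'i\<close>, the variables are \<open>'i \<times> nat\<close>. For finite \<open>'i\<close>, the
  set \<open>Sym\<close> is the tensor product of the rings of symmetric functions in the single alphabets:
  the series of bounded degree that are symmetric in each alphabet separately.
  A single alphabet has \<open>'i = unit\<close>.
\<close>

type_synonym 'i symf = "('i \<times> nat, rf) mseries"

definition Sym :: "'i symf set" where
  "Sym = {F.
     (\<forall>\<pi>. (\<forall>i. bij (\<pi> i)) \<longrightarrow>
        (\<forall>M. coeff_of F (image_mset (\<lambda>(i, n). (i, \<pi> i n)) M) = coeff_of F M)) \<and>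
     (\<exists>d. \<forall>M. coeff_of F M \<noteq> 0 \<longrightarrow> size M \<le> d)}"

text \<open>The same symmetric function in the alphabet with index \<open>i\<close>.\<close>

definition in_alphabet :: "'i \<Rightarrow> unit symf \<Rightarrow> 'i symf" where
  "in_alphabet i F = rename (\<lambda>(_, n). (i, n)) F"

definition power_sum :: "nat \<Rightarrow> unit symf" where
  "power_sum r = Series (\<lambda>M. if \<exists>n. M = replicate_mset r ((), n) then 1 else 0)"

definition complete_h :: "nat \<Rightarrow> unit symf" where
  "complete_h r = Series (\<lambda>M. if size M = r then 1 else 0)"

definition complete_h_part :: "partition \<Rightarrow> unit symf" where
  "complete_h_part \<mu> = prod_list (map complete_h \<mu>)"

text \<open>Semistandard tableaux, normalised to be 0 outside of their shape.\<close>

definition semistandard :: "partition \<Rightarrow> (nat \<times> nat \<Rightarrow> nat) \<Rightarrow> bool" where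
  "semistandard \<nu> T \<longleftrightarrow>
     (\<forall>i j. (i, j + 1) \<in> diagram \<nu> \<longrightarrow> T (i, j) \<le> T (i, j + 1)) \<and>
     (\<forall>i j. (i + 1, j) \<in> diagram \<nu> \<longrightarrow> T (i, j) < T (i + 1, j)) \<and>
     (\<forall>x. x \<notin> diagram \<nu> \<longrightarrow> T x = 0)"

definition schur1 :: "partition \<Rightarrow> unit symf" where
  "schur1 \<nu> = Series (\<lambda>M. of_nat (card {T. semistandard \<nu> T \<and>
     image_mset (\<lambda>x. ((), T x)) (mset_set (diagram \<nu>)) = M}))"

definition Par_family :: "('i \<Rightarrow> partition) set" where
  "Par_family = {\<alpha>. (\<forall>i. \<alpha> i \<in> Par) \<and> finite {i. \<alpha> i \<noteq> []}}"

definition schur :: "('i \<Rightarrow> partition) \<Rightarrow> 'i symf" where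
  "schur \<alpha> = (\<Prod>i | \<alpha> i \<noteq> []. in_alphabet i (schur1 (\<alpha> i)))"

text \<open>
  Every series that is symmetric in each alphabet has a unique, possibly infinite, expansion in the
  products of Schur functions. The Hall inner product makes these products orthonormal; its first
  argument may be in the completion.
\<close>

definition schur_coeffs :: "'i symf \<Rightarrow> ('i \<Rightarrow> partition) \<Rightarrow> rf" where
  "schur_coeffs F = (THE c. (\<forall>\<alpha>. \<alpha> \<notin> Par_family \<longrightarrow> c \<alpha> = 0) \<and>
     F = formal_sum Par_family (\<lambda>\<alpha>. mscale (c \<alpha>) (schur \<alpha>)))"

definition hall :: "'i symf \<Rightarrow> 'i symf \<Rightarrow> rf" where
  "hall F G = (\<Sum>\<alpha> | schur_coeffs F \<alpha> * schur_coeffs G \<alpha> \<noteq> 0.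
     schur_coeffs F \<alpha> * schur_coeffs G \<alpha>)"

text \<open>
  A polynomial in indeterminates \<open>(i, r)\<close> is a finitely supported function on multisets of pairs
  \<open>(i, r)\<close>; \<open>eval_psum \<phi> c\<close> substitutes \<open>\<phi> i r\<close> for \<open>(i, r)\<close>. The expression of a symmetric function
  as a polynomial in the \<open>p_r(x^(i))\<close>, \<open>r > 0\<close>, is unique, so \<open>plethysm M F\<close> is \<open>F[M x]\<close>.
\<close>

definition eval_psum ::
  "('i \<Rightarrow> nat \<Rightarrow> 'i symf) \<Rightarrow> (('i \<times> nat) multiset \<Rightarrow>\<^sub>0 rf) \<Rightarrow> 'i symf" where
  "eval_psum \<phi> c = (\<Sum>A\<in>Poly_Mapping.keys c.
     mscale (Poly_Mapping.lookup c A) (\<Prod>(i, r)\<in>#A. \<phi> i r))"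

definition psum_expansion :: "'i symf \<Rightarrow> (('i \<times> nat) multiset \<Rightarrow>\<^sub>0 rf)" where
  "psum_expansion F = (THE c.
     (\<forall>A\<in>Poly_Mapping.keys c. \<forall>(i, r)\<in>#A. 0 < r) \<and>
     F = eval_psum (\<lambda>i r. in_alphabet i (power_sum r)) c)"

definition plethysm :: "rf ^ 'i ^ 'i \<Rightarrow> 'i symf \<Rightarrow> ('i::finite) symf" where
  "plethysm M F = eval_psum
     (\<lambda>i r. \<Sum>k\<in>UNIV. mscale (adams_rf r (M $ i $ k)) (in_alphabet k (power_sum r)))
     (psum_expansion F)"


section \<open>Macdonald polynomials\<close>

definition hook_factor :: "partition \<Rightarrow> rf \<Rightarrow> rf \<Rightarrow> rf \<Rightarrow> nat \<times> nat \<Rightarrow> rf" where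
  "hook_factor \<nu> u z w x =
     (z ^ (arm \<nu> x + 1) - u * w ^ leg \<nu> x) * (z ^ arm \<nu> x - inverse u * w ^ (leg \<nu> x + 1))"

definition N :: "partition \<Rightarrow> rf \<Rightarrow> rf \<Rightarrow> rf \<Rightarrow> rf" where
  "N \<nu> u z w = (\<Prod>x\<in>diagram \<nu>. hook_factor \<nu> u z w x)"

definition is_macdonald :: "partition \<Rightarrow> unit symf \<Rightarrow> bool" where
  "is_macdonald \<nu> H \<longleftrightarrow> H \<in> Sym \<and>
     plethysm (mat (1 - zz)) H
       \<in> mseries.span {schur (\<lambda>_. \<mu>) | \<mu>. \<mu> \<in> Par \<and> dominates \<mu> \<nu>} \<and>
     plethysm (mat (1 - ww)) H
       \<in> mseries.span {schur (\<lambda>_. \<mu>) | \<mu>. \<mu> \<in> Par \<and> dominates \<mu> (dual \<nu>)} \<and>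
     hall H (schur (\<lambda>_. row (sum_list \<nu>))) = 1"

text \<open>
  That \<open>is_macdonald \<nu>\<close> has exactly one solution for every \<open>\<nu> \<in> Par\<close> is a theorem, so the value 0
  below is never used; likewise for the wreath version.
\<close>

definition macdonald :: "partition \<Rightarrow> unit symf" where
  "macdonald \<nu> = (if \<exists>!H. is_macdonald \<nu> H then THE H. is_macdonald \<nu> H else 0)"

definition Mz :: "rf ^ 2 ^ 2" where "Mz = (\<chi> i k. if i = k then 1 else - zz)"
definition Mw :: "rf ^ 2 ^ 2" where "Mw = (\<chi> i k. if i = k then 1 else - ww)"
definition neg_swap :: "rf ^ 2 ^ 2" where "neg_swap = (\<chi> i k. if i = k then 0 else - 1)"

definition is_wreath_macdonald :: "partition2 \<Rightarrow> 2 symf \<Rightarrow> bool" where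
  "is_wreath_macdonald \<alpha> H \<longleftrightarrow> H \<in> Sym \<and>
     plethysm Mz H \<in> mseries.span {schur \<beta> | \<beta>. \<beta> \<in> Par2 \<and> dominates2 \<beta> \<alpha>} \<and>
     plethysm Mw H \<in> mseries.span {schur \<beta> | \<beta>. \<beta> \<in> Par2 \<and> dominates2 \<beta> (dual2 \<alpha>)} \<and>
     hall H (schur (\<lambda>i. if i = 0 then row (size2 \<alpha>) else [])) = 1"

definition wreath_macdonald :: "partition2 \<Rightarrow> 2 symf" where
  "wreath_macdonald \<alpha> =
     (if \<exists>!H. is_wreath_macdonald \<alpha> H then THE H. is_wreath_macdonald \<alpha> H else 0)"

definition wreath_pairing :: "2 symf \<Rightarrow> 2 symf \<Rightarrow> rf" where
  "wreath_pairing F G = hall F (plethysm (neg_swap ** Mz ** Mw) G)"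

definition N_wreath :: "partition2 \<Rightarrow> rf" where
  "N_wreath \<alpha> = wreath_pairing (wreath_macdonald \<alpha>) (wreath_macdonald \<alpha>)"

definition N_cot :: "partition2 \<Rightarrow> rf \<Rightarrow> rf \<Rightarrow> rf \<Rightarrow> rf" where
  "N_cot \<alpha> u z w = (let \<nu> = from_quotient \<alpha> in
     \<Prod>x | x \<in> diagram \<nu> \<and> even (hook \<nu> x). hook_factor \<nu> u z w x)"

definition N_nabla :: "partition2 \<Rightarrow> rf" where
  "N_nabla \<alpha> = N_wreath \<alpha> / N_cot \<alpha> 1 zz ww"

text \<open>\<open>N_wreath_u r \<alpha> u\<close> is the function \<open>N_wreath\<close> of \<open>(u, z^r, w^r)\<close>.\<close>

definition N_wreath_u :: "nat \<Rightarrow> partition2 \<Rightarrow> rf \<Rightarrow> rf" where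
  "N_wreath_u r \<alpha> u = adams_rf r (N_nabla \<alpha>) * N_cot \<alpha> u (zz ^ r) (ww ^ r)"


section \<open>The generating functions\<close>

text \<open>
  The alphabet \<open>x_j^(i)\<close> has index \<open>(j, i)\<close>. The variables of the union of \<open>x_j^(0)\<close> and \<open>x_j^(1)\<close>
  are enumerated alternately.
\<close>

definition in_x :: "nat \<Rightarrow> 2 symf \<Rightarrow> (nat \<times> 2) symf" where
  "in_x j F = rename (\<lambda>(i, n). ((j, i), n)) F"

definition in_x_union :: "nat \<Rightarrow> unit symf \<Rightarrow> (nat \<times> 2) symf" where
  "in_x_union j F = rename (\<lambda>(_, n). ((j, if even n then 0 else 1), n div 2)) F"

definition Omega_0 :: "nat \<Rightarrow> nat \<Rightarrow> (nat \<times> 2) symf" where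
  "Omega_0 g k = formal_sum Par2 (\<lambda>\<alpha>.
     mscale (N (from_quotient \<alpha>) (zz * ww) (zz\<^sup>2) (ww\<^sup>2) ^ (g + k - 1) /
             (adams_rf 2 (N_wreath \<alpha>) * N_wreath_u 2 \<alpha> (zz * ww) ^ (k - 1)))
       (\<Prod>j=1..2*k. in_x j (map_coeffs (adams_rf 2) (wreath_macdonald \<alpha>))))"

definition Omega_star :: "nat \<Rightarrow> nat \<Rightarrow> (nat \<times> 2) symf" where
  "Omega_star g k = formal_sum Par (\<lambda>\<nu>.
     mscale (N \<nu> (zz * ww) (zz\<^sup>2) (ww\<^sup>2) ^ (2 * g + k - 1) / N \<nu> 1 (zz\<^sup>2) (ww\<^sup>2))
       (\<Prod>j=1..2*k. in_x_union j (map_coeffs (adams_rf 2) (macdonald \<nu>))))"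

definition Omega_HLRV :: "nat \<Rightarrow> nat \<Rightarrow> nat symf" where
  "Omega_HLRV g k = formal_sum Par (\<lambda>\<nu>.
     mscale (N \<nu> (zz * ww) (zz\<^sup>2) (ww\<^sup>2) ^ g / N \<nu> 1 (zz\<^sup>2) (ww\<^sup>2))
       (\<Prod>j=1..2*k. in_alphabet j (map_coeffs (adams_rf 2) (macdonald \<nu>))))"

definition H_mu :: "nat \<Rightarrow> nat \<Rightarrow> (nat \<Rightarrow> partition) \<Rightarrow> rf" where
  "H_mu g k \<mu> = (zz\<^sup>2 - 1) * (1 - ww\<^sup>2) *
     hall (Log (Omega_HLRV g k)) (\<Prod>j=1..2*k. in_alphabet j (complete_h_part (\<mu> j)))"


section \<open>The conjugacy classes\<close>

definition Jmat :: "complex ^ 2 ^ 2" where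
  "Jmat = vector [vector [0, 1], vector [-1, 0]]"

definition sigma :: "complex ^ 2 ^ 2 \<Rightarrow> complex ^ 2 ^ 2" where
  "sigma h = Jmat ** transpose (matrix_inv h) ** matrix_inv Jmat"

definition diag :: "complex \<Rightarrow> complex ^ 2 ^ 2" where
  "diag a = vector [vector [a, 0], vector [0, inverse a]]"

text \<open>
  An element \<open>x \<sigma>\<close> of the coset \<open>GL_2 \<sigma>\<close> is represented by the matrix \<open>x\<close>; conjugation by
  \<open>h\<close> then maps \<open>x\<close> to \<open>h x \<sigma>(h^-1)\<close>.
\<close>

definition sigma_class :: "complex ^ 2 ^ 2 \<Rightarrow> (complex ^ 2 ^ 2) set" where
  "sigma_class x = {h ** x ** sigma (matrix_inv h) | h. invertible h}"

definition h_beta :: "nat \<Rightarrow> (complex ^ 2 ^ 2) set \<Rightarrow> (nat \<times> 2) symf" where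
  "h_beta j C = (if \<exists>a. a\<^sup>2 = 1 \<and> C = sigma_class (diag a)
     then in_alphabet (j, 0) (complete_h 1) else in_x_union j (complete_h 1))"

text \<open>Membership in the class of a central \<open>diag a\<close> can be read off from any representative.\<close>

lemma matrix_inv_eqI:
  fixes A B :: "complex ^ 'n ^ 'n"
  assumes "A ** B = mat 1" "B ** A = mat 1"
  shows "matrix_inv A = B"
proof -
  have "A ** matrix_inv A = mat 1 \<and> matrix_inv A ** A = mat 1"
    unfolding matrix_inv_def by (rule someI[of _ B]) (use assms in simp)
  then show ?thesis
    using assms by (metis matrix_mul_assoc matrix_mul_lid matrix_mul_rid)
qed

lemma times_sigma_inv:
  assumes "invertible h"
  shows "h ** sigma (matrix_inv h) = mat (det h)"
proof -
  have "Jmat ** (- Jmat) = mat 1"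
    by (simp add: Jmat_def vec_eq_iff forall_2 matrix_matrix_mult_def sum_2 mat_def)
  moreover have "(- Jmat) ** Jmat = mat 1"
    by (simp add: Jmat_def vec_eq_iff forall_2 matrix_matrix_mult_def sum_2 mat_def)
  ultimately have J: "matrix_inv Jmat = - Jmat"
    by (rule matrix_inv_eqI)
  have inv: "matrix_inv (matrix_inv h) = h"
    using assms unfolding invertible_def by (metis matrix_inv_eqI)
  show ?thesis
    unfolding sigma_def J inv
    by (simp add: Jmat_def vec_eq_iff forall_2 matrix_matrix_mult_def sum_2 mat_def
          transpose_def det_2 algebra_simps)
qed

lemma sigma_class_diag_central:
  assumes "a \<noteq> 0" "b\<^sup>2 = 1" "sigma_class (diag a) = sigma_class (diag b)"
  shows "a\<^sup>2 = 1"
proof -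
  have "mat 1 ** diag a ** sigma (matrix_inv (mat 1)) = diag a"
    using times_sigma_inv[of "mat 1"] by (simp add: invertible_def)
  then have "diag a \<in> sigma_class (diag a)"
    unfolding sigma_class_def by (auto intro!: exI[of _ "mat 1"] simp: invertible_def)
  then obtain h where h: "invertible h" "diag a = h ** diag b ** sigma (matrix_inv h)"
    using assms(3) by (auto simp: sigma_class_def)
  have "inverse b = b"
    using assms(2) by (metis inverse_unique power2_eq_square)
  then have "h ** diag b = diag b ** h"
    by (simp add: diag_def vec_eq_iff forall_2 matrix_matrix_mult_def sum_2)
  then have "diag a = diag b ** mat (det h)"
    using h by (simp add: times_sigma_inv flip: matrix_mul_assoc)
  then have "a = b * det h \<and> inverse a = inverse b * det h"
    by (simp (no_asm_use) add: diag_def vec_eq_iff forall_2 matrix_matrix_mult_def sum_2 mat_def)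
  then have "a = inverse a"
    unfolding \<open>inverse b = b\<close> by metis
  then show ?thesis
    using assms(1) by (metis power2_eq_square right_inverse)
qed

lemma h_beta_diag:
  assumes "a \<noteq> 0"
  shows "h_beta j (sigma_class (diag a)) =
    (if a\<^sup>2 = 1 then in_alphabet (j, 0) (complete_h 1) else in_x_union j (complete_h 1))"
  using sigma_class_diag_central[OF assms] by (auto simp: h_beta_def)

definition H_B :: "nat \<Rightarrow> nat \<Rightarrow> (nat \<Rightarrow> (complex ^ 2 ^ 2) set) \<Rightarrow> rf" where
  "H_B g k C = hall ((Omega_0 g k)\<^sup>2 * mseries_inverse (Omega_star g k))
     (\<Prod>j=1..2*k. h_beta j (C j))"

end

theory Submission
  imports Defs
begin

text \<open>
  Only 2-partitions of size 1 contribute to the left-hand side, because \<open>\<Prod>\<^sub>j h\<^sub>\<beta>\<close> has degree 1 in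
  each \<open>x\<^sub>j\<close>: in the relevant degree \<open>\<Omega>\<^sub>0\<^sup>2 / \<Omega>\<^sub>*\<close> is twice the degree 1 part of \<open>\<Omega>\<^sub>0\<close> minus that of
  \<open>\<Omega>\<^sub>*\<close>. On the right-hand side \<open>\<Omega>_HLRV\<close> matters in degrees 1 and 2, and \<open>Log\<close> is there
  \<open>A + B - A\<^sup>2 / 2 - \<psi>\<^sub>2 A / 2\<close>. Genericity forces some \<open>\<mu>\<^sub>j\<close> to be \<open>(1, 1)\<close>, which kills the \<open>\<psi>\<^sub>2\<close> term. The
  two wreath Macdonald polynomials \<open>x\<^sup>(\<^sup>0\<^sup>) + z x\<^sup>(\<^sup>1\<^sup>)\<close> and \<open>x\<^sup>(\<^sup>0\<^sup>) + w x\<^sup>(\<^sup>1\<^sup>)\<close> of size 1 correspond to the Macdonald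
  polynomials \<open>s\<^sub>2 + z s\<^sub>1\<^sub>1\<close> and \<open>s\<^sub>2 + w s\<^sub>1\<^sub>1\<close> of size 2, and \<open>A\<^sup>2 / 2\<close> corresponds to the term from \<open>\<Omega>\<^sub>*\<close>.

  That a Hall pairing with a product of complete functions is a coefficient rests on the existence
  of Schur expansions, that is on the symmetry of Schur functions (Bender and Knuth) and the
  triangularity of the Kostka matrix. The uniqueness of the small Macdonald polynomials among all
  symmetric functions rests on the power sums being algebraically independent generators, which
  makes plethysm by an invertible matrix invertible. For the remaining partitions only homogeneity
  of the Macdonald polynomials, or their value 0, is used.
\<close>

section \<open>The coefficient field\<close>

text \<open>\<open>schur_coeffs\<close>, \<open>psum_expansion\<close>,
  \<open>from_quotient\<close>, \<open>macdonald\<close> and \<open>Log\<close> are definite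
  descriptions, so a single coefficient can be evaluated only once existence and uniqueness among
  all admissible objects are known; most of the development serves this. The two sides match term by
  term, with q = z^2 or w^2. If (a_j)^2 = 1, the coefficient 1 of x_j^(0) in x_j^(0) + q x_j^(1)
  equals that of z_1^2 in s_2 + q s_11; otherwise both alphabets together contribute 1 + q, the
  coefficient of z_1 z_2. The factor 2 comes from the square of \<open>Omega_0\<close>. The power of
  z - w comes from the norms at u = zw: each partition of 2 has one box of hook length 2, whose
  factor is all of N^cot, and one of hook length 1, whose factor is (z - w)^2. Dividing the (g + k -
  1)-st power of their product by the (k - 1)-st power of N^cot leaves (z - w)^(2k - 2) times the
  g-th power that stands on the right.\<close>

lemma adams_poly_0 [simp]: "adams_poly r 0 = 0"
  by (simp add: adams_poly_def)

lemma adams_poly_add: "adams_poly r (p + q) = adams_poly r p + adams_poly r q"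
proof -
  have "map_poly (\<lambda>c. pcompose c (monom 1 r)) (p + q)
      = map_poly (\<lambda>c. pcompose c (monom 1 r)) p + map_poly (\<lambda>c. pcompose c (monom 1 r)) q"
    by (rule poly_eqI) (simp add: coeff_map_poly pcompose_add)
  then show ?thesis
    by (simp add: adams_poly_def pcompose_add)
qed

lemma adams_poly_mult: "adams_poly r (p * q) = adams_poly r p * adams_poly r q"
proof -
  have "map_poly (\<lambda>c. pcompose c (monom 1 r)) (p * q)
      = map_poly (\<lambda>c. pcompose c (monom 1 r)) p * map_poly (\<lambda>c. pcompose c (monom 1 r)) q"
    by (rule poly_eqI) (simp add: coeff_map_poly coeff_mult pcompose_sum pcompose_mult)
  then show ?thesis
    by (simp add: adams_poly_def pcompose_mult)
qed

lemma adams_poly_1 [simp]: "adams_poly r 1 = 1"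
  by (simp add: adams_poly_def map_poly_1' pcompose_1)

text \<open>Composition with a polynomial of positive degree is injective, here in the outer
  variable and in the coefficients. Denominators therefore stay nonzero under
  \<open>adams_rf\<close>.\<close>

lemma adams_poly_eq_0_iff:
  assumes "r > 0"
  shows "adams_poly r p = 0 \<longleftrightarrow> p = 0"
proof
  assume "adams_poly r p = 0"
  moreover have "degree (monom (1::rat) r) > 0" "degree (monom (1::rat poly) r) > 0"
    using assms by (simp_all add: degree_monom_eq)
  ultimately have "map_poly (\<lambda>c. pcompose c (monom 1 r)) p = 0"
    unfolding adams_poly_def by (meson pcompose_eq_0)
  then have "pcompose (coeff p n) (monom 1 r) = 0" for n
    by (metis coeff_0 coeff_map_poly pcompose_0)
  then show "p = 0"
    using \<open>degree (monom (1::rat) r) > 0\<close> by (metis coeff_0 pcompose_eq_0 poly_eqI)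
qed simp

text \<open>\<open>adams_poly r\<close> is multiplicative and so preserves cross-multiplied
  equalities; hence the value does not depend on the fraction chosen, which settles the description
  in \<open>adams_rf_def\<close>.\<close>

lemma adams_rf_Fract:
  assumes "r > 0" "b \<noteq> 0"
  shows "adams_rf r (Fraction_Field.Fract a b) = Fraction_Field.Fract (adams_poly r a) (adams_poly r b)"
  unfolding adams_rf_def
proof (rule the_equality)
  fix y assume "\<exists>c d. d \<noteq> 0 \<and> Fraction_Field.Fract a b = Fraction_Field.Fract c d \<and>
     y = Fraction_Field.Fract (adams_poly r c) (adams_poly r d)"
  then obtain c d where cd: "d \<noteq> 0" "a * d = c * b" "y = Fraction_Field.Fract (adams_poly r c) (adams_poly r d)"
    using assms by (auto simp: eq_fract)
  then have "adams_poly r a * adams_poly r d = adams_poly r c * adams_poly r b"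
    by (metis adams_poly_mult)
  then show "y = Fraction_Field.Fract (adams_poly r a) (adams_poly r b)"
    using cd assms by (simp add: eq_fract adams_poly_eq_0_iff)
qed (use assms in blast)

lemma adams_rf_0 [simp]: "r > 0 \<Longrightarrow> adams_rf r 0 = 0"
  and adams_rf_1 [simp]: "r > 0 \<Longrightarrow> adams_rf r 1 = 1"
  by (simp_all add: Zero_fract_def One_fract_def adams_rf_Fract)

lemma adams_rf_add: "r > 0 \<Longrightarrow> adams_rf r (x + y) = adams_rf r x + adams_rf r y"
  by (cases x; cases y)
     (simp add: adams_rf_Fract adams_poly_add adams_poly_mult adams_poly_eq_0_iff)

lemma adams_rf_mult: "r > 0 \<Longrightarrow> adams_rf r (x * y) = adams_rf r x * adams_rf r y"
  by (cases x; cases y)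
     (simp add: adams_rf_Fract adams_poly_add adams_poly_mult adams_poly_eq_0_iff)

lemma adams_rf_minus: "r > 0 \<Longrightarrow> adams_rf r (- x) = - adams_rf r x"
  by (metis add.right_inverse adams_rf_0 adams_rf_add neg_eq_iff_add_eq_0 add.commute)

lemma adams_rf_diff: "r > 0 \<Longrightarrow> adams_rf r (x - y) = adams_rf r x - adams_rf r y"
  by (simp only: diff_conv_add_uminus adams_rf_add adams_rf_minus)

lemma adams_rf_power: "r > 0 \<Longrightarrow> adams_rf r (x ^ n) = adams_rf r x ^ n"
  by (induction n) (simp_all add: adams_rf_mult)

lemma adams_rf_sum: "r > 0 \<Longrightarrow> adams_rf r (sum f A) = (\<Sum>a\<in>A. adams_rf r (f a))"
  by (induction A rule: infinite_finite_induct) (simp_all add: adams_rf_add)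

lemma adams_rf_zz: "r > 0 \<Longrightarrow> adams_rf r zz = zz ^ r"
proof -
  assume "r > 0"
  have "Fraction_Field.Fract [:monom 1 n:] 1 = zz ^ n" for n
  proof (induction n)
    case (Suc n)
    have "Fraction_Field.Fract [:monom 1 (Suc n):] 1 = zz * Fraction_Field.Fract [:monom 1 n:] 1"
      by (simp add: zz_def monom_Suc)
    then show ?case by (simp add: Suc)
  qed (simp add: One_fract_def flip: one_pCons)
  then show ?thesis
    using \<open>r > 0\<close> by (simp add: adams_rf_Fract zz_def) (simp add: adams_poly_def map_poly_pCons pcompose_pCons pcompose_1)
qed

lemma adams_rf_ww: "r > 0 \<Longrightarrow> adams_rf r ww = ww ^ r"
proof -
  assume "r > 0"
  have "Fraction_Field.Fract (monom 1 n) 1 = ww ^ n" for n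
  proof (induction n)
    case (Suc n)
    have "Fraction_Field.Fract (monom 1 (Suc n)) 1 = ww * Fraction_Field.Fract (monom 1 n) 1"
      by (simp add: ww_def monom_Suc)
    then show ?case by (simp add: Suc)
  qed (simp add: One_fract_def)
  then show ?thesis
    using \<open>r > 0\<close> by (simp add: adams_rf_Fract ww_def) (simp add: adams_poly_def map_poly_pCons pcompose_pCons pcompose_1)
qed

lemma adams_rf_one: "adams_rf 1 x = x"
proof (cases x)
  case (Fract a b)
  have "adams_poly 1 p = p" for p
    by (simp add: adams_poly_def monom_altdef map_poly_idI)
  then show ?thesis
    using Fract by (simp add: adams_rf_Fract)
qed

text \<open>The field is linearly ordered by the leading coefficients, with \<open>w\<close> larger than all powers
  of \<open>z\<close> and \<open>z\<close> larger than all rationals.\<close>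

lemma zz_gt_1: "1 < zz"
  unfolding zz_def One_fract_def by (simp add: less_poly_def pos_poly_def one_pCons)

text \<open>The exponent 3 is dictated by the factor \<open>zz ^ 3 - ww\<close> of the partition
  \<open>[2]\<close> at u = zw, which has to be nonzero.\<close>

lemma ww_gt: "zz ^ 3 < ww"
  unfolding zz_def ww_def power3_eq_cube by (simp add: less_poly_def pos_poly_def)

section \<open>Coefficients of series\<close>

lemma coeff_of_0 [simp]: "coeff_of 0 M = 0"
  and coeff_of_add [simp]: "coeff_of (F + G) M = coeff_of F M + coeff_of G M"
  and coeff_of_1: "coeff_of 1 M = (if M = {#} then 1 else 0)"
  by (simp_all add: zero_mseries.rep_eq plus_mseries.rep_eq one_mseries.rep_eq)

lemma coeff_of_diff [simp]: "coeff_of (F - G) M = coeff_of F M - coeff_of G M"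
  by (simp add: minus_mseries.rep_eq)

lemma coeff_of_mult: "coeff_of (F * G) M = (\<Sum>(A, B)\<in>splits M. coeff_of F A * coeff_of G B)"
  by (simp add: times_mseries.rep_eq)

lemma coeff_of_Series [simp]: "coeff_of (Series f) = f"
  by (simp add: Series_inverse)

lemma coeff_of_mscale [simp]: "coeff_of (mscale c F) M = c * coeff_of F M"
  by (simp add: mscale_def)

lemma coeff_of_map_coeffs [simp]: "coeff_of (map_coeffs f F) M = f (coeff_of F M)"
  by (simp add: map_coeffs_def)

lemma coeff_of_sum [simp]: "coeff_of (sum F I) M = (\<Sum>i\<in>I. coeff_of (F i) M)"
  by (induction I rule: infinite_finite_induct) auto

lemma mscale_mult_left: "mscale c F * G = mscale c (F * G)"
  by (rule mseries_eqI) (simp add: coeff_of_mult sum_distrib_left case_prod_unfold mult.assoc)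

lemma mscale_mult_right: "F * mscale c G = mscale c (F * G)"
  by (metis mscale_mult_left mult.commute)

lemma mscale_prod: "finite I \<Longrightarrow> (\<Prod>i\<in>I. mscale (c i) (F i)) = mscale (\<Prod>i\<in>I. c i) (\<Prod>i\<in>I. F i)"
  by (induction I rule: finite_induct)
     (auto intro!: mseries_eqI simp: mscale_mult_left mscale_mult_right mult_ac)

lemma splits_iff: "(A, B) \<in> splits M \<longleftrightarrow> A + B = M"
  by (simp add: splits_def)

lemma coeff_of_mult_single:
  assumes "A0 + B0 = M"
    and "\<And>A B. A + B = M \<Longrightarrow> coeff_of F A \<noteq> 0 \<Longrightarrow> coeff_of G B \<noteq> 0 \<Longrightarrow> A = A0"
  shows "coeff_of (F * G) M = coeff_of F A0 * coeff_of G B0"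
proof -
  have "coeff_of (F * G) M = (\<Sum>(A, B)\<in>{(A0, B0)}. coeff_of F A * coeff_of G B)"
    unfolding coeff_of_mult
  proof (rule sum.mono_neutral_right)
    show "\<forall>i\<in>splits M - {(A0, B0)}. (case i of (A, B) \<Rightarrow> coeff_of F A * coeff_of G B) = 0"
    proof
      fix x assume x: "x \<in> splits M - {(A0, B0)}"
      obtain A B where AB: "x = (A, B)"
        by (cases x)
      with x have *: "(A, B) \<in> splits M" "(A, B) \<noteq> (A0, B0)"
        by auto
      have "coeff_of F A = 0 \<or> coeff_of G B = 0"
      proof (rule ccontr)
        assume "\<not> ?thesis"
        then have "A = A0"
          using * assms(2) by (auto simp: splits_iff)
        then show False
          using * assms(1) by (auto simp: splits_iff)
      qed
      then show "(case x of (A, B) \<Rightarrow> coeff_of F A * coeff_of G B) = 0"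
        using AB by auto
    qed
  qed (use assms in \<open>auto simp: splits_iff\<close>)
  then show ?thesis by simp
qed

lemma coeff_of_mult_nonzero:
  assumes "coeff_of (F * G) M \<noteq> 0"
  obtains A B where "A + B = M" "coeff_of F A \<noteq> 0" "coeff_of G B \<noteq> 0"
proof -
  obtain x where "x \<in> splits M" "(case x of (A, B) \<Rightarrow> coeff_of F A * coeff_of G B) \<noteq> 0"
    using assms unfolding coeff_of_mult by (meson sum.not_neutral_contains_not_neutral)
  moreover obtain A B where "x = (A, B)"
    by (cases x)
  ultimately have "A + B = M" "coeff_of F A \<noteq> 0" "coeff_of G B \<noteq> 0"
    by (auto simp: splits_iff)
  then show ?thesis
    by (rule that)
qed

text \<open>The splittings of an image are the images of the splittings, bijectively since \<sigma>
  is injective. This is what makes products of symmetric series symmetric.\<close>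

lemma coeff_of_mult_image:
  assumes "inj \<sigma>"
  shows "coeff_of (F * G) (image_mset \<sigma> M)
    = (\<Sum>(A, B)\<in>splits M. coeff_of F (image_mset \<sigma> A) * coeff_of G (image_mset \<sigma> B))"
proof -
  have "splits (image_mset \<sigma> M) = map_prod (image_mset \<sigma>) (image_mset \<sigma>) ` splits M"
  proof (intro equalityI subsetI)
    fix x assume "x \<in> splits (image_mset \<sigma> M)"
    then obtain A B where "x = (A, B)" "image_mset \<sigma> M = A + B"
      by (cases x) (auto simp: splits_iff)
    then obtain A' B' where "M = A' + B'" "x = map_prod (image_mset \<sigma>) (image_mset \<sigma>) (A', B')"
      by (auto dest!: image_mset_eq_plusD)
    then show "x \<in> map_prod (image_mset \<sigma>) (image_mset \<sigma>) ` splits M"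
      unfolding splits_def by blast
  qed (auto simp: splits_iff)
  moreover have "inj (map_prod (image_mset \<sigma>) (image_mset \<sigma>))"
    using assms by (intro prod.inj_map multiset.inj_map)
  ultimately show ?thesis
    by (simp add: coeff_of_mult sum.reindex inj_on_subset[OF _ subset_UNIV] case_prod_unfold)
qed

lemma coeff_of_formal_sum:
  assumes "finite S" "S \<subseteq> I" "\<And>i. i \<in> I - S \<Longrightarrow> coeff_of (f i) M = 0"
  shows "coeff_of (formal_sum I f) M = (\<Sum>i\<in>S. coeff_of (f i) M)"
  unfolding formal_sum_def
  by (simp, rule sum.mono_neutral_left) (use assms in auto)

text \<open>The blocks are the fibres of \<open>b\<close>; the factors use variables of pairwise different blocks.\<close>

lemma coeff_of_prod_blocks:
  assumes "finite J"
    and "\<And>j M v. j \<in> J \<Longrightarrow> coeff_of (G j) M \<noteq> 0 \<Longrightarrow> v \<in># M \<Longrightarrow> b v = j"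
  shows "coeff_of (\<Prod>j\<in>J. G j) M =
    (if \<forall>v\<in>#M. b v \<in> J then \<Prod>j\<in>J. coeff_of (G j) {#v \<in># M. b v = j#} else 0)"
  using assms
proof (induction J arbitrary: M rule: finite_induct)
  case empty
  then show ?case by (auto simp: coeff_of_1)
next
  case (insert j J)
  have IH: "coeff_of (\<Prod>j\<in>J. G j) M =
    (if \<forall>v\<in>#M. b v \<in> J then \<Prod>j\<in>J. coeff_of (G j) {#v \<in># M. b v = j#} else 0)" for M
    using insert by blast
  have "coeff_of (G j * (\<Prod>j\<in>J. G j)) M
      = coeff_of (G j) {#v \<in># M. b v = j#} * coeff_of (\<Prod>j\<in>J. G j) {#v \<in># M. b v \<noteq> j#}"
  proof (rule coeff_of_mult_single)
    show "{#v \<in># M. b v = j#} + {#v \<in># M. b v \<noteq> j#} = M"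
      by (metis multiset_partition)
    fix A B assume *: "A + B = M" "coeff_of (G j) A \<noteq> 0" "coeff_of (\<Prod>j\<in>J. G j) B \<noteq> 0"
    then have "\<forall>v\<in>#A. b v = j" "\<forall>v\<in>#B. b v \<in> J"
      using insert.prems by (auto simp: IH split: if_splits)
    then have "filter_mset (\<lambda>v. b v = j) A = A" "filter_mset (\<lambda>v. b v = j) B = {#}"
      using \<open>j \<notin> J\<close> by (auto simp: filter_mset_eq_conv)
    then show "A = {#v \<in># M. b v = j#}"
      using *(1) by (metis add.right_neutral filter_union_mset)
  qed
  moreover have "{#v \<in># {#v \<in># M. b v \<noteq> j#}. b v = i#} = {#v \<in># M. b v = i#}" if "i \<in> J" for i
    using that insert.hyps by (auto intro!: filter_mset_cong simp: filter_filter_mset)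
  then have "coeff_of (\<Prod>j\<in>J. G j) {#v \<in># M. b v \<noteq> j#} =
     (if \<forall>v\<in>#M. b v \<in> insert j J then \<Prod>j\<in>J. coeff_of (G j) {#v \<in># M. b v = j#} else 0)"
    using insert.hyps unfolding IH by (auto intro!: prod.cong)
  ultimately show ?case
    using insert.hyps by auto
qed

section \<open>Renaming of variables\<close>

lemma image_mset_inv:
  assumes "set_mset M \<subseteq> range f"
  shows "image_mset f (image_mset (inv f) M) = M"
proof -
  have "image_mset (\<lambda>v. f (inv f v)) M = image_mset (\<lambda>v. v) M"
    by (rule image_mset_cong) (use assms in \<open>blast intro: f_inv_into_f\<close>)
  then show ?thesis
    by (simp add: image_mset.compositionality o_def)
qed

lemma coeff_of_rename_image: "inj f \<Longrightarrow> coeff_of (rename f F) (image_mset f M) = coeff_of F M"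
  by (auto simp: rename_def image_mset.compositionality o_def)

lemma coeff_of_rename_nonzero:
  assumes "inj f" "coeff_of (rename f F) L \<noteq> 0"
  obtains M where "L = image_mset f M" "coeff_of F M \<noteq> 0"
proof -
  have "set_mset L \<subseteq> range f"
    using assms by (auto simp: rename_def split: if_splits)
  then have "L = image_mset f (image_mset (inv f) L)"
    by (simp add: image_mset_inv)
  moreover from this have "coeff_of F (image_mset (inv f) L) \<noteq> 0"
    using assms by (simp add: rename_def split: if_splits)
  ultimately show ?thesis
    by (rule that)
qed

lemma rename_sum: "rename f (sum E I) = (\<Sum>i\<in>I. rename f (E i))"
  and rename_mscale: "rename f (mscale c F) = mscale c (rename f F)"
  by (auto intro!: mseries_eqI simp: rename_def)

lemma rename_1: "rename f 1 = 1"
  by (auto intro!: mseries_eqI simp: rename_def coeff_of_1)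

section \<open>Homogeneous series\<close>

definition homog :: "nat \<Rightarrow> ('v, 'a::zero) mseries \<Rightarrow> bool" where
  "homog d F \<longleftrightarrow> (\<forall>M. coeff_of F M \<noteq> 0 \<longrightarrow> size M = d)"

lemma homogD: "homog d F \<Longrightarrow> size M \<noteq> d \<Longrightarrow> coeff_of F M = 0"
  by (auto simp: homog_def)

text \<open>That 0 is homogeneous of every degree covers the default value of
  \<open>macdonald\<close> and \<open>wreath_macdonald\<close>.\<close>

lemma homog_0 [simp]: "homog d 0"
  and homog_1 [simp]: "homog 0 1"
  by (auto simp: homog_def coeff_of_1)

lemma homog_mult: "homog d F \<Longrightarrow> homog e G \<Longrightarrow> homog (d + e) (F * G)"
  unfolding homog_def by (auto elim!: coeff_of_mult_nonzero)

lemma homog_mscale: "homog d F \<Longrightarrow> homog d (mscale c F)"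
  unfolding homog_def by (metis coeff_of_mscale mult_zero_right)

lemma homog_add:
  fixes F G :: "('v, 'a::comm_ring_1) mseries"
  shows "homog d F \<Longrightarrow> homog d G \<Longrightarrow> homog d (F + G)"
  unfolding homog_def
proof (intro allI impI)
  fix M assume *: "\<forall>M. coeff_of F M \<noteq> 0 \<longrightarrow> size M = d" "\<forall>M. coeff_of G M \<noteq> 0 \<longrightarrow> size M = d"
    "coeff_of (F + G) M \<noteq> 0"
  then have "coeff_of F M \<noteq> 0 \<or> coeff_of G M \<noteq> 0"
    by auto
  then show "size M = d"
    using * by blast
qed

lemma homog_sum: "(\<And>i. i \<in> I \<Longrightarrow> homog d (F i)) \<Longrightarrow> homog d (sum F I)"
  by (induction I rule: infinite_finite_induct) (auto intro: homog_add)

lemma homog_prod: "(\<And>i. i \<in> I \<Longrightarrow> homog (d i) (F i)) \<Longrightarrow> homog (sum d I) (prod F I)"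
  by (induction I rule: infinite_finite_induct) (auto intro: homog_mult)

lemma homog_prod_mset: "(\<And>i. i \<in># I \<Longrightarrow> homog (d i) (F i)) \<Longrightarrow>
   homog (\<Sum>i\<in>#I. d i) (\<Prod>i\<in>#I. F i)"
  by (induction I) (auto intro: homog_mult)

lemma homog_rename: "inj f \<Longrightarrow> homog d F \<Longrightarrow> homog d (rename f F)"
  unfolding homog_def by (auto elim!: coeff_of_rename_nonzero)

lemma homog_map_coeffs: "f 0 = 0 \<Longrightarrow> homog d F \<Longrightarrow> homog d (map_coeffs f F)"
  unfolding homog_def by (metis coeff_of_map_coeffs)

section \<open>Series that are symmetric in each alphabet\<close>

abbreviation permute_vars :: "('i \<Rightarrow> nat \<Rightarrow> nat) \<Rightarrow> 'i \<times> nat \<Rightarrow> 'i \<times> nat" where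
  "permute_vars \<pi> \<equiv> (\<lambda>(i, n). (i, \<pi> i n))"

text \<open>The condition of \<open>Sym\<close> without the bound on the degree: the generating
  functions, their inverses and their logarithms lie only in the completion.\<close>

definition symmetric :: "('i \<times> nat, 'a::zero) mseries \<Rightarrow> bool" where
  "symmetric F \<longleftrightarrow> (\<forall>\<pi>. (\<forall>i. bij (\<pi> i)) \<longrightarrow>
     (\<forall>M. coeff_of F (image_mset (permute_vars \<pi>) M) = coeff_of F M))"

lemma symmetricD: "symmetric F \<Longrightarrow> (\<And>i. bij (\<pi> i)) \<Longrightarrow>
    coeff_of F (image_mset (permute_vars \<pi>) M) = coeff_of F M"
  by (auto simp: symmetric_def)

lemma Sym_iff: "F \<in> Sym \<longleftrightarrow> symmetric F \<and> (\<exists>d. \<forall>M. coeff_of F M \<noteq> 0 \<longrightarrow> size M \<le> d)"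
  by (auto simp: Sym_def symmetric_def)

lemma inj_permute_vars: "(\<And>i. bij (\<pi> i)) \<Longrightarrow> inj (permute_vars \<pi>)"
  by (auto simp: inj_on_def bij_def)

lemma symmetric_add:
  fixes F G :: "('i \<times> nat, 'a::comm_ring_1) mseries"
  shows "symmetric F \<Longrightarrow> symmetric G \<Longrightarrow> symmetric (F + G)"
  by (simp add: symmetric_def)

lemma symmetric_mscale: "symmetric F \<Longrightarrow> symmetric (mscale c F)"
  by (simp add: symmetric_def)

lemma symmetric_map_coeffs: "symmetric F \<Longrightarrow> symmetric (map_coeffs f F)"
  by (simp add: symmetric_def)

lemma symmetric_0 [simp]: "symmetric 0"
  and symmetric_1 [simp]: "symmetric 1"
  by (auto simp: symmetric_def coeff_of_1)

lemma symmetric_mult: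
  fixes F G :: "('i \<times> nat, 'a::comm_ring_1) mseries"
  assumes "symmetric F" "symmetric G"
  shows "symmetric (F * G)"
  unfolding symmetric_def
  by (intro allI impI)
     (simp add: coeff_of_mult_image inj_permute_vars symmetricD[OF assms(1)] symmetricD[OF assms(2)]
        flip: coeff_of_mult)

lemma symmetric_prod:
  fixes F :: "'j \<Rightarrow> ('i \<times> nat, 'a::comm_ring_1) mseries"
  shows "(\<And>j. j \<in> J \<Longrightarrow> symmetric (F j)) \<Longrightarrow> symmetric (prod F J)"
  by (induction J rule: infinite_finite_induct) (auto intro: symmetric_mult)

lemma symmetric_formal_sum:
  fixes F :: "'j \<Rightarrow> ('i \<times> nat, 'a::comm_ring_1) mseries"
  assumes "\<And>j. j \<in> J \<Longrightarrow> symmetric (F j)"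
  shows "symmetric (formal_sum J F)"
  unfolding symmetric_def
proof (intro allI impI)
  fix \<pi> :: "'i \<Rightarrow> nat \<Rightarrow> nat" and M
  assume "\<forall>i. bij (\<pi> i)"
  then have "coeff_of (F j) (image_mset (permute_vars \<pi>) M) = coeff_of (F j) M" if "j \<in> J" for j
    using assms[OF that] by (simp add: symmetric_def)
  then show "coeff_of (formal_sum J F) (image_mset (permute_vars \<pi>) M) = coeff_of (formal_sum J F) M"
    unfolding formal_sum_def by (simp, intro sum.cong) auto
qed

text \<open>A permutation within the alphabets of the target has to come from one of the source, and
  monomials outside the range of \<open>f\<close> have to stay outside, where both coefficients are
  0.\<close>

lemma symmetric_rename:
  fixes f :: "'u \<times> nat \<Rightarrow> 'v \<times> nat" and F :: "('u \<times> nat, 'a::zero) mseries"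
  assumes "inj f" "symmetric F"
    and "\<And>\<pi>. (\<And>i. bij (\<pi> i)) \<Longrightarrow> \<exists>\<rho>. (\<forall>i. bij (\<rho> i)) \<and> (\<forall>v. f (permute_vars \<rho> v) = permute_vars \<pi> (f v))"
    and range: "\<And>\<pi> v. (\<And>i. bij (\<pi> i)) \<Longrightarrow> permute_vars \<pi> v \<in> range f \<Longrightarrow> v \<in> range f"
  shows "symmetric (rename f F)"
  unfolding symmetric_def
proof (intro allI impI)
  fix \<pi> :: "'v \<Rightarrow> nat \<Rightarrow> nat" and M
  assume \<pi>: "\<forall>i. bij (\<pi> i)"
  then obtain \<rho> where \<rho>: "\<forall>i. bij (\<rho> i)" "\<And>v. f (permute_vars \<rho> v) = permute_vars \<pi> (f v)"
    using assms(3)[of \<pi>] by blast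
  show "coeff_of (rename f F) (image_mset (permute_vars \<pi>) M) = coeff_of (rename f F) M"
  proof (cases "set_mset M \<subseteq> range f")
    case True
    then have "M = image_mset f (image_mset (inv f) M)"
      by (simp add: image_mset_inv)
    then obtain L where L: "M = image_mset f L" by blast
    then have "image_mset (permute_vars \<pi>) M = image_mset f (image_mset (permute_vars \<rho>) L)"
      using \<rho>(2) by (simp add: image_mset.compositionality o_def)
    then show ?thesis
      using L \<rho> assms(1,2) by (simp add: coeff_of_rename_image symmetric_def)
  next
    case False
    then have "\<not> set_mset (image_mset (permute_vars \<pi>) M) \<subseteq> range f"
      using range \<pi> by auto blast
    then show ?thesis
      using False by (simp add: rename_def)
  qed
qed

lemma symmetric_rename_alphabets:
  fixes c :: "'u \<Rightarrow> 'v" and F :: "('u \<times> nat, 'a::zero) mseries"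
  assumes "inj c" "symmetric F"
  shows "symmetric (rename (\<lambda>(i, n). (c i, n)) F)"
proof (rule symmetric_rename)
  show "inj (\<lambda>(i, n). (c i, n))"
    using assms by (auto simp: inj_on_def)
  show "\<exists>\<rho>. (\<forall>i. bij (\<rho> i)) \<and> (\<forall>v. (case permute_vars \<rho> v of (i, n) \<Rightarrow> (c i, n))
      = permute_vars \<pi> (case v of (i, n) \<Rightarrow> (c i, n)))" if "\<And>i. bij (\<pi> i)" for \<pi> :: "'v \<Rightarrow> nat \<Rightarrow> nat"
    by (rule exI[of _ "\<lambda>i. \<pi> (c i)"]) (use that in auto)
qed (use assms in auto)

lemma symmetric_in_alphabet: "symmetric F \<Longrightarrow> symmetric (in_alphabet i F)"
  unfolding in_alphabet_def by (rule symmetric_rename_alphabets) (auto simp: inj_on_def)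

lemma symmetric_in_x: "symmetric F \<Longrightarrow> symmetric (in_x j F)"
  unfolding in_x_def using symmetric_rename_alphabets[of "\<lambda>i. (j, i)" F] by (auto simp: inj_on_def)

lemma inj_union_vars: "inj (\<lambda>(_ :: unit, n :: nat). ((j, if even n then 0 else 1 :: 2), n div 2))"
proof (rule injI)
  fix x y :: "unit \<times> nat"
  assume "(case x of (_, n) \<Rightarrow> ((j, if even n then 0 else 1 :: 2), n div 2))
    = (case y of (_, n) \<Rightarrow> ((j, if even n then 0 else 1), n div 2))"
  then have "even (snd x) = even (snd y)" "snd x div 2 = snd y div 2"
    by (auto simp: case_prod_beta split: if_splits)
  then have "snd x = snd y"
    by presburger
  then show "x = y"
    by (simp add: prod_eq_iff)
qed

lemma symmetric_in_x_union:
  assumes "symmetric F"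
  shows "symmetric (in_x_union j F)"
  unfolding in_x_union_def
proof (rule symmetric_rename[OF inj_union_vars assms])
  let ?f = "\<lambda>(_ :: unit, n :: nat). ((j, if even n then 0 else 1 :: 2), n div 2)"
  fix \<pi> :: "nat \<times> 2 \<Rightarrow> nat \<Rightarrow> nat"
  assume \<pi>: "\<And>i. bij (\<pi> i)"
  have range_f: "v \<in> range ?f \<longleftrightarrow> fst (fst v) = j" for v
  proof
    assume *: "fst (fst v) = j"
    obtain e m where v: "v = ((j, e), m)" using * by (cases v) auto
    have "v = ?f ((), 2 * m + (if e = 0 then 0 else 1))"
      using v exhaust_2[of e] by auto
    then show "v \<in> range ?f" by blast
  qed auto
  then show "permute_vars \<pi> v \<in> range ?f \<Longrightarrow> v \<in> range ?f" for v
    by (simp add: case_prod_beta)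
  \<comment> \<open>Interleaves permutations of the two alphabets: even numbers carry the first, odd
    numbers the second. The result is the permutation of the single alphabet that induces
    both.\<close>
  define R where "R = (\<lambda>(p :: 2 \<Rightarrow> nat \<Rightarrow> nat) n. if even n then 2 * p 0 (n div 2) else Suc (2 * p 1 (n div 2)))"
  have R: "R p (R q n) = n" if "\<And>e n. p e (q e n) = n" for p q n
    by (auto simp: R_def that)
  have "bij (R (\<lambda>e. \<pi> (j, e)))"
    by (rule o_bij[of "R (\<lambda>e. inv (\<pi> (j, e)))"])
       (auto simp: fun_eq_iff intro!: R simp: bij_is_inj[OF \<pi>] bij_is_surj[OF \<pi>] surj_f_inv_f)
  moreover have "?f (permute_vars (\<lambda>_. R (\<lambda>e. \<pi> (j, e))) v) = permute_vars \<pi> (?f v)" for v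
    by (auto simp: R_def case_prod_beta)
  ultimately show "\<exists>\<rho>. (\<forall>i. bij (\<rho> i)) \<and> (\<forall>v. ?f (permute_vars \<rho> v) = permute_vars \<pi> (?f v))"
    by (intro exI[of _ "\<lambda>_. R (\<lambda>e. \<pi> (j, e))"]) blast
qed

subsection \<open>Types of monomials\<close>

text \<open>The exponents occurring in each alphabet, with the names of the variables forgotten. The
  coefficient of a symmetric series depends on this alone, and it also indexes the products of power
  sums.\<close>

definition mtype :: "('i \<times> nat) multiset \<Rightarrow> ('i \<times> nat) multiset" where
  "mtype M = image_mset (\<lambda>v. (fst v, count M v)) (mset_set (set_mset M))"

definition decreasing :: "('i \<times> nat) multiset \<Rightarrow> bool" where
  "decreasing M \<longleftrightarrow> (\<forall>i n. count M (i, Suc n) \<le> count M (i, n))"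

abbreviation swap_vars :: "'i \<Rightarrow> nat \<Rightarrow> 'i \<times> nat \<Rightarrow> 'i \<times> nat" where
  "swap_vars i n \<equiv> permute_vars (\<lambda>i'. if i' = i then Transposition.transpose n (Suc n) else id)"

lemma count_image_mset_inj: "inj \<sigma> \<Longrightarrow> count (image_mset \<sigma> M) (\<sigma> v) = count M v"
  by (induction M) (auto dest: injD)

lemma bij_swap: "bij (if i' = i then Transposition.transpose n (Suc n) else id)"
  by auto

lemma mtype_permute:
  assumes "\<And>i. bij (\<pi> i)"
  shows "mtype (image_mset (permute_vars \<pi>) M) = mtype M"
proof -
  have inj: "inj (permute_vars \<pi>)"
    by (rule inj_permute_vars[OF assms])
  have "mset_set (permute_vars \<pi> ` set_mset M) = image_mset (permute_vars \<pi>) (mset_set (set_mset M))"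
    by (rule image_mset_mset_set[symmetric]) (rule inj_on_subset[OF inj subset_UNIV])
  then have "mtype (image_mset (permute_vars \<pi>) M)
      = image_mset (\<lambda>v. (fst (permute_vars \<pi> v), count (image_mset (permute_vars \<pi>) M) (permute_vars \<pi> v)))
          (mset_set (set_mset M))"
    by (simp add: mtype_def image_mset.compositionality o_def del: split_paired_All)
  also have "\<dots> = mtype M"
    unfolding count_image_mset_inj[OF inj] mtype_def by (simp add: case_prod_beta)
  finally show ?thesis .
qed

text \<open>Exchanging the exponents of two neighbouring variables in the wrong order lowers the sum
  of the variable indices, counted with multiplicity, so sorting terminates. The last clause
  transports any function that is invariant under such exchanges.\<close>

lemma bubble_sort:
  "\<exists>M'. decreasing M' \<and> mtype M' = mtype M \<and>
     (\<forall>K :: ('i \<times> nat) multiset \<Rightarrow> 'b. (\<forall>i n L. K (image_mset (swap_vars i n) L) = K L) \<longrightarrow> K M' = K M)"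
proof (induction "\<Sum>v\<in>#M. snd v" arbitrary: M rule: less_induct)
  case (less M)
  show ?case
  proof (cases "decreasing M")
    case False
    then obtain i n where lt: "count M (i, n) < count M (i, Suc n)"
      by (auto simp: decreasing_def not_le)
    define R where "R = {#v \<in># M. v \<noteq> (i, n) \<and> v \<noteq> (i, Suc n)#}"
    have M: "M = replicate_mset (count M (i, n)) (i, n) + replicate_mset (count M (i, Suc n)) (i, Suc n) + R"
      by (rule multiset_eqI) (auto simp: R_def)
    have R: "image_mset (swap_vars i n) R = R"
    proof -
      have "swap_vars i n v = v" if "v \<in># R" for v
        using that by (cases v) (auto simp: R_def Transposition.transpose_def)
      then show ?thesis
        by (simp cong: image_mset_cong)
    qed
    have "(\<Sum>v\<in>#image_mset (swap_vars i n) M. snd v) < (\<Sum>v\<in>#M. snd v)"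
      by (subst (1 2) M) (use R lt in simp)
    from less[OF this] obtain M' where
      "decreasing M'" "mtype M' = mtype (image_mset (swap_vars i n) M)"
      "\<forall>K :: ('i \<times> nat) multiset \<Rightarrow> 'b. (\<forall>i n L. K (image_mset (swap_vars i n) L) = K L) \<longrightarrow>
         K M' = K (image_mset (swap_vars i n) M)"
      by blast
    then show ?thesis
      using mtype_permute[of "\<lambda>i'. if i' = i then Transposition.transpose n (Suc n) else id" M, OF bij_swap]
      by (intro exI[of _ M']) auto
  qed blast
qed

lemma downward_closed_nat:
  assumes "finite S" "\<And>m n. n \<in> S \<Longrightarrow> m \<le> n \<Longrightarrow> m \<in> S"
  shows "S = {..<card S}"
proof (cases "S = {}")
  case False
  then have "Max S \<in> S"
    using assms(1) by simp
  then have "S = {..Max S}"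
    using assms(1) by (auto intro: assms(2))
  then show ?thesis
    by (metis card_atMost lessThan_Suc_atMost)
qed auto

text \<open>In a sorted monomial the variables of one alphabet with exponent at least t > 0 form an
  initial segment, and \<open>mtype\<close> determines its length.\<close>

lemma decreasing_unique:
  assumes "decreasing M" "decreasing M'" "mtype M = mtype M'"
  shows "M = M'"
proof -
  have card: "card {n. count M (i, n) \<ge> t} = size {#x \<in># mtype M. fst x = i \<and> snd x \<ge> t#}"
    and init: "{n. count M (i, n) \<ge> t} = {..<card {n. count M (i, n) \<ge> t}}"
    if "t > 0" "decreasing M" for M :: "('a \<times> nat) multiset" and t i
  proof -
    let ?S = "{n. count M (i, n) \<ge> t}"
    have eq: "{v \<in> set_mset M. fst v = i \<and> count M v \<ge> t} = Pair i ` ?S"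
      using \<open>t > 0\<close> by (auto simp: image_iff) (metis count_inI le_zero_eq less_not_refl)
    have fin: "finite (Pair i ` ?S)"
      unfolding eq[symmetric] by simp
    then show "card ?S = size {#x \<in># mtype M. fst x = i \<and> snd x \<ge> t#}"
      by (simp add: mtype_def filter_mset_image_mset eq card_image inj_on_def)
    have "finite ?S"
      using fin by (rule finite_imageD) (simp add: inj_on_def)
    moreover have "decseq (\<lambda>n. count M (i, n))"
      using \<open>decreasing M\<close> by (simp add: decreasing_def decseq_Suc_iff)
    then have "m \<in> ?S" if "n \<in> ?S" "m \<le> n" for m n
      using that decseqD[of "\<lambda>n. count M (i, n)" m n] by simp
    ultimately show "?S = {..<card ?S}"
      by (rule downward_closed_nat)
  qed
  have ge_iff: "count M (i, n) \<ge> t \<longleftrightarrow> count M' (i, n) \<ge> t" for t i n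
  proof (cases "t = 0")
    case False
    then have "{n. count M (i, n) \<ge> t} = {n. count M' (i, n) \<ge> t}"
      using card[of t M i] card[of t M' i] init[of t M i] init[of t M' i] assms by simp
    then show ?thesis by blast
  qed simp
  show ?thesis
    by (rule multiset_eqI) (metis ge_iff order.refl order_antisym surj_pair)
qed

lemma swap_invariant_mtype:
  assumes "\<And>i n L. K (image_mset (swap_vars i n) L) = K L" "mtype M = mtype M'"
  shows "K M = K M'"
proof -
  obtain L where L: "decreasing L" "mtype L = mtype M" "K L = K M"
    using bubble_sort[of M] assms(1) by blast
  obtain L' where L': "decreasing L'" "mtype L' = mtype M'" "K L' = K M'"
    using bubble_sort[of M'] assms(1) by blast
  show ?thesis
    using decreasing_unique[OF L(1) L'(1)] L L' assms(2) by simp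
qed

text \<open>\<open>symmetric\<close> speaks of arbitrary bijections of the alphabets, but they
  preserve \<open>mtype\<close>, and a monomial is sorted by finitely many adjacent exchanges. This
  is the form in which the Bender-Knuth involution yields symmetry.\<close>

lemma symmetric_swapI:
  assumes "\<And>i n M. coeff_of F (image_mset (swap_vars i n) M) = coeff_of F M"
  shows "symmetric F"
  unfolding symmetric_def using swap_invariant_mtype[of "coeff_of F", OF assms] mtype_permute by blast

lemma symmetric_mtype: "symmetric F \<Longrightarrow> mtype M = mtype M' \<Longrightarrow> coeff_of F M = coeff_of F M'"
  by (rule swap_invariant_mtype[of "coeff_of F"]) (rule symmetricD[OF _ bij_swap])

subsection \<open>Families of partitions as monomials\<close>

text \<open>The leading monomial of \<open>schur \<alpha>\<close>, with the parts as exponents in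
  their order. \<open>Abs_multiset\<close> is meaningful on \<open>Par_family\<close>, where the
  support is finite.\<close>

definition cont :: "('i \<Rightarrow> partition) \<Rightarrow> ('i \<times> nat) multiset" where
  "cont \<alpha> = Abs_multiset (\<lambda>(i, n). part (\<alpha> i) n)"

lemma part_ge_length: "length \<nu> \<le> n \<Longrightarrow> part \<nu> n = 0"
  by (simp add: nth_default_def)

lemma count_cont:
  assumes "\<alpha> \<in> Par_family"
  shows "count (cont \<alpha>) (i, n) = part (\<alpha> i) n"
proof -
  have "{x. 0 < (\<lambda>(i, n). part (\<alpha> i) n) x} \<subseteq> (SIGMA i:{i. \<alpha> i \<noteq> []}. {..<length (\<alpha> i)})"
    by (auto simp: nth_default_def split: if_splits)
  moreover have "finite (SIGMA i:{i. \<alpha> i \<noteq> []}. {..<length (\<alpha> i)})"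
    using assms by (auto simp: Par_family_def)
  ultimately have "finite {x. 0 < (\<lambda>(i, n). part (\<alpha> i) n) x}"
    by (rule finite_subset)
  then show ?thesis
    by (simp add: cont_def)
qed

lemma Par_part_pos: "\<nu> \<in> Par \<Longrightarrow> n < length \<nu> \<Longrightarrow> part \<nu> n > 0"
  by (auto simp: Par_def nth_default_def) (metis gr0I nth_mem)

lemma Par_part_mono:
  assumes "\<nu> \<in> Par" "m \<le> n"
  shows "part \<nu> n \<le> part \<nu> m"
proof (cases "m = n \<or> length \<nu> \<le> n")
  case False
  then show ?thesis
    using assms by (auto simp: Par_def nth_default_def sorted_wrt_iff_nth_less)
qed (auto simp: part_ge_length)

lemma Par_eqI:
  assumes "\<nu> \<in> Par" "\<mu> \<in> Par" "\<And>n. part \<nu> n = part \<mu> n"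
  shows "\<nu> = \<mu>"
proof -
  have "length \<nu> = length \<mu>"
    using assms by (metis Par_part_pos not_less_iff_gr_or_eq part_ge_length less_or_eq_imp_le)
  then show ?thesis
    using assms(3) by (metis nth_default_nth nth_equalityI)
qed

lemma decreasing_cont: "\<alpha> \<in> Par_family \<Longrightarrow> decreasing (cont \<alpha>)"
  by (auto simp: decreasing_def count_cont Par_part_mono Par_family_def)

lemma decreasing_imp_cont:
  assumes "decreasing M"
  obtains \<alpha> where "\<alpha> \<in> Par_family" "cont \<alpha> = M"
proof -
  have anti: "count M (i, n) \<le> count M (i, m)" if "m \<le> n" for m n i
  proof -
    have "decseq (\<lambda>n. count M (i, n))"
      using assms by (simp add: decreasing_def decseq_Suc_iff)
    then show ?thesis
      using that by (rule decseqD)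
  qed
  define l where "l i = card {n. count M (i, n) > 0}" for i
  have l: "count M (i, n) > 0 \<longleftrightarrow> n < l i" for i n
  proof -
    have "finite (Pair i ` {n. count M (i, n) > 0})"
      by (rule finite_subset[of _ "set_mset M"]) auto
    then have "finite {n. count M (i, n) > 0}"
      by (rule finite_imageD) (simp add: inj_on_def)
    moreover have "m \<in> {n. count M (i, n) > 0}" if "n \<in> {n. count M (i, n) > 0}" "m \<le> n" for m n
      using that anti[of m n i] unfolding mem_Collect_eq by linarith
    ultimately have "{n. count M (i, n) > 0} = {..<l i}"
      unfolding l_def by (rule downward_closed_nat)
    then show ?thesis by blast
  qed
  define \<alpha> where "\<alpha> i = map (\<lambda>n. count M (i, n)) [0..<l i]" for i
  have part: "part (\<alpha> i) n = count M (i, n)" for i n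
    using l[of i n] by (cases "n < l i") (auto simp: \<alpha>_def nth_default_def not_in_iff)
  have "0 \<notin> set (\<alpha> i)" for i
    by (auto simp: \<alpha>_def) (metis l less_irrefl)
  then have "\<alpha> i \<in> Par" for i
    using anti[of _ _ i] by (auto simp: Par_def sorted_wrt_iff_nth_less) (simp add: \<alpha>_def)
  moreover have "finite {i. \<alpha> i \<noteq> []}"
  proof (rule finite_subset)
    show "{i. \<alpha> i \<noteq> []} \<subseteq> fst ` set_mset M"
    proof
      fix i assume "i \<in> {i. \<alpha> i \<noteq> []}"
      then have "count M (i, 0) > 0"
        using l[of i 0] by (auto simp: \<alpha>_def)
      then show "i \<in> fst ` set_mset M"
        by force
    qed
  qed auto
  ultimately have "\<alpha> \<in> Par_family"
    by (auto simp: Par_family_def)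
  moreover have "cont \<alpha> = M"
    using \<open>\<alpha> \<in> Par_family\<close> by (intro multiset_eqI) (auto simp: count_cont part split_paired_all)
  ultimately show ?thesis
    by (rule that)
qed

text \<open>Every monomial can be sorted, and the sorted monomials are exactly those of families of
  partitions.\<close>

lemma symmetric_eqI:
  fixes F G :: "('i \<times> nat, 'a::zero) mseries"
  assumes "symmetric F" "symmetric G"
    and "\<And>\<alpha>. \<alpha> \<in> Par_family \<Longrightarrow> coeff_of F (cont \<alpha>) = coeff_of G (cont \<alpha>)"
  shows "F = G"
proof (rule mseries_eqI)
  fix M :: "('i \<times> nat) multiset"
  obtain M' :: "('i \<times> nat) multiset" where "decreasing M'" "mtype M' = mtype M"
    using bubble_sort[of M] by blast
  moreover then obtain \<alpha> where "\<alpha> \<in> Par_family" "cont \<alpha> = M'"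
    by (blast elim: decreasing_imp_cont)
  ultimately show "coeff_of F M = coeff_of G M"
    using assms symmetric_mtype by metis
qed

section \<open>Schur functions\<close>

lemma diagram_Sigma: "diagram \<nu> = (SIGMA i:{..<length \<nu>}. {..<part \<nu> i})"
  by (auto simp: diagram_def nth_default_def split: if_splits)

lemma finite_diagram [simp]: "finite (diagram \<nu>)"
  by (auto simp: diagram_Sigma)

lemma mem_diagram [simp]: "(i, j) \<in> diagram \<nu> \<longleftrightarrow> j < part \<nu> i"
  by (simp add: diagram_def)

lemma sum_list_part: "length \<nu> \<le> n \<Longrightarrow> (\<Sum>i<n. part \<nu> i) = sum_list \<nu>"
proof -
  assume "length \<nu> \<le> n"
  then have "(\<Sum>i<n. part \<nu> i) = (\<Sum>i<length \<nu>. part \<nu> i)"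
    by (intro sum.mono_neutral_right) (auto simp: part_ge_length)
  then show ?thesis
    by (simp add: sum_list_sum_nth atLeast0LessThan nth_default_nth)
qed

lemma card_diagram: "card (diagram \<nu>) = sum_list \<nu>"
  by (simp add: diagram_Sigma sum_list_part)

lemma card_diagram_rows: "card {x \<in> diagram \<nu>. fst x < n} = (\<Sum>i<n. part \<nu> i)"
proof -
  have "{x \<in> diagram \<nu>. fst x < n} = (SIGMA i:{..<n}. {..<part \<nu> i})"
    by auto
  then show ?thesis
    by simp
qed

lemma count_image_mset_set:
  "finite D \<Longrightarrow> count (image_mset f (mset_set D)) y = card {x \<in> D. f x = y}"
  by (simp add: count_image_mset') (metis (mono_tags, lifting) Collect_cong)

subsection \<open>The Bender-Knuth involution\<close>

text \<open>The number of entries below \<open>n\<close> in row \<open>r\<close>: a tableau is determined by these numbers, and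
  the entries \<open>n\<close> and \<open>n + 1\<close> can be exchanged by reflecting each of the independent intervals
  in which the numbers of entries below \<open>n + 1\<close> may vary.\<close>

definition entries_below :: "partition \<Rightarrow> (nat \<times> nat \<Rightarrow> nat) \<Rightarrow> nat \<Rightarrow> nat \<Rightarrow> nat" where
  "entries_below \<nu> T n r = card {c. c < part \<nu> r \<and> T (r, c) < n}"

text \<open>With the entries below n and those below n + 2 kept in place, the entries up to n in row
  r can reach neither beyond those below n + 2 in that row nor, since columns are strict, beyond the
  entries below n of the row above. The lower end is the corresponding constraint from the entries
  below n in the row and from the row underneath.\<close>

definition upper_end :: "partition \<Rightarrow> (nat \<times> nat \<Rightarrow> nat) \<Rightarrow> nat \<Rightarrow> nat \<Rightarrow> nat" where
  "upper_end \<nu> T n r = (if r = 0 then entries_below \<nu> T (n + 2) r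
     else min (entries_below \<nu> T (n + 2) r) (entries_below \<nu> T n (r - 1)))"

definition lower_end :: "partition \<Rightarrow> (nat \<times> nat \<Rightarrow> nat) \<Rightarrow> nat \<Rightarrow> nat \<Rightarrow> nat" where
  "lower_end \<nu> T n r = max (entries_below \<nu> T (n + 2) (Suc r)) (entries_below \<nu> T n r)"

definition reflected :: "partition \<Rightarrow> (nat \<times> nat \<Rightarrow> nat) \<Rightarrow> nat \<Rightarrow> nat \<Rightarrow> nat" where
  "reflected \<nu> T n r = lower_end \<nu> T n r + upper_end \<nu> T n r - entries_below \<nu> T (n + 1) r"

definition bender_knuth :: "partition \<Rightarrow> nat \<Rightarrow> (nat \<times> nat \<Rightarrow> nat) \<Rightarrow> nat \<times> nat \<Rightarrow> nat" where
  "bender_knuth \<nu> n T = (\<lambda>(r, c). if c < part \<nu> r \<and> (T (r, c) = n \<or> T (r, c) = n + 1)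
     then (if c < reflected \<nu> T n r then n else n + 1) else T (r, c))"

context
  fixes \<nu> :: partition and n :: nat and T :: "nat \<times> nat \<Rightarrow> nat"
  assumes Par: "\<nu> \<in> Par" and T: "semistandard \<nu> T"
begin

lemma row_mono: "c < part \<nu> r \<Longrightarrow> c' \<le> c \<Longrightarrow> T (r, c') \<le> T (r, c)"
proof (induction c)
  case (Suc c)
  have "T (r, c) \<le> T (r, Suc c)"
    using T Suc.prems by (simp add: semistandard_def)
  then show ?case
    using Suc by (cases "c' = Suc c") auto
qed simp

lemma column_strict: "c < part \<nu> (Suc r) \<Longrightarrow> T (r, c) < T (Suc r, c)"
  using T by (simp add: semistandard_def)

lemma less_entries_below: "c < part \<nu> r \<Longrightarrow> T (r, c) < m \<longleftrightarrow> c < entries_below \<nu> T m r"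
proof -
  assume c: "c < part \<nu> r"
  have "{c. c < part \<nu> r \<and> T (r, c) < m} = {..<entries_below \<nu> T m r}"
    unfolding entries_below_def
  proof (rule downward_closed_nat)
    fix a b assume "b \<in> {c. c < part \<nu> r \<and> T (r, c) < m}" "a \<le> b"
    then show "a \<in> {c. c < part \<nu> r \<and> T (r, c) < m}"
      using row_mono[of b r a] by auto
  qed simp
  then show ?thesis
    using c by blast
qed

lemma entries_below_le: "entries_below \<nu> T m r \<le> part \<nu> r"
proof -
  have "card {c. c < part \<nu> r \<and> T (r, c) < m} \<le> card {..<part \<nu> r}"
    by (rule card_mono) auto
  then show ?thesis
    by (simp add: entries_below_def)
qed

lemma entries_below_mono: "m \<le> m' \<Longrightarrow> entries_below \<nu> T m r \<le> entries_below \<nu> T m' r"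
  unfolding entries_below_def by (rule card_mono) auto

text \<open>Strictness of columns in terms of numbers: above an entry less than m + 1 stands an
  entry less than m.\<close>

lemma entries_below_Suc: "entries_below \<nu> T (Suc m) (Suc r) \<le> entries_below \<nu> T m r"
proof (rule ccontr)
  let ?c = "entries_below \<nu> T m r"
  assume "\<not> ?thesis"
  then have c: "?c < entries_below \<nu> T (Suc m) (Suc r)" by simp
  then have "?c < part \<nu> (Suc r)"
    using entries_below_le[of "Suc m" "Suc r"] by linarith
  moreover from this have "?c < part \<nu> r"
    using Par_part_mono[OF Par, of r "Suc r"] by linarith
  ultimately show False
    using c less_entries_below[of ?c "Suc r" "Suc m"] less_entries_below[of ?c r m] column_strict[of ?c r]
    by auto
qed

lemma interval:
  "lower_end \<nu> T n r \<le> entries_below \<nu> T (n + 1) r" "entries_below \<nu> T (n + 1) r \<le> upper_end \<nu> T n r"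
proof -
  show "lower_end \<nu> T n r \<le> entries_below \<nu> T (n + 1) r"
    using entries_below_Suc[of "n + 1" r] entries_below_mono[of n "n + 1" r]
    by (simp add: lower_end_def)
  show "entries_below \<nu> T (n + 1) r \<le> upper_end \<nu> T n r"
    using entries_below_Suc[of n "r - 1"] entries_below_mono[of "n + 1" "n + 2" r]
    by (auto simp: upper_end_def)
qed

lemma reflected_bounds:
  "entries_below \<nu> T n r \<le> reflected \<nu> T n r" "entries_below \<nu> T (n + 2) (Suc r) \<le> reflected \<nu> T n r"
  "reflected \<nu> T n r \<le> entries_below \<nu> T (n + 2) r" "reflected \<nu> T n (Suc r) \<le> entries_below \<nu> T n r"
  using interval[of r] interval[of "Suc r"]
  unfolding reflected_def by (auto simp: lower_end_def upper_end_def split: if_splits)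

lemma bk_less:
  assumes "c < part \<nu> r"
  shows "bender_knuth \<nu> n T (r, c) < n \<longleftrightarrow> T (r, c) < n" "bender_knuth \<nu> n T (r, c) < n + 2 \<longleftrightarrow> T (r, c) < n + 2"
    "bender_knuth \<nu> n T (r, c) < n + 1 \<longleftrightarrow> c < reflected \<nu> T n r"
    "m \<noteq> n \<Longrightarrow> m \<noteq> n + 1 \<Longrightarrow> bender_knuth \<nu> n T (r, c) = m \<longleftrightarrow> T (r, c) = m"
  using assms less_entries_below[of c r n] less_entries_below[of c r "n + 2"] reflected_bounds[of r]
  by (auto simp: bender_knuth_def)

lemma semistandard_bk: "semistandard \<nu> (bender_knuth \<nu> n T)"
  unfolding semistandard_def
proof (intro conjI allI impI)
  fix i j assume "(i, j + 1) \<in> diagram \<nu>"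
  then have "j + 1 < part \<nu> i" "j < part \<nu> i" by auto
  then show "bender_knuth \<nu> n T (i, j) \<le> bender_knuth \<nu> n T (i, j + 1)"
    using row_mono[of "j + 1" i j] by (auto simp: bender_knuth_def)
next
  fix i j assume "(i + 1, j) \<in> diagram \<nu>"
  then have j: "j < part \<nu> (Suc i)" by simp
  then have j': "j < part \<nu> i"
    using Par_part_mono[OF Par, of i "Suc i"] by linarith
  show "bender_knuth \<nu> n T (i, j) < bender_knuth \<nu> n T (i + 1, j)"
  proof (cases "T (i, j) = n \<and> T (Suc i, j) = n + 1")
    case True
    then have "j < entries_below \<nu> T (n + 2) (Suc i)" "\<not> j < entries_below \<nu> T n i"
      using less_entries_below[OF j, of "n + 2"] less_entries_below[OF j', of n] by auto
    then have "j < reflected \<nu> T n i" "\<not> j < reflected \<nu> T n (Suc i)"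
      using reflected_bounds[of i] by auto
    then show ?thesis
      using True j j' by (simp add: bender_knuth_def)
  next
    case False
    then show ?thesis
      using column_strict[OF j] j j' by (auto simp: bender_knuth_def)
  qed
next
  fix x assume "x \<notin> diagram \<nu>"
  then show "bender_knuth \<nu> n T x = 0"
    using T by (cases x) (auto simp: bender_knuth_def semistandard_def)
qed

lemma entries_below_bk:
  "entries_below \<nu> (bender_knuth \<nu> n T) n r = entries_below \<nu> T n r"
  "entries_below \<nu> (bender_knuth \<nu> n T) (n + 2) r = entries_below \<nu> T (n + 2) r"
  "entries_below \<nu> (bender_knuth \<nu> n T) (n + 1) r = reflected \<nu> T n r"
proof -
  show "entries_below \<nu> (bender_knuth \<nu> n T) n r = entries_below \<nu> T n r"
    "entries_below \<nu> (bender_knuth \<nu> n T) (n + 2) r = entries_below \<nu> T (n + 2) r"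
    unfolding entries_below_def using bk_less(1,2) by (metis (no_types, lifting) Collect_cong)+
  have "{c. c < part \<nu> r \<and> bender_knuth \<nu> n T (r, c) < n + 1} = {..<reflected \<nu> T n r}"
    using bk_less(3)[of _ r] reflected_bounds(3)[of r] entries_below_le[of "n + 2" r] by auto
  then show "entries_below \<nu> (bender_knuth \<nu> n T) (n + 1) r = reflected \<nu> T n r"
    by (simp add: entries_below_def)
qed

lemma bk_involution: "bender_knuth \<nu> n (bender_knuth \<nu> n T) = T"
proof
  fix x :: "nat \<times> nat"
  obtain r c where x: "x = (r, c)" by (cases x)
  have "reflected \<nu> (bender_knuth \<nu> n T) n r = entries_below \<nu> T (n + 1) r"
  proof -
    have "lower_end \<nu> (bender_knuth \<nu> n T) n r = lower_end \<nu> T n r" "upper_end \<nu> (bender_knuth \<nu> n T) n r = upper_end \<nu> T n r"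
      by (simp_all only: lower_end_def upper_end_def entries_below_bk)
    then have "reflected \<nu> (bender_knuth \<nu> n T) n r = lower_end \<nu> T n r + upper_end \<nu> T n r - reflected \<nu> T n r"
      by (simp only: reflected_def[of \<nu> "bender_knuth \<nu> n T" n r] entries_below_bk)
    then show ?thesis
      using interval[of r] by (simp add: reflected_def)
  qed
  moreover have "c < entries_below \<nu> T (n + 1) r \<longleftrightarrow> T (r, c) < n + 1" if "c < part \<nu> r"
    using less_entries_below[OF that, of "n + 1"] by simp
  ultimately show "bender_knuth \<nu> n (bender_knuth \<nu> n T) x = T x"
    unfolding x by (auto simp: bender_knuth_def[of _ _ "bender_knuth \<nu> n T"]) (auto simp: bender_knuth_def split: if_splits)
qed

lemma card_entries_less: "card {x \<in> diagram \<nu>. T x < m} = (\<Sum>r<length \<nu>. entries_below \<nu> T m r)"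
proof -
  have "{x \<in> diagram \<nu>. T x < m} = (SIGMA r:{..<length \<nu>}. {c. c < part \<nu> r \<and> T (r, c) < m})"
    by (auto simp: diagram_Sigma)
  then show ?thesis
    by (simp add: entries_below_def)
qed

text \<open>The lower end in row r and the upper end in row r + 1 are the maximum and the minimum of
  the same two numbers, so together they give the sum of these numbers. Pairing them across rows
  makes the reflections preserve the total count.\<close>

lemma sum_ends:
  "(\<Sum>r<R. lower_end \<nu> T n r + upper_end \<nu> T n r) + upper_end \<nu> T n R =
   (\<Sum>r<R. entries_below \<nu> T (n + 2) r + entries_below \<nu> T n r) + entries_below \<nu> T (n + 2) R"
  by (induction R) (auto simp: lower_end_def upper_end_def)

lemma sum_reflected:
  "(\<Sum>r<length \<nu>. reflected \<nu> T n r) + (\<Sum>r<length \<nu>. entries_below \<nu> T (n + 1) r) =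
   (\<Sum>r<length \<nu>. entries_below \<nu> T (n + 2) r) + (\<Sum>r<length \<nu>. entries_below \<nu> T n r)"
proof -
  have "entries_below \<nu> T (n + 2) (length \<nu>) = 0" "upper_end \<nu> T n (length \<nu>) = 0"
    using entries_below_le[of "n + 2" "length \<nu>"] by (auto simp: part_ge_length upper_end_def)
  moreover have "reflected \<nu> T n r + entries_below \<nu> T (n + 1) r = lower_end \<nu> T n r + upper_end \<nu> T n r" for r
    using interval[of r] by (simp add: reflected_def)
  ultimately show ?thesis
    using sum_ends[of "length \<nu>"] by (simp flip: sum.distrib)
qed

end

lemma card_entries_eq:
  "card {x \<in> diagram \<nu>. T x < Suc m} = card {x \<in> diagram \<nu>. T x < m} + card {x \<in> diagram \<nu>. T x = m}"
  by (subst card_Un_disjoint[symmetric]) (auto intro!: arg_cong[of _ _ card])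

text \<open>The numbers of entries below n and below n + 2 are unchanged, while the number below n +
  1 is reflected between them; so the multiplicities of n and n + 1 change places.\<close>

lemma card_entries_bk:
  assumes "\<nu> \<in> Par" "semistandard \<nu> T"
  shows "card {x \<in> diagram \<nu>. bender_knuth \<nu> n T x = m}
    = card {x \<in> diagram \<nu>. T x = Transposition.transpose n (Suc n) m}"
proof -
  note T' = semistandard_bk[OF assms, of n]
  let ?C = "\<lambda>T m. card {x \<in> diagram \<nu>. T x < m}"
  let ?T' = "bender_knuth \<nu> n T"
  have "?C ?T' n = ?C T n" "?C ?T' (n + 2) = ?C T (n + 2)" "?C ?T' (n + 1) + ?C T (n + 1) = ?C T (n + 2) + ?C T n"
    using sum_reflected[OF assms, of n]
    by (simp_all only: card_entries_less[OF assms] card_entries_less[OF assms(1) T'] entries_below_bk[OF assms]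
        cong: sum.cong)
  then have "card {x \<in> diagram \<nu>. ?T' x = n} = card {x \<in> diagram \<nu>. T x = Suc n}"
    "card {x \<in> diagram \<nu>. ?T' x = Suc n} = card {x \<in> diagram \<nu>. T x = n}"
    using card_entries_eq[of \<nu> ?T' n] card_entries_eq[of \<nu> ?T' "Suc n"]
      card_entries_eq[of \<nu> T n] card_entries_eq[of \<nu> T "Suc n"] by auto
  moreover have "{x \<in> diagram \<nu>. ?T' x = m} = {x \<in> diagram \<nu>. T x = m}" if "m \<noteq> n" "m \<noteq> Suc n"
  proof -
    have "?T' x = m \<longleftrightarrow> T x = m" if "x \<in> diagram \<nu>" for x
      using bk_less(4)[OF assms, of "snd x" "fst x" m n] \<open>m \<noteq> n\<close> \<open>m \<noteq> Suc n\<close> that by (cases x) auto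
    then show ?thesis
      by blast
  qed
  ultimately show ?thesis
    by (cases "m = n"; cases "m = Suc n") (auto simp: Transposition.transpose_def)
qed

definition tableau_content :: "partition \<Rightarrow> (nat \<times> nat \<Rightarrow> nat) \<Rightarrow> (unit \<times> nat) multiset" where
  "tableau_content \<nu> T = image_mset (\<lambda>x. ((), T x)) (mset_set (diagram \<nu>))"

lemma coeff_of_schur1:
  "coeff_of (schur1 \<nu>) M = of_nat (card {T. semistandard \<nu> T \<and> tableau_content \<nu> T = M})"
  by (simp add: schur1_def tableau_content_def)

lemma count_tableau_content: "count (tableau_content \<nu> T) (u, m) = card {x \<in> diagram \<nu>. T x = m}"
  by (simp add: tableau_content_def count_image_mset_set)

lemma tableau_content_bk:
  assumes "\<nu> \<in> Par" "semistandard \<nu> T"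
  shows "tableau_content \<nu> (bender_knuth \<nu> n T) = image_mset (swap_vars () n) (tableau_content \<nu> T)"
proof (rule multiset_eqI)
  fix v :: "unit \<times> nat"
  obtain m where v: "v = ((), m)" by (cases v) auto
  have eq: "v = swap_vars () n ((), Transposition.transpose n (Suc n) m)"
    by (simp add: v)
  show "count (tableau_content \<nu> (bender_knuth \<nu> n T)) v
      = count (image_mset (swap_vars () n) (tableau_content \<nu> T)) v"
    unfolding eq count_image_mset_inj[OF inj_permute_vars[OF bij_swap]]
    by (simp add: count_tableau_content card_entries_bk[OF assms])
qed

lemma symmetric_schur1:
  assumes "\<nu> \<in> Par"
  shows "symmetric (schur1 \<nu>)"
proof (rule symmetric_swapI)
  fix i :: unit and n M
  have swap2: "image_mset (swap_vars i n) (image_mset (swap_vars i n) M) = M" for M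
  proof -
    have "swap_vars i n (swap_vars i n v) = v" for v
      by (cases v) simp
    then show ?thesis
      by (simp only: image_mset.compositionality o_def multiset.map_ident)
  qed
  have "bij_betw (bender_knuth \<nu> n) {T. semistandard \<nu> T \<and> tableau_content \<nu> T = image_mset (swap_vars i n) M}
     {T. semistandard \<nu> T \<and> tableau_content \<nu> T = M}"
    by (rule bij_betw_byWitness[of _ "bender_knuth \<nu> n"])
       (auto simp: bk_involution[OF assms] semistandard_bk[OF assms] tableau_content_bk[OF assms] swap2[simplified])
  then show "coeff_of (schur1 \<nu>) (image_mset (swap_vars i n) M) = coeff_of (schur1 \<nu>) M"
    by (simp add: coeff_of_schur1 bij_betw_same_card)
qed

subsection \<open>Triangularity\<close>

lemma semistandard_ge_row:
  assumes "\<nu> \<in> Par" "semistandard \<nu> T" "c < part \<nu> r"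
  shows "r \<le> T (r, c)"
  using assms(3)
proof (induction r)
  case (Suc r)
  then have "c < part \<nu> r"
    using Par_part_mono[OF assms(1), of r "Suc r"] by linarith
  then show ?case
    using Suc column_strict[OF assms(1,2) Suc.prems] by auto
qed simp

lemma sum_count_tableau_content:
  "(\<Sum>i<n. count (tableau_content \<nu> T) (u, i)) = card {x \<in> diagram \<nu>. T x < n}"
  by (induction n) (auto simp: card_entries_eq count_tableau_content)

text \<open>An entry in row r, counted from 0, is at least r. So the entries below n lie in the
  first n rows, which is the dominance bound.\<close>

lemma coeff_of_schur1_nonzero:
  assumes "\<nu> \<in> Par" "coeff_of (schur1 \<nu>) M \<noteq> 0"
  shows "size M = sum_list \<nu>" "(\<Sum>i<n. count M ((), i)) \<le> (\<Sum>i<n. part \<nu> i)"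
proof -
  obtain T where T: "semistandard \<nu> T" "tableau_content \<nu> T = M"
    using assms by (metis (mono_tags, lifting) Collect_empty_eq_bot bot_empty_eq card.empty coeff_of_schur1
      empty_Collect_eq of_nat_0)
  show "size M = sum_list \<nu>"
    using T by (auto simp: tableau_content_def card_diagram)
  have "{x \<in> diagram \<nu>. T x < n} \<subseteq> {x \<in> diagram \<nu>. fst x < n}"
    using semistandard_ge_row[OF assms(1) T(1)] by fastforce
  then have "card {x \<in> diagram \<nu>. T x < n} \<le> card {x \<in> diagram \<nu>. fst x < n}"
    by (intro card_mono) auto
  then show "(\<Sum>i<n. count M ((), i)) \<le> (\<Sum>i<n. part \<nu> i)"
    by (simp add: card_diagram_rows sum_count_tableau_content flip: T(2))
qed

text \<open>Here the entries below n are as many as the boxes in the first n rows and are contained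
  in them, so they fill them. The only tableau has the row number in each box.\<close>

lemma coeff_of_schur1_leading:
  assumes "\<nu> \<in> Par" "\<And>i. count M ((), i) = part \<nu> i"
  shows "coeff_of (schur1 \<nu>) M = 1"
proof -
  define T0 where "T0 x = (if x \<in> diagram \<nu> then fst x else 0)" for x :: "nat \<times> nat"
  have "{T. semistandard \<nu> T \<and> tableau_content \<nu> T = M} = {T0}"
  proof (intro equalityI subsetI)
    fix T assume "T \<in> {T. semistandard \<nu> T \<and> tableau_content \<nu> T = M}"
    then have T: "semistandard \<nu> T" "tableau_content \<nu> T = M" by auto
    have eq: "{x \<in> diagram \<nu>. T x < n} = {x \<in> diagram \<nu>. fst x < n}" for n
    proof (rule card_seteq)
      show "{x \<in> diagram \<nu>. T x < n} \<subseteq> {x \<in> diagram \<nu>. fst x < n}"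
        using semistandard_ge_row[OF assms(1) T(1)] by fastforce
      have "card {x \<in> diagram \<nu>. T x < n} = (\<Sum>i<n. part \<nu> i)"
        using sum_count_tableau_content[of \<nu> T "()" n] by (simp add: T(2) assms(2))
      then show "card {x \<in> diagram \<nu>. fst x < n} \<le> card {x \<in> diagram \<nu>. T x < n}"
        by (simp add: card_diagram_rows)
    qed auto
    have "T x = fst x" if "x \<in> diagram \<nu>" for x
    proof (rule antisym)
      have "x \<in> {y \<in> diagram \<nu>. T y < Suc (fst x)}"
        by (subst eq) (simp add: that)
      then show "T x \<le> fst x"
        by simp
      show "fst x \<le> T x"
        using semistandard_ge_row[OF assms(1) T(1), of "snd x" "fst x"] that by (cases x) auto
    qed
    moreover have "T x = 0" if "x \<notin> diagram \<nu>" for x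
      using T(1) that unfolding semistandard_def by blast
    ultimately show "T \<in> {T0}"
      by (auto simp: T0_def)
  next
    fix T assume "T \<in> {T0}"
    moreover have "semistandard \<nu> T0"
      using Par_part_mono[OF assms(1)] by (auto simp: semistandard_def T0_def)
    moreover have "tableau_content \<nu> T0 = M"
    proof (rule multiset_eqI)
      fix v :: "unit \<times> nat"
      obtain m where v: "v = ((), m)" by (cases v) auto
      have "{x \<in> diagram \<nu>. T0 x = m} = Pair m ` {..<part \<nu> m}"
        by (auto simp: T0_def)
      then show "count (tableau_content \<nu> T0) v = count M v"
        using assms(2) by (simp add: v count_tableau_content card_image inj_on_def)
    qed
    ultimately show "T \<in> {T. semistandard \<nu> T \<and> tableau_content \<nu> T = M}"
      by blast
  qed
  then show ?thesis
    by (simp add: coeff_of_schur1)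
qed

subsection \<open>Expansion in Schur functions\<close>

definition section_at :: "'i \<Rightarrow> ('i \<times> nat) multiset \<Rightarrow> (unit \<times> nat) multiset" where
  "section_at i M = image_mset (\<lambda>v. ((), snd v)) {#v \<in># M. fst v = i#}"

lemma count_section_at: "count (section_at i M) (u, n) = count M (i, n)"
proof -
  have inj: "inj_on (\<lambda>v. ((), snd v)) {v. fst v = i}"
    by (auto simp: inj_on_def)
  have "count (section_at i M) ((), n) = (\<Sum>v | v \<in># {#v \<in># M. fst v = i#} \<and> ((), n) = ((), snd v). count {#v \<in># M. fst v = i#} v)"
    unfolding section_at_def count_image_mset' ..
  also have "\<dots> = (\<Sum>v\<in>{(i, n)}. count {#v \<in># M. fst v = i#} v)"
    by (rule sum.mono_neutral_left) (auto simp: not_in_iff)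
  finally show ?thesis by simp
qed

lemma coeff_of_in_alphabet:
  "coeff_of (in_alphabet i F) {#v \<in># M. fst v = i#} = coeff_of F (section_at i M)"
proof -
  have "image_mset (\<lambda>v. (i, snd v)) {#v \<in># M. fst v = i#} = image_mset (\<lambda>v. v) {#v \<in># M. fst v = i#}"
    by (rule image_mset_cong) auto
  then have "{#v \<in># M. fst v = i#} = image_mset (\<lambda>(_ :: unit, n). (i, n)) (section_at i M)"
    unfolding section_at_def by (simp add: image_mset.compositionality o_def)
  moreover have "inj (\<lambda>(_ :: unit, n :: nat). (i, n))"
    by (auto simp: inj_on_def)
  ultimately show ?thesis
    by (simp add: in_alphabet_def coeff_of_rename_image)
qed

lemma in_alphabet_support:
  assumes "coeff_of (in_alphabet i F) M \<noteq> 0" "v \<in># M"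
  shows "fst v = i"
proof -
  have "inj (\<lambda>(_ :: unit, n :: nat). (i, n))"
    by (auto simp: inj_on_def)
  then obtain L where "M = image_mset (\<lambda>(_ :: unit, n). (i, n)) L"
    using assms(1) unfolding in_alphabet_def by (rule coeff_of_rename_nonzero)
  then show ?thesis
    using assms(2) by auto
qed

lemma coeff_of_prod_in_alphabet:
  assumes "finite J"
  shows "coeff_of (\<Prod>j\<in>J. in_alphabet j (G j)) M =
    (if fst ` set_mset M \<subseteq> J then \<Prod>j\<in>J. coeff_of (G j) (section_at j M) else 0)"
proof -
  have "coeff_of (\<Prod>j\<in>J. in_alphabet j (G j)) M =
    (if \<forall>v\<in>#M. fst v \<in> J then \<Prod>j\<in>J. coeff_of (in_alphabet j (G j)) {#v \<in># M. fst v = j#} else 0)"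
    by (rule coeff_of_prod_blocks[OF assms]) (rule in_alphabet_support)
  then show ?thesis
    by (simp only: coeff_of_in_alphabet image_subset_iff)
qed

lemma schur1_Nil: "schur1 [] = 1"
proof (rule mseries_eqI)
  fix M
  have "{T. semistandard [] T \<and> tableau_content [] T = M} = (if M = {#} then {\<lambda>_. 0} else {})"
    by (auto simp: semistandard_def diagram_def tableau_content_def)
  then show "coeff_of (schur1 []) M = coeff_of 1 M"
    by (simp add: coeff_of_schur1 coeff_of_1)
qed

lemma schur_superset:
  assumes "finite J" "{i. \<alpha> i \<noteq> []} \<subseteq> J"
  shows "schur \<alpha> = (\<Prod>j\<in>J. in_alphabet j (schur1 (\<alpha> j)))"
  unfolding schur_def
  by (rule prod.mono_neutral_left) (use assms in \<open>auto simp: schur1_Nil in_alphabet_def rename_1\<close>)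

lemma symmetric_schur:
  assumes "\<alpha> \<in> Par_family"
  shows "symmetric (schur \<alpha>)"
  unfolding schur_def
  by (intro symmetric_prod symmetric_in_alphabet symmetric_schur1) (use assms in \<open>auto simp: Par_family_def\<close>)

text \<open>The multidegree. Schur functions are homogeneous for it, which splits the Schur
  expansion of a series into finite systems.\<close>

definition msize :: "('i \<times> nat) multiset \<Rightarrow> 'i \<Rightarrow> nat" where
  "msize M i = size {#v \<in># M. fst v = i#}"

lemma size_section_at: "size (section_at i M) = msize M i"
  by (simp add: section_at_def msize_def)

lemma finite_msize: "finite {i. msize M i \<noteq> 0}"
proof (rule finite_subset)
  show "{i. msize M i \<noteq> 0} \<subseteq> fst ` set_mset M"
    by (auto simp: msize_def filter_mset_eq_conv)
qed simp

lemma coeff_of_schur_nonzero: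
  assumes "\<alpha> \<in> Par_family" "coeff_of (schur \<alpha>) M \<noteq> 0"
  shows "sum_list (\<alpha> i) = msize M i" "(\<Sum>n<m. count M (i, n)) \<le> (\<Sum>n<m. part (\<alpha> i) n)"
proof -
  let ?J = "insert i {i. \<alpha> i \<noteq> []}"
  have "coeff_of (schur \<alpha>) M = coeff_of (\<Prod>j\<in>?J. in_alphabet j (schur1 (\<alpha> j))) M"
    using assms(1) by (subst schur_superset[of ?J]) (auto simp: Par_family_def)
  then have "(\<Prod>j\<in>?J. coeff_of (schur1 (\<alpha> j)) (section_at j M)) \<noteq> 0"
    using assms by (auto simp: coeff_of_prod_in_alphabet Par_family_def split: if_splits)
  then have "coeff_of (schur1 (\<alpha> i)) (section_at i M) \<noteq> 0"
    using assms(1) by (auto simp: Par_family_def prod_zero_iff)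
  moreover have "\<alpha> i \<in> Par"
    using assms(1) by (simp add: Par_family_def)
  ultimately show "sum_list (\<alpha> i) = msize M i" "(\<Sum>n<m. count M (i, n)) \<le> (\<Sum>n<m. part (\<alpha> i) n)"
    using coeff_of_schur1_nonzero[of "\<alpha> i" "section_at i M"] by (simp_all add: count_section_at size_section_at)
qed

lemma coeff_of_schur_leading:
  assumes "\<alpha> \<in> Par_family"
  shows "coeff_of (schur \<alpha>) (cont \<alpha>) = 1"
proof -
  have "fst ` set_mset (cont \<alpha>) \<subseteq> {i. \<alpha> i \<noteq> []}"
  proof
    fix i assume "i \<in> fst ` set_mset (cont \<alpha>)"
    then obtain n where "(i, n) \<in># cont \<alpha>" by auto
    then have "part (\<alpha> i) n > 0"
      by (simp add: count_cont[OF assms] flip: count_greater_zero_iff)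
    then show "i \<in> {i. \<alpha> i \<noteq> []}" by auto
  qed
  moreover have "coeff_of (schur1 (\<alpha> j)) (section_at j (cont \<alpha>)) = 1" for j
    by (rule coeff_of_schur1_leading) (use assms in \<open>auto simp: Par_family_def count_section_at count_cont\<close>)
  ultimately show ?thesis
    using assms by (simp add: schur_def coeff_of_prod_in_alphabet Par_family_def)
qed

definition Par_of_size :: "('i \<Rightarrow> nat) \<Rightarrow> ('i \<Rightarrow> partition) set" where
  "Par_of_size d = {\<alpha> \<in> Par_family. \<forall>i. sum_list (\<alpha> i) = d i}"

lemma finite_partitions: "finite {\<nu> \<in> Par. sum_list \<nu> = m}"
proof (rule finite_subset)
  show "{\<nu> \<in> Par. sum_list \<nu> = m} \<subseteq> {xs. set xs \<subseteq> {..m} \<and> length xs \<le> m}"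
  proof (clarify, intro conjI)
    fix \<nu> assume *: "\<nu> \<in> Par" "m = sum_list \<nu>"
    show "set \<nu> \<subseteq> {..sum_list \<nu>}"
      by (auto intro: member_le_sum_list)
    have "length \<nu> = (\<Sum>x\<leftarrow>\<nu>. 1)"
      by (simp add: sum_list_triv)
    also have "\<dots> \<le> (\<Sum>x\<leftarrow>\<nu>. x)"
      using * by (intro sum_list_mono) (auto simp: Par_def intro: Suc_leI gr0I)
    finally show "length \<nu> \<le> sum_list \<nu>" by simp
  qed
  show "finite {xs. set xs \<subseteq> {..m} \<and> length xs \<le> m}"
    by (rule finite_lists_length_le) simp
qed

lemma Par_sum_list_0: "\<nu> \<in> Par \<Longrightarrow> sum_list \<nu> = 0 \<longleftrightarrow> \<nu> = []"
  by (cases \<nu>) (auto simp: Par_def)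

lemma finite_Par_of_size:
  assumes "finite {i. d i \<noteq> 0}"
  shows "finite (Par_of_size d)"
proof (rule finite_subset)
  show "Par_of_size d \<subseteq> {f. \<forall>i. (i \<in> {i. d i \<noteq> 0} \<longrightarrow> f i \<in> (\<Union>m\<in>d ` {i. d i \<noteq> 0}. {\<nu> \<in> Par. sum_list \<nu> = m})) \<and>
      (i \<notin> {i. d i \<noteq> 0} \<longrightarrow> f i = [])}"
    by (auto simp: Par_of_size_def Par_family_def Par_sum_list_0) (metis Par_sum_list_0)
  show "finite \<dots>"
    by (rule finite_set_of_finite_funs) (use assms finite_partitions in auto)
qed

lemma finite_Par_of_msize: "finite (Par_of_size (msize M))"
  by (rule finite_Par_of_size[OF finite_msize])

lemma Par_of_sizeD: "\<alpha> \<in> Par_of_size d \<Longrightarrow> \<alpha> \<in> Par_family"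
  by (simp add: Par_of_size_def)

lemma cont_Par_of_size: "\<alpha> \<in> Par_family \<Longrightarrow> \<alpha> \<in> Par_of_size (msize (cont \<alpha>))"
  using coeff_of_schur_nonzero(1)[of \<alpha> "cont \<alpha>"] by (auto simp: Par_of_size_def coeff_of_schur_leading)

lemma msize_cont: "\<alpha> \<in> Par_family \<Longrightarrow> msize (cont \<alpha>) i = sum_list (\<alpha> i)"
  using cont_Par_of_size[of \<alpha>] by (simp add: Par_of_size_def)

text \<open>For existence a minimal index is removed: its unknown occurs only in its own equation
  and is solved for last. For uniqueness the equation at a maximal index of the support of
  \<open>x\<close> retains a single term.\<close>

lemma triangular_solve:
  fixes K :: "'x \<Rightarrow> 'x \<Rightarrow> 'a::field"
  assumes "finite P" and K: "\<And>a b. a \<in> P \<Longrightarrow> b \<in> P \<Longrightarrow> K b a \<noteq> 0 \<Longrightarrow> R a b" "\<And>a. a \<in> P \<Longrightarrow> K a a \<noteq> 0"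
    and R: "\<And>a b. a \<in> P \<Longrightarrow> b \<in> P \<Longrightarrow> R a b \<Longrightarrow> R b a \<Longrightarrow> a = b"
      "\<And>a b c. R a b \<Longrightarrow> R b c \<Longrightarrow> R a c"
  shows "\<exists>x. \<forall>a\<in>P. (\<Sum>b\<in>P. x b * K b a) = f a"
    and "(\<And>a. a \<in> P \<Longrightarrow> (\<Sum>b\<in>P. x b * K b a) = 0) \<Longrightarrow> a \<in> P \<Longrightarrow> x a = 0"
proof -
  have "\<exists>x. \<forall>a\<in>P. (\<Sum>b\<in>P. x b * K b a) = f a"
    using assms
  proof (induction "card P" arbitrary: P)
    case (Suc n)
    have "P \<noteq> {}"
      using Suc.hyps(2) by auto
    have "asymp_on P (\<lambda>a b. R a b \<and> a \<noteq> b)" "transp_on P (\<lambda>a b. R a b \<and> a \<noteq> b)"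
      using Suc.prems(4,5) by (intro asymp_onI transp_onI; blast)+
    from Finite_Set.bex_min_element[OF Suc.prems(1) this \<open>P \<noteq> {}\<close>]
    obtain m where m: "m \<in> P" "\<And>a. a \<in> P \<Longrightarrow> R a m \<Longrightarrow> a = m"
      by blast
    have "\<exists>x. \<forall>a\<in>P - {m}. (\<Sum>b\<in>P - {m}. x b * K b a) = f a"
    proof (rule Suc.hyps(1))
      show "n = card (P - {m})"
        using Suc.hyps(2) m(1) Suc.prems(1) by simp
      show "R a b \<Longrightarrow> R b c \<Longrightarrow> R a c" for a b c
        by (fact Suc.prems(5))
    qed (use Suc.prems(1-4) in simp_all)
    then obtain x where x: "\<And>a. a \<in> P - {m} \<Longrightarrow> (\<Sum>b\<in>P - {m}. x b * K b a) = f a"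
      by blast
    define y where "y = x(m := (f m - (\<Sum>b\<in>P - {m}. x b * K b m)) / K m m)"
    have y: "(\<Sum>b\<in>P. y b * K b a) = y m * K m a + (\<Sum>b\<in>P - {m}. x b * K b a)" for a
      using m Suc.prems(1) by (subst sum.remove[of _ m]) (auto simp: y_def intro!: sum.cong)
    have "(\<Sum>b\<in>P. y b * K b a) = f a" if "a \<in> P" for a
    proof (cases "a = m")
      case True
      then show ?thesis
        using y[of m] Suc.prems(3)[OF m(1)] by (simp add: y_def)
    next
      case False
      then have "K m a = 0"
        using m that Suc.prems(2) by blast
      then show ?thesis
        using y[of a] x[of a] that False by simp
    qed
    then show ?case by blast
  qed simp
  then show "\<exists>x. \<forall>a\<in>P. (\<Sum>b\<in>P. x b * K b a) = f a" .
  assume *: "\<And>a. a \<in> P \<Longrightarrow> (\<Sum>b\<in>P. x b * K b a) = 0" and "a \<in> P"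
  show "x a = 0"
  proof (rule ccontr)
    let ?Q = "{a \<in> P. x a \<noteq> 0}"
    assume "x a \<noteq> 0"
    then have "?Q \<noteq> {}" using \<open>a \<in> P\<close> by blast
    have "asymp_on ?Q (\<lambda>a b. R a b \<and> a \<noteq> b)" "transp_on ?Q (\<lambda>a b. R a b \<and> a \<noteq> b)"
      using R by (intro asymp_onI transp_onI; blast)+
    from Finite_Set.bex_max_element[OF _ this \<open>?Q \<noteq> {}\<close>]
    obtain m where m: "m \<in> ?Q" "\<And>a. a \<in> ?Q \<Longrightarrow> R m a \<Longrightarrow> a = m"
      using assms(1) by force
    have "(\<Sum>b\<in>P. x b * K b m) = (\<Sum>b\<in>{m}. x b * K b m)"
      by (rule sum.mono_neutral_right) (use assms(1) m K(1) in auto)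
    then show False
      using * m K(2) by auto
  qed
qed

definition dominated :: "('i \<Rightarrow> partition) \<Rightarrow> ('i \<Rightarrow> partition) \<Rightarrow> bool" where
  "dominated \<alpha> \<beta> \<longleftrightarrow> (\<forall>i m. (\<Sum>n<m. part (\<alpha> i) n) \<le> (\<Sum>n<m. part (\<beta> i) n))"

lemma dominated_antisym:
  assumes "\<alpha> \<in> Par_family" "\<beta> \<in> Par_family" "dominated \<alpha> \<beta>" "dominated \<beta> \<alpha>"
  shows "\<alpha> = \<beta>"
proof
  fix i
  have "(\<Sum>n<m. part (\<alpha> i) n) = (\<Sum>n<m. part (\<beta> i) n)" for m
    using assms unfolding dominated_def by (meson antisym)
  then have "part (\<alpha> i) m = part (\<beta> i) m" for m
    by (metis add_left_cancel sum.lessThan_Suc)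
  then show "\<alpha> i = \<beta> i"
    using assms by (intro Par_eqI) (auto simp: Par_family_def)
qed

lemma dominated_trans: "dominated \<alpha> \<beta> \<Longrightarrow> dominated \<beta> \<gamma> \<Longrightarrow> dominated \<alpha> \<gamma>"
  unfolding dominated_def by (meson order_trans)

lemma schur_triangular:
  assumes "\<alpha> \<in> Par_family" "\<beta> \<in> Par_family" "coeff_of (schur \<beta>) (cont \<alpha>) \<noteq> 0"
  shows "dominated \<alpha> \<beta>"
  using coeff_of_schur_nonzero(2)[OF assms(2,3)] by (simp add: dominated_def count_cont[OF assms(1)])

lemma coeff_of_schur_sum:
  assumes "\<And>\<alpha>. \<alpha> \<notin> Par_family \<Longrightarrow> c \<alpha> = 0"
  shows "coeff_of (formal_sum Par_family (\<lambda>\<alpha>. mscale (c \<alpha>) (schur \<alpha>))) M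
    = (\<Sum>\<alpha>\<in>Par_of_size (msize M). c \<alpha> * coeff_of (schur \<alpha>) M)"
proof -
  have "coeff_of (formal_sum Par_family (\<lambda>\<alpha>. mscale (c \<alpha>) (schur \<alpha>))) M
     = (\<Sum>\<alpha>\<in>Par_of_size (msize M). coeff_of (mscale (c \<alpha>) (schur \<alpha>)) M)"
  proof (rule coeff_of_formal_sum)
    fix \<alpha> assume "\<alpha> \<in> Par_family - Par_of_size (msize M)"
    then have "coeff_of (schur \<alpha>) M = 0"
      using coeff_of_schur_nonzero(1)[of \<alpha> M] unfolding Par_of_size_def by blast
    then show "coeff_of (mscale (c \<alpha>) (schur \<alpha>)) M = 0"
      by simp
  qed (auto simp: finite_Par_of_msize dest: Par_of_sizeD)
  then show ?thesis by simp
qed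

text \<open>At the monomials \<open>cont\<close> of one multidegree, two expansions differ by a
  solution of a finite homogeneous system that is unitriangular for dominance. This settles the
  description in \<open>schur_coeffs_def\<close>.\<close>

lemma schur_expansion_unique:
  assumes "\<And>\<alpha>. \<alpha> \<notin> Par_family \<Longrightarrow> c \<alpha> = 0"
    and "F = formal_sum Par_family (\<lambda>\<alpha>. mscale (c \<alpha>) (schur \<alpha>))"
  shows "schur_coeffs F = c"
  unfolding schur_coeffs_def
proof (rule the_equality)
  fix c' :: "('a \<Rightarrow> partition) \<Rightarrow> rf"
  assume c': "(\<forall>\<alpha>. \<alpha> \<notin> Par_family \<longrightarrow> c' \<alpha> = 0) \<and> F = formal_sum Par_family (\<lambda>\<alpha>. mscale (c' \<alpha>) (schur \<alpha>))"
  show "c' = c"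
  proof
    fix \<alpha> :: "'a \<Rightarrow> partition"
    show "c' \<alpha> = c \<alpha>"
    proof (cases "\<alpha> \<in> Par_family")
      case True
      let ?P = "Par_of_size (msize (cont \<alpha>))"
      have "c' \<alpha> - c \<alpha> = 0"
      proof (rule triangular_solve(2)[of ?P "\<lambda>b a. coeff_of (schur b) (cont a)" dominated "\<lambda>b. c' b - c b"])
        fix \<beta> assume "\<beta> \<in> ?P"
        then have "msize (cont \<beta>) = msize (cont \<alpha>)"
          by (auto simp: Par_of_size_def msize_cont)
        moreover have "(\<Sum>b\<in>Par_of_size (msize (cont \<beta>)). c' b * coeff_of (schur b) (cont \<beta>))
            = (\<Sum>b\<in>Par_of_size (msize (cont \<beta>)). c b * coeff_of (schur b) (cont \<beta>))"
          using coeff_of_schur_sum[of c' "cont \<beta>"] coeff_of_schur_sum[of c "cont \<beta>"] assms c' by simp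
        ultimately show "(\<Sum>b\<in>?P. (c' b - c b) * coeff_of (schur b) (cont \<beta>)) = 0"
          by (simp add: left_diff_distrib sum_subtractf)
      next
        show "dominated a b \<Longrightarrow> dominated b c \<Longrightarrow> dominated a c" for a b c :: "'a \<Rightarrow> partition"
          by (rule dominated_trans)
      qed (use cont_Par_of_size[OF True] in \<open>simp_all add: Par_of_sizeD finite_Par_of_msize schur_triangular
            coeff_of_schur_leading dominated_antisym\<close>)
      then show ?thesis by simp
    qed (use assms c' in auto)
  qed
qed (use assms in auto)

text \<open>The systems of the different multidegrees are solved independently and the solutions are
  glued. Agreement at the sorted monomials suffices, both series being symmetric.\<close>

lemma schur_expansion_exists:
  assumes "symmetric F"
  shows "\<exists>c. (\<forall>\<alpha>. \<alpha> \<notin> Par_family \<longrightarrow> c \<alpha> = 0) \<and> F = formal_sum Par_family (\<lambda>\<alpha>. mscale (c \<alpha>) (schur \<alpha>))"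
proof -
  have "\<exists>c. \<forall>\<beta>\<in>Par_of_size d. (\<Sum>\<alpha>\<in>Par_of_size d. c \<alpha> * coeff_of (schur \<alpha>) (cont \<beta>)) = coeff_of F (cont \<beta>)"
    if "finite {i. d i \<noteq> 0}" for d
  proof (rule triangular_solve(1)[where R = dominated])
    show "dominated a b \<Longrightarrow> dominated b c \<Longrightarrow> dominated a c" for a b c :: "'a \<Rightarrow> partition"
      by (rule dominated_trans)
  qed (use that in \<open>simp_all add: finite_Par_of_size Par_of_sizeD schur_triangular
            coeff_of_schur_leading dominated_antisym\<close>)
  then have "\<forall>d. \<exists>c. finite {i. d i \<noteq> 0} \<longrightarrow> (\<forall>\<beta>\<in>Par_of_size d.
     (\<Sum>\<alpha>\<in>Par_of_size d. c \<alpha> * coeff_of (schur \<alpha>) (cont \<beta>)) = coeff_of F (cont \<beta>))"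
    by blast
  from choice[OF this] obtain c where c: "\<And>d \<beta>. finite {i. d i \<noteq> 0} \<Longrightarrow> \<beta> \<in> Par_of_size d \<Longrightarrow>
     (\<Sum>\<alpha>\<in>Par_of_size d. c d \<alpha> * coeff_of (schur \<alpha>) (cont \<beta>)) = coeff_of F (cont \<beta>)"
    by blast
  define c' where "c' \<alpha> = (if \<alpha> \<in> Par_family then c (\<lambda>i. sum_list (\<alpha> i)) \<alpha> else 0)" for \<alpha>
  have c': "\<alpha> \<notin> Par_family \<Longrightarrow> c' \<alpha> = 0" for \<alpha>
    by (simp add: c'_def)
  have "F = formal_sum Par_family (\<lambda>\<alpha>. mscale (c' \<alpha>) (schur \<alpha>))"
  proof (rule symmetric_eqI[OF assms])
    show "symmetric (formal_sum Par_family (\<lambda>\<alpha>. mscale (c' \<alpha>) (schur \<alpha>)))"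
      by (intro symmetric_formal_sum symmetric_mscale symmetric_schur)
    fix \<beta> :: "'a \<Rightarrow> partition"
    assume \<beta>: "\<beta> \<in> Par_family"
    have "(\<Sum>\<alpha>\<in>Par_of_size (msize (cont \<beta>)). c' \<alpha> * coeff_of (schur \<alpha>) (cont \<beta>))
       = (\<Sum>\<alpha>\<in>Par_of_size (msize (cont \<beta>)). c (msize (cont \<beta>)) \<alpha> * coeff_of (schur \<alpha>) (cont \<beta>))"
      by (rule sum.cong) (auto simp: c'_def Par_of_size_def)
    also have "\<dots> = coeff_of F (cont \<beta>)"
      by (rule c[OF finite_msize cont_Par_of_size[OF \<beta>]])
    finally show "coeff_of F (cont \<beta>) = coeff_of (formal_sum Par_family (\<lambda>\<alpha>. mscale (c' \<alpha>) (schur \<alpha>))) (cont \<beta>)"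
      using coeff_of_schur_sum[of c', OF c'] by simp
  qed
  then show ?thesis
    using c' by blast
qed

lemma schur_coeffs_expansion:
  assumes "symmetric F"
  shows "\<alpha> \<notin> Par_family \<Longrightarrow> schur_coeffs F \<alpha> = 0"
    and "coeff_of F M = (\<Sum>\<alpha>\<in>Par_of_size (msize M). schur_coeffs F \<alpha> * coeff_of (schur \<alpha>) M)"
proof -
  obtain c where c: "\<And>\<alpha>. \<alpha> \<notin> Par_family \<Longrightarrow> c \<alpha> = 0" "F = formal_sum Par_family (\<lambda>\<alpha>. mscale (c \<alpha>) (schur \<alpha>))"
    using schur_expansion_exists[OF assms] by blast
  then have "schur_coeffs F = c"
    by (rule schur_expansion_unique)
  then show "\<alpha> \<notin> Par_family \<Longrightarrow> schur_coeffs F \<alpha> = 0"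
    and "coeff_of F M = (\<Sum>\<alpha>\<in>Par_of_size (msize M). schur_coeffs F \<alpha> * coeff_of (schur \<alpha>) M)"
    using c coeff_of_schur_sum[of c M] by auto
qed

lemma hall_schur_sum:
  assumes "finite S" "S \<subseteq> Par_family"
  shows "hall F (\<Sum>\<alpha>\<in>S. mscale (d \<alpha>) (schur \<alpha>)) = (\<Sum>\<alpha>\<in>S. schur_coeffs F \<alpha> * d \<alpha>)"
proof -
  have "schur_coeffs (\<Sum>\<alpha>\<in>S. mscale (d \<alpha>) (schur \<alpha>)) = (\<lambda>\<alpha>. if \<alpha> \<in> S then d \<alpha> else 0)"
  proof (rule schur_expansion_unique)
    show "(\<Sum>\<alpha>\<in>S. mscale (d \<alpha>) (schur \<alpha>))
        = formal_sum Par_family (\<lambda>\<alpha>. mscale (if \<alpha> \<in> S then d \<alpha> else 0) (schur \<alpha>))"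
      by (rule mseries_eqI, subst coeff_of_formal_sum[of S]) (use assms in auto)
  qed (use assms in auto)
  then show ?thesis
    unfolding hall_def by (simp, intro sum.mono_neutral_cong_left) (use assms in auto)
qed

text \<open>The function \<open>monomial_dual M\<close> is \<open>h_\<mu>\<close> for the exponents \<open>\<mu>\<close> of \<open>M\<close>, expressed through
  Kostka numbers.\<close>

definition monomial_dual :: "('i \<times> nat) multiset \<Rightarrow> 'i symf" where
  "monomial_dual M = (\<Sum>\<alpha>\<in>Par_of_size (msize M). mscale (coeff_of (schur \<alpha>) M) (schur \<alpha>))"

text \<open>The Kostka numbers in \<open>monomial_dual\<close> rebuild the coefficient of
  \<open>F\<close> from its Schur expansion. It is stated for a finite sum because a product of
  factors h_1 in unions of two alphabets expands into several such duals.\<close>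

lemma hall_sum_monomial_dual:
  assumes "symmetric F" "finite I"
  shows "hall F (\<Sum>j\<in>I. monomial_dual (M j)) = (\<Sum>j\<in>I. coeff_of F (M j))"
proof -
  let ?P = "\<lambda>j. Par_of_size (msize (M j))"
  define S where "S = (\<Union>j\<in>I. ?P j)"
  have S: "finite S" "S \<subseteq> Par_family"
    using assms(2) by (auto simp: S_def finite_Par_of_msize dest: Par_of_sizeD)
  let ?d = "\<lambda>j \<alpha>. if \<alpha> \<in> ?P j then coeff_of (schur \<alpha>) (M j) else 0"
  have "monomial_dual (M j) = (\<Sum>\<alpha>\<in>S. mscale (?d j \<alpha>) (schur \<alpha>))" if "j \<in> I" for j
    unfolding monomial_dual_def by (rule sum.mono_neutral_cong_left)
      (use S that in \<open>auto simp: S_def intro!: mseries_eqI\<close>)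
  then have "(\<Sum>j\<in>I. monomial_dual (M j)) = (\<Sum>j\<in>I. \<Sum>\<alpha>\<in>S. mscale (?d j \<alpha>) (schur \<alpha>))"
    by simp
  also have "\<dots> = (\<Sum>\<alpha>\<in>S. mscale (\<Sum>j\<in>I. ?d j \<alpha>) (schur \<alpha>))"
    by (rule mseries_eqI) (simp add: sum_distrib_right, rule sum.swap)
  finally have "hall F (\<Sum>j\<in>I. monomial_dual (M j)) = (\<Sum>\<alpha>\<in>S. schur_coeffs F \<alpha> * (\<Sum>j\<in>I. ?d j \<alpha>))"
    by (simp only: hall_schur_sum[OF S])
  also have "\<dots> = (\<Sum>j\<in>I. \<Sum>\<alpha>\<in>S. schur_coeffs F \<alpha> * ?d j \<alpha>)"
    by (simp only: sum_distrib_left) (rule sum.swap)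
  also have "\<dots> = (\<Sum>j\<in>I. coeff_of F (M j))"
  proof (rule sum.cong[OF refl])
    fix j assume "j \<in> I"
    have "(\<Sum>\<alpha>\<in>S. schur_coeffs F \<alpha> * ?d j \<alpha>) = (\<Sum>\<alpha>\<in>?P j. schur_coeffs F \<alpha> * coeff_of (schur \<alpha>) (M j))"
      by (rule sum.mono_neutral_cong_right) (use S \<open>j \<in> I\<close> in \<open>auto simp: S_def\<close>)
    then show "(\<Sum>\<alpha>\<in>S. schur_coeffs F \<alpha> * ?d j \<alpha>) = coeff_of F (M j)"
      using schur_coeffs_expansion(2)[OF assms(1), of "M j"] by simp
  qed
  finally show ?thesis .
qed

lemma hall_monomial_dual: "symmetric F \<Longrightarrow> hall F (monomial_dual M) = coeff_of F M"
  using hall_sum_monomial_dual[of F "{()}" "\<lambda>_. M"] by simp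

definition monomial_dual1 :: "(unit \<times> nat) multiset \<Rightarrow> unit symf" where
  "monomial_dual1 m = (\<Sum>\<nu> | \<nu> \<in> Par \<and> sum_list \<nu> = size m. mscale (coeff_of (schur1 \<nu>) m) (schur1 \<nu>))"

text \<open>Distributivity: choosing a Schur function in every alphabet is choosing a family of
  partitions, and the Kostka numbers multiply.\<close>

lemma prod_monomial_dual1:
  assumes "finite J" "\<And>i. section_at i M = (if i \<in> J then m i else {#})"
  shows "(\<Prod>j\<in>J. in_alphabet j (monomial_dual1 (m j))) = monomial_dual M"
proof -
  let ?P = "\<lambda>j. {\<nu>. \<nu> \<in> Par \<and> sum_list \<nu> = size (m j)}"
  have msize: "msize M i = (if i \<in> J then size (m i) else 0)" for i
    using assms(2)[of i] size_section_at[of i M] by auto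
  have supp: "fst ` set_mset M \<subseteq> J"
  proof
    fix i assume "i \<in> fst ` set_mset M"
    then obtain v where "v \<in># M" "fst v = i"
      by auto
    then have "section_at i M \<noteq> {#}"
      by (auto simp: section_at_def filter_mset_eq_conv)
    then show "i \<in> J"
      using assms(2)[of i] by (auto split: if_splits)
  qed
  have "(\<Prod>j\<in>J. in_alphabet j (monomial_dual1 (m j)))
     = (\<Prod>j\<in>J. \<Sum>\<nu>\<in>?P j. mscale (coeff_of (schur1 \<nu>) (m j)) (in_alphabet j (schur1 \<nu>)))"
    by (simp add: monomial_dual1_def in_alphabet_def rename_sum rename_mscale)
  also have "\<dots> = (\<Sum>\<alpha>\<in>PiE J ?P. \<Prod>j\<in>J. mscale (coeff_of (schur1 (\<alpha> j)) (m j)) (in_alphabet j (schur1 (\<alpha> j))))"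
    by (rule prod_sum_PiE) (use assms finite_partitions in auto)
  \<comment> \<open>A member of \<open>Par_of_size (msize M)\<close> is empty outside
    \<open>J\<close>, where the multidegree vanishes, so it is determined by its restriction to
    \<open>J\<close>.\<close>
  also have "\<dots> = (\<Sum>\<alpha>\<in>Par_of_size (msize M). mscale (coeff_of (schur \<alpha>) M) (schur \<alpha>))"
  proof (rule sum.reindex_bij_witness[of _ "\<lambda>\<alpha>. restrict \<alpha> J" "\<lambda>\<alpha> i. if i \<in> J then \<alpha> i else []"])
    fix \<alpha> assume \<alpha>: "\<alpha> \<in> Par_of_size (msize M)"
    then have Nil: "\<alpha> i = []" if "i \<notin> J" for i
      using that Par_sum_list_0[of "\<alpha> i"] by (auto simp: Par_of_size_def msize Par_family_def)
    show "restrict \<alpha> J \<in> PiE J ?P"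
      using \<alpha> by (auto simp: Par_of_size_def msize Par_family_def)
    show "(\<lambda>i. if i \<in> J then restrict \<alpha> J i else []) = \<alpha>"
      using Nil by auto
  next
    fix \<alpha> assume \<alpha>: "\<alpha> \<in> PiE J ?P"
    let ?\<alpha> = "\<lambda>i. if i \<in> J then \<alpha> i else []"
    show "restrict ?\<alpha> J = \<alpha>"
    proof
      show "restrict ?\<alpha> J i = \<alpha> i" for i
        using PiE_arb[OF \<alpha>, of i] by (cases "i \<in> J") simp_all
    qed
    have "finite {i. ?\<alpha> i \<noteq> []}"
      by (rule finite_subset[OF _ assms(1)]) auto
    moreover have "[] \<in> Par"
      by (simp add: Par_def)
    moreover have "\<alpha> i \<in> Par \<and> sum_list (\<alpha> i) = size (m i)" if "i \<in> J" for i
      using PiE_mem[OF \<alpha> that] by simp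
    ultimately show "?\<alpha> \<in> Par_of_size (msize M)"
      by (simp add: Par_of_size_def Par_family_def msize)
    have schur: "schur ?\<alpha> = (\<Prod>j\<in>J. in_alphabet j (schur1 (\<alpha> j)))"
      by (subst schur_superset[OF assms(1)]) (auto split: if_splits)
    have "coeff_of (schur ?\<alpha>) M = (\<Prod>j\<in>J. coeff_of (schur1 (\<alpha> j)) (m j))"
      unfolding schur coeff_of_prod_in_alphabet[OF assms(1)] using supp assms(2) by simp
    then show "mscale (coeff_of (schur ?\<alpha>) M) (schur ?\<alpha>)
        = (\<Prod>j\<in>J. mscale (coeff_of (schur1 (\<alpha> j)) (m j)) (in_alphabet j (schur1 (\<alpha> j))))"
      by (simp add: mscale_prod[OF assms(1)] schur)
  qed
  finally show ?thesis
    by (simp add: monomial_dual_def)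
qed

section \<open>Power sums and plethysm\<close>

lemma Sym_0 [simp]: "0 \<in> Sym" and Sym_1 [simp]: "1 \<in> Sym"
  by (auto simp: Sym_iff coeff_of_1)

lemma Sym_add: "F \<in> Sym \<Longrightarrow> G \<in> Sym \<Longrightarrow> F + G \<in> Sym"
proof -
  assume *: "F \<in> Sym" "G \<in> Sym"
  then obtain d e where "\<And>M. coeff_of F M \<noteq> 0 \<Longrightarrow> size M \<le> d" "\<And>M. coeff_of G M \<noteq> 0 \<Longrightarrow> size M \<le> e"
    by (auto simp: Sym_iff)
  then have "size M \<le> max d e" if "coeff_of (F + G) M \<noteq> 0" for M
    using that by (cases "coeff_of F M = 0") (auto simp: le_max_iff_disj)
  then show ?thesis
    using * unfolding Sym_iff by (blast intro: symmetric_add)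
qed

lemma Sym_mscale: "F \<in> Sym \<Longrightarrow> mscale c F \<in> Sym"
  unfolding Sym_iff using symmetric_mscale by (metis coeff_of_mscale mult_zero_right)

lemma Sym_diff:
  assumes "F \<in> Sym" "G \<in> Sym"
  shows "F - G \<in> Sym"
proof -
  have "F - G = F + mscale (-1) G"
    by (rule mseries_eqI) simp
  then show ?thesis
    using assms by (simp only: Sym_add Sym_mscale)
qed

lemma Sym_sum: "(\<And>j. j \<in> J \<Longrightarrow> F j \<in> Sym) \<Longrightarrow> sum F J \<in> Sym"
  by (induction J rule: infinite_finite_induct) (auto intro: Sym_add)

lemma Sym_mult: "F \<in> Sym \<Longrightarrow> G \<in> Sym \<Longrightarrow> F * G \<in> Sym"
proof -
  assume *: "F \<in> Sym" "G \<in> Sym"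
  then obtain d e where de: "\<And>M. coeff_of F M \<noteq> 0 \<Longrightarrow> size M \<le> d" "\<And>M. coeff_of G M \<noteq> 0 \<Longrightarrow> size M \<le> e"
    by (auto simp: Sym_iff)
  have "size M \<le> d + e" if "coeff_of (F * G) M \<noteq> 0" for M
    using that
  proof (rule coeff_of_mult_nonzero)
    fix A B assume "A + B = M" "coeff_of F A \<noteq> 0" "coeff_of G B \<noteq> 0"
    then show "size M \<le> d + e"
      using de[of A] de[of B] by auto
  qed
  then show ?thesis
    using * unfolding Sym_iff by (blast intro: symmetric_mult)
qed

lemma Sym_prod_mset: "(\<And>j. j \<in># J \<Longrightarrow> F j \<in> Sym) \<Longrightarrow> (\<Prod>j\<in>#J. F j) \<in> Sym"
  by (induction J) (auto intro: Sym_mult)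

lemma homog_Sym: "symmetric F \<Longrightarrow> homog d F \<Longrightarrow> F \<in> Sym"
  unfolding Sym_iff homog_def by (metis order_refl)

subsection \<open>Products of power sums\<close>

definition psum_prod :: "('i \<times> nat) multiset \<Rightarrow> 'i symf" where
  "psum_prod A = (\<Prod>(i, r)\<in>#A. in_alphabet i (power_sum r))"

definition pos_type :: "('i \<times> nat) multiset \<Rightarrow> bool" where
  "pos_type A \<longleftrightarrow> (\<forall>(i, r)\<in>#A. 0 < r)"

lemma pos_type_simps [simp]: "pos_type {#}" "pos_type (add_mset x A) \<longleftrightarrow> 0 < snd x \<and> pos_type A"
    "pos_type (A + B) \<longleftrightarrow> pos_type A \<and> pos_type B"
  by (auto simp: pos_type_def)

lemma psum_prod_simps [simp]: "psum_prod {#} = 1"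
    "psum_prod (add_mset (i, r) A) = in_alphabet i (power_sum r) * psum_prod A"
    "psum_prod (A + B) = psum_prod A * psum_prod B"
  by (simp_all add: psum_prod_def)

lemma coeff_of_power_sum:
  "coeff_of (in_alphabet i (power_sum r)) M = (if \<exists>n. M = replicate_mset r (i, n) then 1 else 0)"
proof -
  have inj: "inj (\<lambda>(_ :: unit, n :: nat). (i, n))"
    by (auto simp: inj_on_def)
  show ?thesis
  proof (cases "\<exists>n. M = replicate_mset r (i, n)")
    case True
    then obtain n where M: "M = image_mset (\<lambda>(_ :: unit, n). (i, n)) (replicate_mset r ((), n))"
      by auto
    have "coeff_of (power_sum r) (replicate_mset r ((), n)) = 1"
      by (auto simp: power_sum_def)
    then show ?thesis
      using True unfolding M in_alphabet_def coeff_of_rename_image[OF inj] by (simp only: if_True)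
  next
    case False
    have "coeff_of (in_alphabet i (power_sum r)) M = 0"
    proof (rule ccontr)
      assume "coeff_of (in_alphabet i (power_sum r)) M \<noteq> 0"
      then obtain L where "M = image_mset (\<lambda>(_ :: unit, n). (i, n)) L" "coeff_of (power_sum r) L \<noteq> 0"
        unfolding in_alphabet_def by (rule coeff_of_rename_nonzero[OF inj])
      then show False
        using False by (auto simp: power_sum_def split: if_splits)
    qed
    then show ?thesis
      using False by simp
  qed
qed

lemma symmetric_power_sum: "symmetric (power_sum r)"
proof (rule symmetric_swapI)
  fix i :: unit and n M
  have swap2: "image_mset (swap_vars i n) (image_mset (swap_vars i n) M) = M" for M
  proof -
    have "swap_vars i n (swap_vars i n v) = v" for v
      by (cases v) simp
    then show ?thesis
      by (simp only: image_mset.compositionality o_def multiset.map_ident)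
  qed
  have *: "\<exists>m. image_mset (swap_vars i n) M = replicate_mset r ((), m)" if "\<exists>m. M = replicate_mset r ((), m)" for M
    using that by auto
  have "(\<exists>m. image_mset (swap_vars i n) M = replicate_mset r ((), m)) \<longleftrightarrow> (\<exists>m. M = replicate_mset r ((), m))"
    using *[of M] *[of "image_mset (swap_vars i n) M"] unfolding swap2 by blast
  then show "coeff_of (power_sum r) (image_mset (swap_vars i n) M) = coeff_of (power_sum r) M"
    unfolding power_sum_def coeff_of_Series by (simp only:)
qed

lemma homog_power_sum: "homog r (in_alphabet i (power_sum r))"
  by (auto simp: homog_def coeff_of_power_sum split: if_splits)

lemma Sym_power_sum: "in_alphabet i (power_sum r) \<in> Sym"
  by (rule homog_Sym[OF symmetric_in_alphabet[OF symmetric_power_sum] homog_power_sum])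

lemma Sym_psum_prod: "psum_prod A \<in> Sym"
  unfolding psum_prod_def by (intro Sym_prod_mset) (auto simp: Sym_power_sum)

lemma homog_psum_prod: "homog (\<Sum>x\<in>#A. snd x) (psum_prod A)"
  unfolding psum_prod_def by (intro homog_prod_mset) (auto simp: homog_power_sum)

lemma size_mtype: "size (mtype M) = card (set_mset M)"
  by (simp add: mtype_def)

lemma mtype_add_replicate:
  assumes "r > 0" "(i, n) \<notin># C"
  shows "mtype (replicate_mset r (i, n) + C) = add_mset (i, r) (mtype C)"
proof -
  let ?f = "\<lambda>v. (fst v, count (replicate_mset r (i, n) + C) v)"
  have "set_mset (replicate_mset r (i, n) + C) = insert (i, n) (set_mset C)"
    using assms(1) by auto
  then have "mtype (replicate_mset r (i, n) + C) = image_mset ?f (mset_set (insert (i, n) (set_mset C)))"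
    by (simp only: mtype_def)
  also have "\<dots> = add_mset (?f (i, n)) (image_mset ?f (mset_set (set_mset C)))"
    using assms(2) by simp
  also have "image_mset ?f (mset_set (set_mset C)) = mtype C"
    unfolding mtype_def by (rule image_mset_cong) (use assms in auto)
  also have "?f (i, n) = (i, r)"
    using assms by (simp add: not_in_iff)
  finally show ?thesis .
qed

lemma mtype_surj:
  fixes A :: "('i \<times> nat) multiset"
  assumes "pos_type A"
  obtains M where "mtype M = A"
proof -
  have "\<exists>M. mtype M = A"
    using assms
  proof (induction A)
    case empty
    then show ?case
      by (intro exI[of _ "{#}"]) (simp add: mtype_def)
  next
    case (add x A)
    then obtain M where M: "mtype M = A" by auto
    obtain i r where x: "x = (i, r)" by (cases x)
    have "finite (snd ` set_mset M)"
      by simp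
    then obtain n where "n \<notin> snd ` set_mset M"
      using ex_new_if_finite infinite_UNIV_nat by blast
    then have "(i, n) \<notin># M"
      by force
    then show ?case
      using add.prems M x mtype_add_replicate[of r i n M] by auto
  qed
  then show ?thesis
    using that by blast
qed

text \<open>A product of power sums contains only monomials obtained by multiplying some of the powers of
  variables in the same variable, so monomials with the maximal number of variables have the
  prescribed type.\<close>

lemma coeff_of_psum_prod:
  assumes "pos_type A"
  shows "\<exists>q. \<forall>M. coeff_of (psum_prod A) M = of_nat (q M) \<and>
     (q M \<noteq> 0 \<longrightarrow> card (set_mset M) \<le> size A \<and> (card (set_mset M) = size A \<longrightarrow> mtype M = A)) \<and>
     (mtype M = A \<longrightarrow> q M \<noteq> 0)"
  using assms
proof (induction A)
  case empty
  have "mtype M = {#} \<longleftrightarrow> M = {#}" for M :: "('a \<times> nat) multiset"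
    by (auto simp: mtype_def mset_set_empty_iff)
  then show ?case
    by (intro exI[of _ "\<lambda>M. if M = {#} then 1 else 0"]) (auto simp: coeff_of_1)
next
  case (add x A)
  obtain i r where x: "x = (i, r)" by (cases x)
  have r: "r > 0" and "pos_type A"
    using add.prems by (auto simp: x)
  from add.IH[OF \<open>pos_type A\<close>] obtain q where
    q: "\<And>M. coeff_of (psum_prod A) M = of_nat (q M)"
    and q1: "\<And>M. q M \<noteq> 0 \<Longrightarrow> card (set_mset M) \<le> size A"
    and q2: "\<And>M. q M \<noteq> 0 \<Longrightarrow> card (set_mset M) = size A \<Longrightarrow> mtype M = A"
    and q3: "\<And>M. mtype M = A \<Longrightarrow> q M \<noteq> 0"
    by blast
  \<comment> \<open>The coefficients are counted in the natural numbers: nothing cancels there, so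
    one contributing splitting already makes the leading coefficient nonzero.\<close>
  define f where "f = (\<lambda>(B :: ('a \<times> nat) multiset, C). (if \<exists>n. B = replicate_mset r (i, n) then 1 else 0) * q C)"
  define q' where "q' M = sum f (splits M)" for M
  have "coeff_of (psum_prod (add_mset x A)) M = of_nat (q' M)" for M
    unfolding x psum_prod_simps coeff_of_mult q'_def of_nat_sum
    by (rule sum.cong) (auto simp: coeff_of_power_sum q f_def)
  moreover have "card (set_mset M) \<le> size (add_mset x A) \<and>
      (card (set_mset M) = size (add_mset x A) \<longrightarrow> mtype M = add_mset x A)" if nz: "q' M \<noteq> 0" for M
  proof -
    obtain y where "y \<in> splits M" "f y \<noteq> 0"
      using nz unfolding q'_def by (rule sum.not_neutral_contains_not_neutral)
    moreover obtain B C where y: "y = (B, C)"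
      by (cases y)
    ultimately have BC: "B + C = M" and *: "(if \<exists>n. B = replicate_mset r (i, n) then 1 else 0) * q C \<noteq> 0"
      unfolding splits_def f_def by simp_all
    from * have "\<exists>n. B = replicate_mset r (i, n)"
      by (cases "\<exists>n. B = replicate_mset r (i, n)") (simp_all only: if_False mult_0 not_True_eq_False)
    then obtain n where M: "M = replicate_mset r (i, n) + C"
      using BC by blast
    from * have C: "q C \<noteq> 0"
      by (rule contrapos_nn) simp
    have set: "set_mset M = insert (i, n) (set_mset C)"
      using r by (auto simp: M)
    show ?thesis
    proof (cases "(i, n) \<in># C")
      case True
      then show ?thesis
        using q1[OF C] set by (simp add: insert_absorb)
    next
      case False
      then show ?thesis
        using q1[OF C] q2[OF C] set mtype_add_replicate[OF r False] by (simp add: x M)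
    qed
  qed
  moreover have "q' M \<noteq> 0" if M: "mtype M = add_mset x A" for M
  proof -
    have "(i, r) \<in># mtype M"
      by (simp add: M x)
    then obtain n where n: "count M (i, n) = r"
      by (auto simp: mtype_def)
    define C where "C = {#v \<in># M. v \<noteq> (i, n)#}"
    have M': "M = replicate_mset r (i, n) + C"
      by (rule multiset_eqI) (use n in \<open>auto simp: C_def\<close>)
    have "(i, n) \<notin># C"
      by (simp add: C_def)
    then have "mtype C = A"
      using mtype_add_replicate[OF r, of i n C] M by (simp add: M' x)
    then have "q C \<noteq> 0"
      by (rule q3)
    moreover have "(replicate_mset r (i, n), C) \<in> splits M"
      by (simp add: splits_iff M')
    ultimately show ?thesis
      unfolding q'_def by (subst sum_eq_0_iff) (auto intro!: bexI[of _ "(replicate_mset r (i, n), C)"] simp: f_def)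
  qed
  ultimately show ?case
    by blast
qed

lemma psum_prod_support:
  assumes "pos_type A" "coeff_of (psum_prod A) M \<noteq> 0"
  shows "card (set_mset M) \<le> size A" "card (set_mset M) = size A \<Longrightarrow> mtype M = A"
  using coeff_of_psum_prod[OF assms(1)] assms(2) by (metis of_nat_0)+

lemma psum_prod_leading: "pos_type A \<Longrightarrow> mtype M = A \<Longrightarrow> coeff_of (psum_prod A) M \<noteq> 0"
  using coeff_of_psum_prod by (metis of_nat_eq_0_iff)

lemma pos_type_mtype: "pos_type (mtype M)"
  by (auto simp: pos_type_def mtype_def)

text \<open>Induction on the largest number of variables in a monomial. Multiples of products of
  power sums cancel the monomials with exactly n variables; only finitely many types arise, the
  exponents being bounded by the degree and the alphabets finite in number.\<close>

lemma Sym_span_aux: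
  fixes F :: "('i::finite) symf"
  assumes "F \<in> Sym" "\<And>M. coeff_of F M \<noteq> 0 \<Longrightarrow> card (set_mset M) < n"
  shows "F \<in> mseries.span (psum_prod ` {A. pos_type A})"
  using assms
proof (induction n arbitrary: F)
  case 0
  then have "F = 0"
    by (intro mseries_eqI) auto
  then show ?case
    by (simp add: mseries.span_zero)
next
  case (Suc n)
  from Suc.prems(1) obtain d where d: "\<And>M. coeff_of F M \<noteq> 0 \<Longrightarrow> size M \<le> d" and sym: "symmetric F"
    by (auto simp: Sym_iff)
  define S where "S = mtype ` {M. coeff_of F M \<noteq> 0 \<and> card (set_mset M) = n}"
  have "S \<subseteq> multisets_of_size (UNIV \<times> {..d}) n"
  proof
    fix A assume "A \<in> S"
    then obtain M where M: "A = mtype M" "coeff_of F M \<noteq> 0" "card (set_mset M) = n"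
      by (auto simp: S_def)
    then have "count M v \<le> d" for v
      using d[of M] count_le_size[of M v] by linarith
    then show "A \<in> multisets_of_size (UNIV \<times> {..d}) n"
      using M size_mtype[of M] by (auto simp: multisets_of_size_def mtype_def)
  qed
  then have fin: "finite S"
    by (rule finite_subset) auto
  \<comment> \<open>Any monomial of the given type will do: the coefficients of \<open>F\<close> and
    of \<open>psum_prod A\<close> depend only on the type.\<close>
  define rep where "rep A = (SOME M. mtype M = A)" for A :: "('i \<times> nat) multiset"
  have rep: "mtype (rep (mtype M)) = mtype M" for M
    unfolding rep_def by (rule someI_ex) blast
  have pos: "pos_type A" and size: "size A = n" if "A \<in> S" for A
    using that by (auto simp: S_def pos_type_mtype size_mtype)
  define c where "c A = coeff_of F (rep A) / coeff_of (psum_prod A) (rep A)" for A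
  define G where "G = (\<Sum>A\<in>S. mscale (c A) (psum_prod A))"
  have "G \<in> mseries.span (psum_prod ` {A. pos_type A})"
    unfolding G_def by (intro mseries.span_sum mseries.span_scale mseries.span_base) (use pos in auto)
  moreover have "F - G \<in> mseries.span (psum_prod ` {A. pos_type A})"
  proof (rule Suc.IH)
    show "F - G \<in> Sym"
      unfolding G_def by (intro Sym_diff Suc.prems(1) Sym_sum Sym_mscale Sym_psum_prod)
    fix M assume M: "coeff_of (F - G) M \<noteq> 0"
    show "card (set_mset M) < n"
    proof (rule ccontr)
      assume n: "\<not> card (set_mset M) < n"
      have 0: "coeff_of (psum_prod A) M = 0" if "A \<in> S" "A \<noteq> mtype M" for A
        using psum_prod_support[OF pos[OF that(1)], of M] size[OF that(1)] that n by force
      have "coeff_of G M = (\<Sum>A\<in>S \<inter> {mtype M}. c A * coeff_of (psum_prod A) M)"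
        unfolding G_def coeff_of_sum coeff_of_mscale
        by (rule sum.mono_neutral_right) (use fin 0 in auto)
      also have "\<dots> = coeff_of F M"
      proof (cases "mtype M \<in> S")
        case True
        have "coeff_of (psum_prod (mtype M)) (rep (mtype M)) = coeff_of (psum_prod (mtype M)) M"
          using Sym_psum_prod rep by (auto simp: Sym_iff intro: symmetric_mtype)
        moreover have "coeff_of F (rep (mtype M)) = coeff_of F M"
          using sym rep by (rule symmetric_mtype)
        ultimately show ?thesis
          using True psum_prod_leading[OF pos_type_mtype refl, of M] by (simp add: c_def)
      next
        case False
        have "coeff_of F M = 0"
        proof (rule ccontr)
          assume "coeff_of F M \<noteq> 0"
          then have "mtype M \<in> S"
            using n Suc.prems(2)[of M] unfolding S_def by (intro imageI) simp
          with False show False ..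
        qed
        then show ?thesis
          using False by simp
      qed
      finally show False
        using M by simp
    qed
  qed
  ultimately have "(F - G) + G \<in> mseries.span (psum_prod ` {A. pos_type A})"
    by (intro mseries.span_add)
  then show ?case by simp
qed

lemma Sym_span:
  fixes F :: "('i::finite) symf"
  assumes "F \<in> Sym"
  shows "F \<in> mseries.span (psum_prod ` {A. pos_type A})"
proof -
  from assms obtain d where d: "\<And>M. coeff_of F M \<noteq> 0 \<Longrightarrow> size M \<le> d"
    by (auto simp: Sym_iff)
  show ?thesis
  proof (rule Sym_span_aux[OF assms, of "Suc d"])
    fix M assume "coeff_of F M \<noteq> 0"
    moreover have "card (set_mset M) \<le> size M"
      using size_multiset_overloaded_eq[of M] sum_mono[of "set_mset M" "\<lambda>_. 1" "count M"]
      by (simp add: Suc_le_eq)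
    ultimately show "card (set_mset M) < Suc d"
      using d[of M] by simp
  qed
qed

text \<open>Among the types with nonzero coefficient take one, B, with the most elements. At a
  monomial of type B every other product vanishes: it either has too few factors to produce so many
  variables or would force its own type.\<close>

lemma psum_prod_independent:
  assumes "finite S" "\<And>A. A \<in> S \<Longrightarrow> pos_type A" "(\<Sum>A\<in>S. mscale (c A) (psum_prod A)) = 0" "A \<in> S"
  shows "c A = 0"
proof (rule ccontr)
  assume "c A \<noteq> 0"
  define Q where "Q = {A \<in> S. c A \<noteq> 0}"
  have Q: "finite (size ` Q)" "size ` Q \<noteq> {}"
    using assms \<open>c A \<noteq> 0\<close> by (auto simp: Q_def)
  obtain B where B: "B \<in> Q" "size B = Max (size ` Q)"
    using Max_in[OF Q] by auto
  then have "pos_type B"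
    using assms by (auto simp: Q_def)
  then obtain M where M: "mtype M = B"
    by (rule mtype_surj)
  have "coeff_of (psum_prod A) M = 0" if "A \<in> Q" "A \<noteq> B" for A
  proof (rule ccontr)
    assume "coeff_of (psum_prod A) M \<noteq> 0"
    then have "card (set_mset M) \<le> size A" "card (set_mset M) = size A \<Longrightarrow> mtype M = A"
      using psum_prod_support[of A M] that assms by (auto simp: Q_def)
    moreover have "size A \<le> size B"
      unfolding B(2) using that Q by (intro Max_ge) auto
    ultimately show False
      using that M size_mtype[of M] by auto
  qed
  then have "(\<Sum>A\<in>S. c A * coeff_of (psum_prod A) M) = (\<Sum>A\<in>{B}. c A * coeff_of (psum_prod A) M)"
    using B assms(1) by (intro sum.mono_neutral_right) (auto simp: Q_def)
  moreover have "coeff_of (\<Sum>A\<in>S. mscale (c A) (psum_prod A)) M = 0"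
    unfolding assms(3) by simp
  ultimately have "c B * coeff_of (psum_prod B) M = 0"
    by simp
  then show False
    using psum_prod_leading[OF \<open>pos_type B\<close> M] B by (auto simp: Q_def)
qed


subsection \<open>Plethysm\<close>

definition pos_poly :: "(('i \<times> nat) multiset \<Rightarrow>\<^sub>0 rf) \<Rightarrow> bool" where
  "pos_poly c \<longleftrightarrow> (\<forall>A\<in>Poly_Mapping.keys c. pos_type A)"

lemma eval_psum_superset:
  assumes "finite S" "Poly_Mapping.keys c \<subseteq> S"
  shows "eval_psum \<phi> c = (\<Sum>A\<in>S. mscale (Poly_Mapping.lookup c A) (\<Prod>(i, r)\<in>#A. \<phi> i r))"
  unfolding eval_psum_def
  by (rule sum.mono_neutral_left) (use assms in \<open>auto simp: in_keys_iff intro!: mseries_eqI\<close>)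

lemma eval_psum_add: "eval_psum \<phi> (c + d) = eval_psum \<phi> c + eval_psum \<phi> d"
proof -
  let ?S = "Poly_Mapping.keys c \<union> Poly_Mapping.keys d"
  have S: "finite ?S" by simp
  have "Poly_Mapping.keys (c + d) \<subseteq> ?S"
    by (rule Poly_Mapping.keys_add)
  from eval_psum_superset[OF S this] show ?thesis
    by (simp add: eval_psum_superset[OF S] lookup_add mseries.scale_left_distrib sum.distrib)
qed

lemma eval_psum_scale:
  "eval_psum \<phi> (Poly_Mapping.map ((*) k) c) = mscale k (eval_psum \<phi> c)"
proof -
  have "Poly_Mapping.keys (Poly_Mapping.map ((*) k) c) \<subseteq> Poly_Mapping.keys c"
    by (auto simp: in_keys_iff Poly_Mapping.map.rep_eq when_def)
  from eval_psum_superset[OF finite_keys this] have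
    "eval_psum \<phi> (Poly_Mapping.map ((*) k) c)
      = (\<Sum>A\<in>Poly_Mapping.keys c. mscale k (mscale (Poly_Mapping.lookup c A) (\<Prod>(i, r)\<in>#A. \<phi> i r)))"
    by (simp add: Poly_Mapping.map.rep_eq when_def in_keys_iff)
  then show ?thesis
    by (simp add: eval_psum_def mseries.scale_sum_right)
qed

lemma pos_poly_add: "pos_poly c \<Longrightarrow> pos_poly d \<Longrightarrow> pos_poly (c + d)"
  using Poly_Mapping.keys_add[of c d] by (auto simp: pos_poly_def)

lemma pos_poly_scale: "pos_poly c \<Longrightarrow> pos_poly (Poly_Mapping.map ((*) k) c)"
  by (auto simp: pos_poly_def in_keys_iff Poly_Mapping.map.rep_eq when_def)

lemma eval_psum_single: "eval_psum \<phi> (Poly_Mapping.single A 1) = (\<Prod>(i, r)\<in>#A. \<phi> i r)"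
  by (subst eval_psum_superset[of "{A}"]) auto

abbreviation power_sums :: "'i \<Rightarrow> nat \<Rightarrow> 'i symf" where
  "power_sums \<equiv> (\<lambda>i r. in_alphabet i (power_sum r))"

text \<open>Algebraic independence of the power sums settles the description in
  \<open>psum_expansion_def\<close>; from here on plethysm is a substitution.\<close>

lemma psum_expansion_eval:
  assumes "pos_poly c"
  shows "psum_expansion (eval_psum power_sums c) = c"
  unfolding psum_expansion_def
proof (rule the_equality)
  fix d :: "('a \<times> nat) multiset \<Rightarrow>\<^sub>0 rf"
  assume d: "(\<forall>A\<in>Poly_Mapping.keys d. \<forall>(i, r)\<in>#A. 0 < r) \<and> eval_psum power_sums c = eval_psum power_sums d"
  let ?S = "Poly_Mapping.keys c \<union> Poly_Mapping.keys d"
  have S: "finite ?S" "\<And>A. A \<in> ?S \<Longrightarrow> pos_type A"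
    using d assms by (auto simp: pos_poly_def pos_type_def)
  have "(\<Sum>A\<in>?S. mscale (Poly_Mapping.lookup c A - Poly_Mapping.lookup d A) (psum_prod A)) = 0"
    using eval_psum_superset[OF S(1), of c power_sums] eval_psum_superset[OF S(1), of d power_sums] d
    by (simp add: mseries.scale_left_diff_distrib sum_subtractf psum_prod_def)
  from psum_prod_independent[OF S this] have "Poly_Mapping.lookup c A = Poly_Mapping.lookup d A" if "A \<in> ?S" for A
    using that by simp
  then show "d = c"
    by (intro poly_mapping_eqI) (metis UnCI in_keys_iff)
qed (use assms in \<open>auto simp: pos_poly_def pos_type_def\<close>)

lemma Sym_eval_psum:
  fixes F :: "('i::finite) symf"
  assumes "F \<in> Sym"
  obtains c where "pos_poly c" "F = eval_psum power_sums c"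
proof -
  have "mseries.span (psum_prod ` {A. pos_type A}) \<subseteq> (eval_psum power_sums ` {c. pos_poly c} :: 'i symf set)"
  proof (rule mseries.span_minimal)
    show "psum_prod ` {A. pos_type A} \<subseteq> (eval_psum power_sums ` {c. pos_poly c} :: 'i symf set)"
    proof (clarify, rule image_eqI)
      fix A :: "('i \<times> nat) multiset"
      assume "pos_type A"
      then show "Poly_Mapping.single A 1 \<in> {c :: _ \<Rightarrow>\<^sub>0 rf. pos_poly c}"
        by (simp add: pos_poly_def)
    qed (simp add: eval_psum_single psum_prod_def)
    show "mseries.subspace (eval_psum power_sums ` {c. pos_poly c} :: 'i symf set)"
    proof (rule mseries.subspaceI)
      show "0 \<in> (eval_psum power_sums ` {c. pos_poly c} :: 'i symf set)"
        by (rule image_eqI[of _ _ 0]) (auto simp: eval_psum_def pos_poly_def)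
    next
      fix x y :: "'i symf" assume "x \<in> eval_psum power_sums ` {c. pos_poly c}" "y \<in> eval_psum power_sums ` {c. pos_poly c}"
      then show "x + y \<in> eval_psum power_sums ` {c. pos_poly c}"
        by (auto simp: eval_psum_add[symmetric] intro!: imageI pos_poly_add)
    next
      fix k and x :: "'i symf" assume "x \<in> eval_psum power_sums ` {c. pos_poly c}"
      then show "mscale k x \<in> eval_psum power_sums ` {c. pos_poly c}"
        by (auto simp: eval_psum_scale[symmetric] intro!: imageI pos_poly_scale)
    qed
  qed
  then show ?thesis
    using Sym_span[OF assms] that by blast
qed

definition plethysm_psum :: "rf ^ 'i ^ 'i \<Rightarrow> 'i \<Rightarrow> nat \<Rightarrow> ('i::finite) symf" where
  "plethysm_psum M i r = (\<Sum>k\<in>UNIV. mscale (adams_rf r (M $ i $ k)) (in_alphabet k (power_sum r)))"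

lemma plethysm_eval:
  assumes "pos_poly c"
  shows "plethysm M (eval_psum power_sums c) = eval_psum (plethysm_psum M) c"
  unfolding plethysm_def psum_expansion_eval[OF assms] plethysm_psum_def ..

lemma plethysm_add:
  assumes "F \<in> Sym" "G \<in> Sym"
  shows "plethysm M (F + G) = plethysm M F + plethysm M G"
proof -
  from assms(1) obtain c where "pos_poly c" "F = eval_psum power_sums c"
    by (rule Sym_eval_psum)
  moreover from assms(2) obtain d where "pos_poly d" "G = eval_psum power_sums d"
    by (rule Sym_eval_psum)
  ultimately show ?thesis
    by (simp add: plethysm_eval pos_poly_add flip: eval_psum_add)
qed

lemma plethysm_mscale:
  assumes "F \<in> Sym"
  shows "plethysm M (mscale k F) = mscale k (plethysm M F)"
proof -
  from assms obtain c where "pos_poly c" "F = eval_psum power_sums c"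
    by (rule Sym_eval_psum)
  then show ?thesis
    by (simp add: plethysm_eval pos_poly_scale flip: eval_psum_scale)
qed

lemma plethysm_0: "plethysm M 0 = 0"
  using plethysm_mscale[of 0 M 0] by simp

lemma plethysm_sum:
  "(\<And>j. j \<in> J \<Longrightarrow> F j \<in> Sym) \<Longrightarrow> plethysm M (sum F J) = (\<Sum>j\<in>J. plethysm M (F j))"
  by (induction J rule: infinite_finite_induct) (auto simp: plethysm_0 plethysm_add Sym_sum)

lemma plethysm_psum_prod:
  assumes "pos_type A"
  shows "plethysm M (psum_prod A) = (\<Prod>(i, r)\<in>#A. plethysm_psum M i r)"
proof -
  have "pos_poly (Poly_Mapping.single A 1)"
    using assms by (simp add: pos_poly_def)
  from plethysm_eval[OF this, of M] show ?thesis
    by (simp add: eval_psum_single psum_prod_def)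
qed

lemma plethysm_power_sum: "r > 0 \<Longrightarrow> plethysm M (in_alphabet i (power_sum r)) = plethysm_psum M i r"
  using plethysm_psum_prod[of "{#(i, r)#}" M] by simp

lemma Sym_plethysm_psum: "plethysm_psum M i r \<in> Sym"
  unfolding plethysm_psum_def by (intro Sym_sum Sym_mscale Sym_power_sum)

lemma homog_plethysm_psum: "homog r (plethysm_psum M i r)"
  unfolding plethysm_psum_def by (intro homog_sum homog_mscale homog_power_sum)

text \<open>Power sum products span \<open>Sym\<close>, so linear statements can be checked on
  them.\<close>

lemma Sym_induct [consumes 1, case_names psum_prod add mscale]:
  fixes F :: "('i::finite) symf"
  assumes "F \<in> Sym" "\<And>A. pos_type A \<Longrightarrow> P (psum_prod A)"
    and add: "\<And>F G. F \<in> Sym \<Longrightarrow> G \<in> Sym \<Longrightarrow> P F \<Longrightarrow> P G \<Longrightarrow> P (F + G)"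
    and mscale: "\<And>k F. F \<in> Sym \<Longrightarrow> P F \<Longrightarrow> P (mscale k F)"
  shows "P F"
proof -
  have "F \<in> Sym \<and> P F"
    using Sym_span[OF assms(1)]
  proof (induction rule: mseries.span_induct_alt)
    case base
    show ?case
      using mscale[OF Sym_psum_prod assms(2), of "{#}" 0] by simp
  next
    case (step k x y)
    then show ?case
      using assms(2) by (auto intro!: Sym_add Sym_mscale Sym_psum_prod add mscale)
  qed
  then show ?thesis ..
qed

lemma Sym_plethysm:
  assumes "F \<in> Sym"
  shows "plethysm M F \<in> Sym"
  using assms
  by (induction rule: Sym_induct)
     (auto simp: plethysm_add plethysm_mscale plethysm_psum_prod Sym_add Sym_mscale
        intro!: Sym_prod_mset Sym_plethysm_psum)

lemma plethysm_mult:
  assumes "F \<in> Sym" "G \<in> Sym"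
  shows "plethysm M (F * G) = plethysm M F * plethysm M G"
  using assms(1)
proof (induction rule: Sym_induct)
  case (psum_prod A)
  show ?case
    using assms(2)
  proof (induction rule: Sym_induct)
    case (psum_prod B)
    then show ?case
      using \<open>pos_type A\<close> plethysm_psum_prod[of "A + B" M] by (simp add: plethysm_psum_prod)
  next
    case (add F G)
    then show ?case
      by (simp add: distrib_left plethysm_add Sym_mult Sym_psum_prod)
  next
    case (mscale k F)
    then show ?case
      by (simp add: mscale_mult_right plethysm_mscale Sym_mult Sym_psum_prod)
  qed
next
  case (add F G')
  then show ?case
    by (simp add: distrib_right plethysm_add Sym_mult assms(2))
next
  case (mscale k F)
  then show ?case
    by (simp add: mscale_mult_left plethysm_mscale Sym_mult assms(2))
qed

lemma plethysm_1: "plethysm M 1 = 1"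
  using plethysm_psum_prod[of "{#}" M] by simp

text \<open>\<open>adams_rf r\<close> is a ring homomorphism, so on the r-th power sums the two
  substitutions multiply as the matrices do.\<close>

lemma plethysm_plethysm_psum:
  assumes "r > 0" "M ** M' = mat 1"
  shows "plethysm M' (plethysm_psum M i r) = in_alphabet i (power_sum r)"
proof -
  have "plethysm M' (plethysm_psum M i r)
      = (\<Sum>k\<in>UNIV. mscale (adams_rf r (M $ i $ k)) (plethysm_psum M' k r))"
    using assms(1) by (simp add: plethysm_psum_def[of M] plethysm_sum Sym_mscale Sym_power_sum
        plethysm_mscale plethysm_power_sum)
  also have "\<dots> = (\<Sum>l\<in>UNIV. mscale (\<Sum>k\<in>UNIV. adams_rf r (M $ i $ k) * adams_rf r (M' $ k $ l))
      (in_alphabet l (power_sum r)))"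
    unfolding plethysm_psum_def
    by (rule mseries_eqI) (simp add: sum_distrib_left sum_distrib_right mult.assoc, rule sum.swap)
  also have "\<dots> = (\<Sum>l\<in>UNIV. mscale (if l = i then 1 else 0) (in_alphabet l (power_sum r)))"
  proof (rule sum.cong[OF refl])
    fix l
    have "(\<Sum>k\<in>UNIV. adams_rf r (M $ i $ k) * adams_rf r (M' $ k $ l)) = adams_rf r ((M ** M') $ i $ l)"
      using assms(1) by (simp add: matrix_matrix_mult_def adams_rf_sum adams_rf_mult)
    also have "\<dots> = (if l = i then 1 else 0)"
      using assms by (auto simp: mat_def)
    finally show "mscale (\<Sum>k\<in>UNIV. adams_rf r (M $ i $ k) * adams_rf r (M' $ k $ l)) (in_alphabet l (power_sum r))
       = mscale (if l = i then 1 else 0) (in_alphabet l (power_sum r))"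
      by simp
  qed
  also have "\<dots> = (\<Sum>l\<in>UNIV. if l = i then in_alphabet l (power_sum r) else 0)"
    by (rule sum.cong) auto
  finally show ?thesis
    by simp
qed

text \<open>By linearity and multiplicativity a single power sum decides. This carries uniqueness
  and homogeneity from the plethysm of a Macdonald polynomial back to the polynomial itself.\<close>

lemma plethysm_inverse:
  assumes "F \<in> Sym" "M ** M' = mat 1"
  shows "plethysm M' (plethysm M F) = F"
  using assms(1)
proof (induction rule: Sym_induct)
  case (psum_prod A)
  have "plethysm M' (\<Prod>(i, r)\<in>#A. plethysm_psum M i r) = psum_prod A" if "pos_type A" for A
    using that
  proof (induction A)
    case (add x A)
    obtain i r where x: "x = (i, r)" by (cases x)
    have "(\<Prod>(i, r)\<in>#A. plethysm_psum M i r) \<in> Sym"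
      by (intro Sym_prod_mset) (auto simp: Sym_plethysm_psum)
    then show ?case
      using add assms(2) by (simp add: x plethysm_mult Sym_plethysm_psum plethysm_plethysm_psum)
  qed (simp add: plethysm_1)
  then show ?case
    using psum_prod by (simp add: plethysm_psum_prod)
qed (simp_all add: plethysm_add plethysm_mscale Sym_plethysm)

text \<open>In a homogeneous \<open>F\<close> the power sum products of other degrees contribute
  nothing and may be dropped; the substitution respects the degree of each remaining
  product.\<close>

lemma homog_plethysm:
  fixes F :: "('i::finite) symf"
  assumes "F \<in> Sym" "homog d F"
  shows "homog d (plethysm M F)"
proof -
  obtain c where c: "pos_poly c" "F = eval_psum power_sums c"
    using assms(1) by (rule Sym_eval_psum)
  let ?deg = "\<lambda>A :: ('i \<times> nat) multiset. \<Sum>x\<in>#A. snd x"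
  let ?K = "{A \<in> Poly_Mapping.keys c. ?deg A = d}"
  have "F = (\<Sum>A\<in>?K. mscale (Poly_Mapping.lookup c A) (psum_prod A))"
  proof (rule mseries_eqI)
    fix M
    have F: "coeff_of F M = (\<Sum>A\<in>Poly_Mapping.keys c. Poly_Mapping.lookup c A * coeff_of (psum_prod A) M)"
      by (simp add: c(2) eval_psum_def psum_prod_def)
    have 0: "coeff_of (psum_prod A) M = 0" if "size M \<noteq> ?deg A" for A
      using homogD[OF homog_psum_prod that] .
    show "coeff_of F M = coeff_of (\<Sum>A\<in>?K. mscale (Poly_Mapping.lookup c A) (psum_prod A)) M"
    proof (cases "size M = d")
      case True
      then show ?thesis
        unfolding F coeff_of_sum coeff_of_mscale by (intro sum.mono_neutral_right) (auto intro!: 0)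
    next
      case False
      then have "coeff_of F M = 0"
        using assms(2) by (auto simp: homog_def)
      moreover have "(\<Sum>A\<in>?K. Poly_Mapping.lookup c A * coeff_of (psum_prod A) M) = 0"
        using False 0 by (intro sum.neutral) auto
      ultimately show ?thesis
        by simp
    qed
  qed
  then have "plethysm M F = plethysm M (\<Sum>A\<in>?K. mscale (Poly_Mapping.lookup c A) (psum_prod A))"
    by (rule arg_cong)
  also have "\<dots> = (\<Sum>A\<in>?K. mscale (Poly_Mapping.lookup c A) (\<Prod>(i, r)\<in>#A. plethysm_psum M i r))"
    using c(1) by (simp add: plethysm_sum Sym_mscale Sym_psum_prod plethysm_mscale plethysm_psum_prod pos_poly_def)
  finally show ?thesis
  proof (elim ssubst, intro homog_sum homog_mscale)
    fix A assume "A \<in> ?K"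
    moreover have "homog (?deg A) (\<Prod>(i, r)\<in>#A. plethysm_psum M i r)"
      by (rule homog_prod_mset) (auto simp: homog_plethysm_psum)
    ultimately show "homog d (\<Prod>(i, r)\<in>#A. plethysm_psum M i r)"
      by simp
  qed
qed

section \<open>Small partitions and their 2-quotients\<close>

lemma Par_Nil [simp]: "[] \<in> Par"
  and Par_1 [simp]: "[Suc 0] \<in> Par" and Par_2 [simp]: "[2] \<in> Par" and Par_11 [simp]: "[Suc 0, Suc 0] \<in> Par"
  by (auto simp: Par_def)

lemma Par_Cons: "m # \<nu> \<in> Par \<longleftrightarrow> 0 < m \<and> (\<forall>k\<in>set \<nu>. k \<le> m) \<and> \<nu> \<in> Par"
  by (auto simp: Par_def)

lemma Par_sum_list_1: "\<nu> \<in> Par \<Longrightarrow> sum_list \<nu> = 1 \<longleftrightarrow> \<nu> = [1]"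
  by (cases \<nu>) (auto simp: Par_Cons Par_sum_list_0 add_is_1 simp del: sum_list_eq_0_iff)

lemma Par_sum_list_2: "\<nu> \<in> Par \<Longrightarrow> sum_list \<nu> = 2 \<longleftrightarrow> \<nu> = [2] \<or> \<nu> = [1, 1]"
proof
  assume *: "\<nu> \<in> Par" "sum_list \<nu> = 2"
  then obtain m \<mu> where \<nu>: "\<nu> = m # \<mu>" by (cases \<nu>) auto
  then have "m = 2 \<and> sum_list \<mu> = 0 \<or> m = 1 \<and> sum_list \<mu> = 1"
    using * by (simp add: Par_Cons del: sum_list_eq_0_iff) arith
  then consider "m = 2" "sum_list \<mu> = 0" | "m = 1" "sum_list \<mu> = 1"
    by metis
  then show "\<nu> = [2] \<or> \<nu> = [1, 1]"
    using * Par_sum_list_0[of \<mu>] Par_sum_list_1[of \<mu>] by cases (auto simp: \<nu> Par_Cons)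
qed auto

lemma part_simps [simp]: "part [] n = 0" "part (m # \<nu>) 0 = m" "part (m # \<nu>) (Suc n) = part \<nu> n"
  by (auto simp: nth_default_def)

lemma dual_Nil [simp]: "dual [] = []"
  by (simp add: dual_def)

lemma dual_1 [simp]: "dual [Suc 0] = [Suc 0]"
proof -
  have "{i. 0 < part [Suc 0] i} = {0}"
    by (auto simp: nth_default_def less_Suc_eq)
  then show ?thesis
    by (simp add: dual_def)
qed

lemma dual_2 [simp]: "dual [2] = [Suc 0, Suc 0]"
proof -
  have "{i. 0 < part [2] i} = {0}" "{i. 1 < part [2] i} = {0}"
    by (auto simp: nth_default_def split: if_splits)
  then show ?thesis
    by (simp add: dual_def upt_rec)
qed

lemma dual_11 [simp]: "dual [Suc 0, Suc 0] = [2]"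
proof -
  have "{i. 0 < part [Suc 0, Suc 0] i} = {0, 1}"
    by (auto simp: nth_default_def split: if_splits)
  then show ?thesis
    by (simp add: dual_def)
qed

lemma dominates_row_iff: "\<mu> \<in> Par \<Longrightarrow> dominates \<mu> [2] \<longleftrightarrow> \<mu> = [2]"
proof
  assume *: "\<mu> \<in> Par" "dominates \<mu> [2]"
  then have "\<mu> = [2] \<or> \<mu> = [1, 1]"
    using Par_sum_list_2[of \<mu>] by (simp add: dominates_def)
  moreover have "(\<Sum>i<1. part [2] i) \<le> (\<Sum>i<1. part \<mu> i)"
    using * unfolding dominates_def by blast
  ultimately show "\<mu> = [2]"
    by auto
qed (auto simp: dominates_def)

lemma dominates_column_iff: "\<mu> \<in> Par \<Longrightarrow> dominates \<mu> [Suc 0, Suc 0] \<longleftrightarrow> \<mu> = [2] \<or> \<mu> = [1, 1]"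
proof -
  have "(\<Sum>i<n. part [Suc 0, Suc 0] i) \<le> (\<Sum>i<n. part [2] i)" for n
  proof (cases n)
    case (Suc m)
    have "(\<Sum>i<m. part [Suc 0] i) \<le> 1"
      by (cases m) (simp_all add: sum.lessThan_Suc_shift del: sum.lessThan_Suc)
    then show ?thesis
      by (simp add: Suc sum.lessThan_Suc_shift del: sum.lessThan_Suc)
  qed simp
  then show "\<mu> \<in> Par \<Longrightarrow> ?thesis"
    using Par_sum_list_2[of \<mu>] by (auto simp: dominates_def)
qed

lemma dominates_refl: "dominates \<mu> \<mu>"
  by (simp add: dominates_def)

subsection \<open>The size of a partition with empty 2-core\<close>

text \<open>A domino covers one box of each colour of the chessboard, so the coloured boxes of a partition
  with empty 2-core cancel; in terms of beta numbers, there is one more even than odd number.\<close>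

lemma chessboard_empty_2core:
  assumes "empty_2core \<nu>"
  shows "(\<Sum>(i, j)\<in>diagram \<nu>. (-1 :: int) ^ (i + j)) = 0"
  using assms unfolding empty_2core_def
proof (induction rule: converse_rtranclp_induct)
  case base
  then show ?case by (simp add: diagram_def)
next
  case (step \<nu> \<mu>)
  then have "diagram \<mu> \<subseteq> diagram \<nu>" "domino (diagram \<nu> - diagram \<mu>)"
    by (auto simp: remove_domino_def)
  then have "(\<Sum>(i, j)\<in>diagram \<nu>. (-1 :: int) ^ (i + j)) = (\<Sum>(i, j)\<in>diagram \<nu> - diagram \<mu>. (-1) ^ (i + j))
      + (\<Sum>(i, j)\<in>diagram \<mu>. (-1) ^ (i + j))"
    by (intro sum.subset_diff) auto
  moreover have "(\<Sum>(i, j)\<in>diagram \<nu> - diagram \<mu>. (-1 :: int) ^ (i + j)) = 0"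
    using \<open>domino (diagram \<nu> - diagram \<mu>)\<close> unfolding domino_def by auto
  ultimately show ?case
    using step.IH by simp
qed

lemma sum_sign: "(\<Sum>j<p. (-1 :: int) ^ j) = (if odd p then 1 else 0)"
  by (induction p) auto

lemma sum_list_parity:
  "(\<Sum>b\<leftarrow>bs. (-1 :: int) ^ b) = int (length (filter even bs)) - int (length (filter odd bs))"
  "sum_list bs = 2 * (\<Sum>b\<leftarrow>filter even bs. b div 2) + 2 * (\<Sum>b\<leftarrow>filter odd bs. b div 2) + length (filter odd bs)"
  by (induction bs) (auto elim!: evenE oddE)

lemma sum_list_quotient_component:
  assumes "sorted_wrt (>) bs" "(\<forall>b\<in>set bs. even b) \<or> (\<forall>b\<in>set bs. odd b)"
  shows "sum_list (quotient_component bs) + (\<Sum>i<length bs. i) = (\<Sum>b\<leftarrow>bs. b div 2)"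
proof -
  define ys where "ys = map (\<lambda>b. b div 2) bs"
  let ?l = "length ys"
  have ys: "sorted_wrt (>) ys"
    unfolding ys_def sorted_wrt_map
  proof (rule sorted_wrt_mono_rel[OF _ assms(1)])
    fix x y assume "x \<in> set bs" "y \<in> set bs" "x > y"
    moreover from this have "even x = even y"
      using assms(2) by blast
    ultimately show "x div 2 > y div 2"
      by presburger
  qed
  \<comment> \<open>In a strictly decreasing list of l natural numbers the entry with index i is at
    least l - 1 - i, so the truncated subtraction in \<open>quotient_component\<close> loses
    nothing.\<close>
  have ge: "?l \<le> ys ! i + i + 1" if "i < ?l" for i
  proof -
    have "length zs \<le> zs ! i + i + 1" if "sorted_wrt (>) zs" "i < length zs" for zs :: "nat list"
      using that
    proof (induction zs arbitrary: i)
      case (Cons z zs)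
      show ?case
      proof (cases i)
        case 0
        show ?thesis
        proof (cases zs)
          case (Cons a list)
          then show ?thesis
            using Cons.prems Cons.IH[of 0] 0 by auto
        qed (use 0 in simp)
      next
        case (Suc k)
        then show ?thesis
          using Cons.prems Cons.IH[of k] by auto
      qed
    qed simp
    then show ?thesis
      using ys that by blast
  qed
  have "sum_list (filter (\<lambda>p. p \<noteq> 0) xs) = sum_list xs" for xs :: "nat list"
    by (induction xs) auto
  then have "sum_list (quotient_component bs) = (\<Sum>i<?l. ys ! i + i + 1 - ?l)"
    by (simp add: quotient_component_def Let_def ys_def sum_set_upt_conv_sum_list_nat[symmetric] atLeast0LessThan
        interv_sum_list_conv_sum_set_nat)
  moreover have "(\<Sum>i<?l. i) = (\<Sum>i<?l. ?l - Suc i)"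
    by (rule sum.nat_diff_reindex[symmetric])
  ultimately have "sum_list (quotient_component bs) + (\<Sum>i<?l. i) = (\<Sum>i<?l. (ys ! i + i + 1 - ?l) + (?l - Suc i))"
    by (simp only: sum.distrib)
  also have "\<dots> = (\<Sum>i<?l. ys ! i)"
    by (rule sum.cong) (use ge in auto)
  also have "\<dots> = sum_list ys"
    by (simp add: sum_list_sum_nth atLeast0LessThan)
  finally show ?thesis
    by (simp add: ys_def)
qed

lemma type2_cases: "(e :: 2) = 0 \<or> e = 1"
  using exhaust_2[of e] by auto

lemma UNIV_2: "(UNIV :: 2 set) = {0, 1}"
  using type2_cases by auto

text \<open>The beta numbers are summed in two ways: by rows this gives the size plus a triangular
  number, and by parity classes twice the halves, which are the quotient sizes plus triangular
  numbers, plus the number of odd ones. With one more even than odd number the triangular terms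
  cancel.\<close>

lemma sum_list_empty_2core:
  assumes "\<nu> \<in> Par" "empty_2core \<nu>"
  shows "sum_list \<nu> = 2 * size2 (quotient2 \<nu>)"
proof -
  define r where "r = (LEAST r. odd r \<and> length \<nu> \<le> r)"
  have "\<exists>r. odd r \<and> length \<nu> \<le> r"
    by (rule exI[of _ "2 * length \<nu> + 1"]) simp
  then have r: "odd r" "length \<nu> \<le> r"
    unfolding r_def by (metis (mono_tags, lifting) LeastI_ex)+
  define bs where "bs = map (\<lambda>i. part \<nu> i + (r - 1 - i)) [0..<r]"
  have bs: "beta_numbers \<nu> = bs"
    by (simp add: beta_numbers_def Let_def bs_def r_def)
  have "part \<nu> j + (r - 1 - j) < part \<nu> i + (r - 1 - i)" if "i < j" "j < r" for i j
    using Par_part_mono[OF assms(1), of i j] that by simp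
  then have "sorted_wrt (>) bs"
    by (simp add: bs_def sorted_wrt_map sorted_wrt_iff_nth_less)
  then have sorted: "sorted_wrt (>) (filter P bs)" for P
    by (rule sorted_wrt_filter)
  let ?l0 = "length (filter even bs)" and ?l1 = "length (filter odd bs)"
  have "(\<Sum>(i, j)\<in>diagram \<nu>. (-1 :: int) ^ (i + j)) = (\<Sum>i<length \<nu>. (-1) ^ i * (\<Sum>j<part \<nu> i. (-1) ^ j))"
    unfolding diagram_Sigma by (simp add: sum.Sigma[symmetric] power_add sum_distrib_left)
  also have "\<dots> = (\<Sum>i<r. (-1) ^ i * (\<Sum>j<part \<nu> i. (-1) ^ j))"
    using r by (intro sum.mono_neutral_left) (auto simp: part_ge_length)
  finally have imbalance: "(\<Sum>i<r. (-1 :: int) ^ i * (if odd (part \<nu> i) then 1 else 0)) = 0"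
    using chessboard_empty_2core[OF assms(2)] by (simp add: sum_sign)
  have "(\<Sum>b\<leftarrow>bs. (-1 :: int) ^ b) = (\<Sum>i<r. (-1) ^ (part \<nu> i + (r - 1 - i)))"
    by (simp add: bs_def o_def interv_sum_list_conv_sum_set_nat atLeast0LessThan)
  \<comment> \<open>As r is odd, r - 1 - i has the parity of i, so the sign is (-1)^i, reversed if
    the part is odd. The chessboard identity annihilates the reversals, and an odd number of
    alternating signs sums to 1.\<close>
  also have "\<dots> = (\<Sum>i<r. (-1) ^ i - 2 * ((-1) ^ i * (if odd (part \<nu> i) then 1 else 0)))"
  proof (rule sum.cong)
    fix i assume "i \<in> {..<r}"
    then have "even (r - 1 - i) \<longleftrightarrow> even i"
      using \<open>odd r\<close> by auto
    then show "(-1 :: int) ^ (part \<nu> i + (r - 1 - i)) = (-1) ^ i - 2 * ((-1) ^ i * (if odd (part \<nu> i) then 1 else 0))"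
      by (cases "even i") (auto simp: power_add)
  qed simp
  also have "\<dots> = 1"
    using imbalance \<open>odd r\<close> by (simp add: sum_subtractf sum_sign flip: sum_distrib_left)
  finally have l: "int ?l0 - int ?l1 = 1"
    by (simp add: sum_list_parity)
  have lr: "?l0 + ?l1 = r"
    using sum_length_filter_compl[of even bs] by (simp add: bs_def)
  have "sum_list bs = (\<Sum>i<r. part \<nu> i + (r - Suc i))"
    by (simp add: bs_def interv_sum_list_conv_sum_set_nat atLeast0LessThan)
  then have "sum_list bs = (\<Sum>i<r. part \<nu> i) + (\<Sum>i<r. r - Suc i)"
    by (simp only: sum.distrib)
  then have sum: "sum_list bs = sum_list \<nu> + (\<Sum>i<r. i)"
    using r sum.nat_diff_reindex[of "\<lambda>i. i" r] by (simp add: sum_list_part)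
  have q0: "sum_list (quotient2 \<nu> 0) + (\<Sum>i<?l0. i) = (\<Sum>b\<leftarrow>filter even bs. b div 2)"
    unfolding quotient2_def bs by (simp, rule sum_list_quotient_component[OF sorted]) auto
  have q1: "sum_list (quotient2 \<nu> 1) + (\<Sum>i<?l1. i) = (\<Sum>b\<leftarrow>filter odd bs. b div 2)"
    unfolding quotient2_def bs by (simp, rule sum_list_quotient_component[OF sorted]) auto
  have tri: "2 * (\<Sum>i<n. i) = n * (n - 1)" for n :: nat
    by (induction n) (auto simp: algebra_simps)
  have "size2 (quotient2 \<nu>) = sum_list (quotient2 \<nu> 0) + sum_list (quotient2 \<nu> 1)"
    by (simp add: size2_def UNIV_2)
  moreover have "?l0 = ?l1 + 1" "r = 2 * ?l1 + 1"
    using l lr by auto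
  \<comment> \<open>Doubling turns the triangular numbers into products n(n - 1), which avoids
    division.\<close>
  moreover have "2 * sum_list bs = 2 * (2 * (\<Sum>b\<leftarrow>filter even bs. b div 2) + 2 * (\<Sum>b\<leftarrow>filter odd bs. b div 2) + ?l1)"
    by (simp only: sum_list_parity(2)[of bs])
  ultimately have "2 * sum_list \<nu> + r * (r - 1) = 4 * size2 (quotient2 \<nu>) + 2 * (?l0 * (?l0 - 1)) + 2 * (?l1 * (?l1 - 1)) + 2 * ?l1"
    using q0 q1 sum tri[of r] tri[of ?l0] tri[of ?l1] by (simp only: distrib_left)
  moreover have "r * (r - 1) = 2 * (?l0 * (?l0 - 1)) + 2 * (?l1 * (?l1 - 1)) + 2 * ?l1"
    unfolding \<open>?l0 = ?l1 + 1\<close> \<open>r = 2 * ?l1 + 1\<close> by (cases ?l1) (auto simp: algebra_simps)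
  ultimately show ?thesis
    by linarith
qed

subsection \<open>The 2-partitions of size at most 1\<close>

definition par00 :: partition2 where "par00 = (\<lambda>_. [])"
definition par10 :: partition2 where "par10 = (\<lambda>i. if i = 0 then [1] else [])"
definition par01 :: partition2 where "par01 = (\<lambda>i. if i = 0 then [] else [1])"

lemma beta_numbers_small:
  "beta_numbers [] = [0]" "beta_numbers [2] = [2]" "beta_numbers [Suc 0, Suc 0] = [3, 2, 0]"
proof -
  have "(LEAST r. odd r \<and> length ([] :: nat list) \<le> r) = 1" "(LEAST r. odd r \<and> length [2 :: nat] \<le> r) = 1"
    by (rule Least_equality; force elim: oddE)+
  moreover have "(LEAST r. odd r \<and> length [Suc 0, Suc 0] \<le> r) = 3"
    by (rule Least_equality) (auto elim!: oddE)
  ultimately show "beta_numbers [] = [0]" "beta_numbers [2] = [2]" "beta_numbers [Suc 0, Suc 0] = [3, 2, 0]"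
    by (simp_all add: beta_numbers_def numeral_3_eq_3)
qed

lemma quotient2_small:
  "quotient2 [] = par00" "quotient2 [2] = par10" "quotient2 [Suc 0, Suc 0] = par01"
proof -
  have "quotient_component [] = []" "quotient_component [0] = []" "quotient_component [2] = [1]"
    "quotient_component [2, 0] = []" "quotient_component [3] = [1]"
    by (simp_all add: quotient_component_def Let_def)
  then show "quotient2 [] = par00" "quotient2 [2] = par10" "quotient2 [Suc 0, Suc 0] = par01"
    by (auto simp: quotient2_def par00_def par10_def par01_def beta_numbers_small fun_eq_iff)
qed

lemma par_distinct: "par10 \<noteq> par01" "par00 \<noteq> par10" "par00 \<noteq> par01"
proof -
  have "par10 0 \<noteq> par01 0" "par00 0 \<noteq> par10 0" "par00 1 \<noteq> par01 1"
    by (simp_all add: par00_def par10_def par01_def)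
  then show "par10 \<noteq> par01" "par00 \<noteq> par10" "par00 \<noteq> par01"
    by metis+
qed

lemma size2_small [simp]: "size2 par00 = 0" "size2 par10 = 1" "size2 par01 = 1"
  by (auto simp: size2_def UNIV_2 par00_def par10_def par01_def)

lemma Par2_small [simp]: "par00 \<in> Par2" "par10 \<in> Par2" "par01 \<in> Par2"
  by (auto simp: Par2_def par00_def par10_def par01_def)

lemma Par2_size_0: "\<alpha> \<in> Par2 \<Longrightarrow> size2 \<alpha> = 0 \<longleftrightarrow> \<alpha> = par00"
  by (auto simp: Par2_def size2_def Par_sum_list_0 par00_def fun_eq_iff simp del: sum_list_eq_0_iff)

lemma Par2_size_1: "\<alpha> \<in> Par2 \<Longrightarrow> size2 \<alpha> = 1 \<longleftrightarrow> \<alpha> = par10 \<or> \<alpha> = par01"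
proof
  assume *: "\<alpha> \<in> Par2" "size2 \<alpha> = 1"
  then have "sum_list (\<alpha> 0) + sum_list (\<alpha> 1) = 1" "\<alpha> 0 \<in> Par" "\<alpha> 1 \<in> Par"
    by (auto simp: Par2_def size2_def UNIV_2)
  then have "\<alpha> 0 = [1] \<and> \<alpha> 1 = [] \<or> \<alpha> 0 = [] \<and> \<alpha> 1 = [1]"
    unfolding One_nat_def add_is_1 using Par_sum_list_0 Par_sum_list_1 by auto
  then show "\<alpha> = par10 \<or> \<alpha> = par01"
    by (auto simp: par10_def par01_def fun_eq_iff) (metis type2_cases)+
qed auto

lemma empty_2core_small: "empty_2core []" "empty_2core [2]" "empty_2core [Suc 0, Suc 0]"
proof -
  have "diagram [2] - diagram [] = {(0, 0), (0, 0 + 1)}" "diagram [Suc 0, Suc 0] - diagram [] = {(0, 0), (0 + 1, 0)}"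
    by (auto simp: diagram_Sigma lessThan_Suc)
  then have "remove_domino [2] []" "remove_domino [Suc 0, Suc 0] []"
    unfolding remove_domino_def domino_def by (auto simp: diagram_def)
  then show "empty_2core []" "empty_2core [2]" "empty_2core [Suc 0, Suc 0]"
    by (auto simp: empty_2core_def)
qed

text \<open>The description ranges over all partitions with empty 2-core. The size formula confines
  the candidates to sizes 0 and 2, and the two partitions of 2 are told apart by their
  quotients.\<close>

lemma from_quotient_small:
  "from_quotient par00 = []" "from_quotient par10 = [2]" "from_quotient par01 = [Suc 0, Suc 0]"
proof -
  have "\<nu> = []" if "\<nu> \<in> Par" "empty_2core \<nu>" "quotient2 \<nu> = par00" for \<nu>
    using sum_list_empty_2core[OF that(1,2)] that by (simp add: Par_sum_list_0 del: sum_list_eq_0_iff)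
  then show "from_quotient par00 = []"
    unfolding from_quotient_def by (intro the_equality) (auto simp: empty_2core_small quotient2_small)
  have two: "\<nu> = [2] \<or> \<nu> = [1, 1]" if "\<nu> \<in> Par" "empty_2core \<nu>" "quotient2 \<nu> = par10 \<or> quotient2 \<nu> = par01" for \<nu>
    using sum_list_empty_2core[OF that(1,2)] that Par_sum_list_2[of \<nu>] by auto
  have "\<nu> = [2]" if "\<nu> \<in> Par" "empty_2core \<nu>" "quotient2 \<nu> = par10" for \<nu>
    using two[of \<nu>] that par_distinct by (auto simp: quotient2_small)
  then show "from_quotient par10 = [2]"
    unfolding from_quotient_def by (intro the_equality) (auto simp: empty_2core_small quotient2_small)
  have "\<nu> = [Suc 0, Suc 0]" if "\<nu> \<in> Par" "empty_2core \<nu>" "quotient2 \<nu> = par01" for \<nu>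
    using two[of \<nu>] that par_distinct by (auto simp: quotient2_small)
  then show "from_quotient par01 = [Suc 0, Suc 0]"
    unfolding from_quotient_def by (intro the_equality) (auto simp: empty_2core_small quotient2_small)
qed

lemma dominates2_par00: "\<beta> \<in> Par2 \<Longrightarrow> dominates2 \<beta> par00 \<longleftrightarrow> \<beta> = par00"
  by (auto simp: dominates2_def Par2_size_0 dominates_refl)

lemma dominates2_par10: "\<beta> \<in> Par2 \<Longrightarrow> dominates2 \<beta> par10 \<longleftrightarrow> \<beta> = par10"
  using Par2_size_1[of \<beta>] dominates_row_iff[of "[1, 1]"]
  by (auto simp: dominates2_def from_quotient_small dominates_refl)

lemma dominates2_par01: "\<beta> \<in> Par2 \<Longrightarrow> dominates2 \<beta> par01 \<longleftrightarrow> \<beta> = par10 \<or> \<beta> = par01"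
  using Par2_size_1[of \<beta>] dominates_column_iff[of "[2]"]
  by (auto simp: dominates2_def from_quotient_small dominates_refl)

lemma dual2_small: "dual2 par00 = par00" "dual2 par10 = par01" "dual2 par01 = par10"
proof -
  have "1 - i = 0 \<longleftrightarrow> i = 1" for i :: 2
    by auto
  then show "dual2 par00 = par00" "dual2 par10 = par01" "dual2 par01 = par10"
    using type2_cases by (auto simp: dual2_def par00_def par10_def par01_def fun_eq_iff)
qed

subsection \<open>Hook factors\<close>

lemma diagram_small:
  "diagram [] = {}" "diagram [Suc 0] = {(0, 0)}" "diagram [2] = {(0, 0), (0, 1)}"
  "diagram [Suc 0, Suc 0] = {(0, 0), (1, 0)}"
  by (auto simp: diagram_Sigma lessThan_Suc)

lemma N_small:
  "N [] u z w = 1" "N [Suc 0] u z w = (z - u) * (1 - inverse u * w)"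
  "N [2] u z w = (z ^ 2 - u) * (z - inverse u * w) * ((z - u) * (1 - inverse u * w))"
  "N [Suc 0, Suc 0] u z w = (z - u * w) * (1 - inverse u * w ^ 2) * ((z - u) * (1 - inverse u * w))"
  by (simp_all add: N_def diagram_small hook_factor_def arm_def leg_def power2_eq_square)

lemma N_cot_small:
  "N_cot par10 u z w = (z ^ 2 - u) * (z - inverse u * w)"
  "N_cot par01 u z w = (z - u * w) * (1 - inverse u * w ^ 2)"
proof -
  have "{x \<in> diagram [2]. even (hook [2] x)} = {(0, 0)}"
    "{x \<in> diagram [Suc 0, Suc 0]. even (hook [Suc 0, Suc 0] x)} = {(0, 0)}"
    by (auto simp: diagram_small hook_def arm_def leg_def)
  then show "N_cot par10 u z w = (z ^ 2 - u) * (z - inverse u * w)"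
    "N_cot par01 u z w = (z - u * w) * (1 - inverse u * w ^ 2)"
    by (simp_all add: N_cot_def from_quotient_small hook_factor_def arm_def leg_def power2_eq_square)
qed

section \<open>Macdonald polynomials of small degree\<close>

lemma in_alphabet_unit: "in_alphabet () F = F"
proof -
  have "(\<lambda>(_ :: unit, n :: nat). ((), n)) = id"
    by auto
  then show ?thesis
    unfolding in_alphabet_def by (intro mseries_eqI) (simp add: rename_def)
qed

lemma schur_unit: "schur (\<lambda>_ :: unit. \<nu>) = schur1 \<nu>"
  by (cases "\<nu> = []") (simp_all add: schur_def schur1_Nil in_alphabet_unit UNIV_unit)

lemma homog_schur:
  assumes "\<alpha> \<in> Par_family"
  shows "homog (\<Sum>i | \<alpha> i \<noteq> []. sum_list (\<alpha> i)) (schur \<alpha>)"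
proof -
  have "homog (sum_list (\<alpha> i)) (in_alphabet i (schur1 (\<alpha> i)))" for i
  proof -
    have "homog (sum_list (\<alpha> i)) (schur1 (\<alpha> i))"
      using assms coeff_of_schur1_nonzero(1)[of "\<alpha> i"] by (auto simp: homog_def Par_family_def)
    then show ?thesis
      unfolding in_alphabet_def by (intro homog_rename) (auto simp: inj_on_def)
  qed
  then show ?thesis
    unfolding schur_def by (rule homog_prod)
qed

lemma homog_schur_unit: "\<nu> \<in> Par \<Longrightarrow> homog (sum_list \<nu>) (schur (\<lambda>_ :: unit. \<nu>))"
  using homog_schur[of "\<lambda>_ :: unit. \<nu>"] by (cases "\<nu> = []") (auto simp: Par_family_def UNIV_unit)

lemma homog_schur_2: "\<alpha> \<in> Par2 \<Longrightarrow> homog (size2 \<alpha>) (schur \<alpha>)"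
proof -
  assume \<alpha>: "\<alpha> \<in> Par2"
  have "(\<Sum>i | \<alpha> i \<noteq> []. sum_list (\<alpha> i)) = size2 \<alpha>"
    unfolding size2_def by (rule sum.mono_neutral_left) auto
  moreover have "\<alpha> \<in> Par_family"
    using \<alpha> by (auto simp: Par2_def Par_family_def)
  ultimately show ?thesis
    using homog_schur by metis
qed

lemma homog_span: "(\<And>F. F \<in> B \<Longrightarrow> homog d F) \<Longrightarrow> F \<in> mseries.span B \<Longrightarrow> homog d F"
proof -
  assume B: "\<And>F. F \<in> B \<Longrightarrow> homog d F" and F: "F \<in> mseries.span B"
  have "mseries.span B \<subseteq> {F. homog d F}"
  proof (rule mseries.span_minimal)
    show "mseries.subspace {F. homog d F}"
      by (rule mseries.subspaceI) (auto intro: homog_add homog_mscale)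
  qed (use B in auto)
  then show ?thesis
    using F by auto
qed

text \<open>This is h_m = s_(m): only the one-row partition has a first part as large as m, so the
  dual of the m-th power of one variable is a single Schur function.\<close>

lemma hall_row:
  assumes "symmetric F"
  shows "hall F (schur (\<lambda>i. if i = i0 then row m else [])) = coeff_of F (replicate_mset m (i0, 0))"
proof -
  let ?\<rho> = "\<lambda>i. if i = i0 then row m else []"
  let ?M = "replicate_mset m (i0, 0 :: nat)"
  have \<rho>: "?\<rho> \<in> Par_family"
  proof -
    have "{i. ?\<rho> i \<noteq> []} \<subseteq> {i0}" by auto
    then have "finite {i. ?\<rho> i \<noteq> []}"
      by (rule finite_subset) simp
    then show ?thesis
      by (auto simp: Par_family_def row_def Par_Cons)
  qed
  have cont: "cont ?\<rho> = ?M"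
  proof (rule multiset_eqI)
    fix v :: "'a \<times> nat"
    obtain i n where v: "v = (i, n)" by (cases v)
    show "count (cont ?\<rho>) v = count ?M v"
      unfolding v count_cont[OF \<rho>] by (cases n) (auto simp: row_def)
  qed
  have other: "coeff_of (schur \<alpha>) ?M = 0" if "\<alpha> \<in> Par_of_size (msize ?M)" "\<alpha> \<noteq> ?\<rho>" for \<alpha>
  proof (rule ccontr)
    assume nz: "coeff_of (schur \<alpha>) ?M \<noteq> 0"
    have \<alpha>: "\<alpha> \<in> Par_family" "\<And>i. \<alpha> i \<in> Par"
      using that by (auto simp: Par_of_size_def Par_family_def)
    have size: "sum_list (\<alpha> i) = (if i = i0 then m else 0)" for i
    proof -
      have "{#v \<in># replicate_mset m (i0, 0 :: nat). fst v = i#} = (if i = i0 then replicate_mset m (i0, 0) else {#})"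
        by (induction m) auto
      then show ?thesis
        using coeff_of_schur_nonzero(1)[OF \<alpha>(1) nz, of i] by (simp add: msize_def)
    qed
    have "m \<le> part (\<alpha> i0) 0"
      using coeff_of_schur_nonzero(2)[OF \<alpha>(1) nz, where m = 1 and i = i0] by simp
    then have "\<alpha> i0 = row m"
      using size[of i0] \<alpha>(2)[of i0] by (cases "\<alpha> i0") (auto simp: row_def Par_Cons Par_sum_list_0 simp del: sum_list_eq_0_iff)
    moreover have "\<alpha> i = []" if "i \<noteq> i0" for i
      using size[of i] \<alpha>(2)[of i] that by (simp add: Par_sum_list_0 del: sum_list_eq_0_iff)
    ultimately show False
      using that(2) by auto
  qed
  have "monomial_dual ?M = (\<Sum>\<alpha>\<in>{?\<rho>}. mscale (coeff_of (schur \<alpha>) ?M) (schur \<alpha>))"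
    unfolding monomial_dual_def
  proof (rule sum.mono_neutral_right)
    show "{?\<rho>} \<subseteq> Par_of_size (msize ?M)"
      using cont_Par_of_size[OF \<rho>] cont by simp
    show "\<forall>\<alpha>\<in>Par_of_size (msize ?M) - {?\<rho>}. mscale (coeff_of (schur \<alpha>) ?M) (schur \<alpha>) = 0"
      using other by (auto intro!: mseries_eqI)
  qed (rule finite_Par_of_msize)
  also have "\<dots> = schur ?\<rho>"
    using coeff_of_schur_leading[OF \<rho>] by (simp add: cont)
  finally have "schur ?\<rho> = monomial_dual ?M" ..
  then show ?thesis
    by (simp only: hall_monomial_dual[OF assms])
qed

lemma hall_row_unit:
  "symmetric F \<Longrightarrow> hall F (schur (\<lambda>_ :: unit. row m)) = coeff_of F (replicate_mset m ((), 0))"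
  using hall_row[of F "()" m] by simp

text \<open>Pulling a one-dimensional span back through an invertible plethysm determines
  \<open>H\<close> up to a scalar; the normalisation of Macdonald polynomials then fixes the
  scalar.\<close>

lemma plethysm_span_singleton:
  assumes "H \<in> Sym" "H' \<in> Sym" "M ** M' = mat 1" "plethysm M H' = mscale a B" "a \<noteq> 0"
    and "plethysm M H \<in> mseries.span {B}"
  obtains c where "H = mscale c H'"
proof -
  obtain k where "plethysm M H = mscale k B"
    using assms(6) by (auto simp: mseries.span_singleton)
  then have "plethysm M H = mscale (k / a) (plethysm M H')"
    using assms(5) by (simp add: assms(4))
  also have "\<dots> = plethysm M (mscale (k / a) H')"
    by (simp add: plethysm_mscale assms(2))
  finally have "H = mscale (k / a) H'"
    by (metis plethysm_inverse assms(1,2,3) Sym_mscale)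
  then show ?thesis
    by (rule that)
qed

lemma zz_facts: "zz \<noteq> 0" "zz > 0" "1 - zz \<noteq> 0" "1 - zz\<^sup>2 \<noteq> 0" "1 + zz \<noteq> 0"
proof -
  show "zz \<noteq> 0" "zz > 0" "1 - zz \<noteq> 0" "1 + zz \<noteq> 0"
    using zz_gt_1 by auto
  show "1 - zz\<^sup>2 \<noteq> 0"
    using one_less_power[OF zz_gt_1, of 2] by auto
qed

lemma ww_gt_1: "1 < ww"
  using one_less_power[OF zz_gt_1, of 3] ww_gt by auto

lemma ww_facts: "ww \<noteq> 0" "ww > 0" "1 - ww \<noteq> 0" "1 - ww\<^sup>2 \<noteq> 0" "1 + ww \<noteq> 0"
proof -
  show "ww \<noteq> 0" "ww > 0" "1 - ww \<noteq> 0" "1 + ww \<noteq> 0"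
    using ww_gt_1 by auto
  show "1 - ww\<^sup>2 \<noteq> 0"
    using one_less_power[OF ww_gt_1, of 2] by auto
qed

lemma mat_inverse_unit: "a \<noteq> (0 :: rf) \<Longrightarrow> mat a ** mat (1 / a) = (mat 1 :: rf ^ unit ^ unit)"
  by (simp add: matrix_matrix_mult_def mat_def vec_eq_iff UNIV_unit)

definition Mq :: "rf \<Rightarrow> rf ^ 2 ^ 2" where
  "Mq q = (\<chi> i k. if i = k then 1 else - q)"

lemma Mz_Mq: "Mz = Mq zz" and Mw_Mq: "Mw = Mq ww"
  by (simp_all add: Mz_def Mw_def Mq_def)

text \<open>1 - q^2 is the determinant of \<open>Mq q\<close>, and the witness is the adjugate
  divided by it.\<close>

lemma Mq_inverse: "1 - q\<^sup>2 \<noteq> 0 \<Longrightarrow> \<exists>M'. Mq q ** M' = mat 1"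
proof -
  assume "1 - q\<^sup>2 \<noteq> 0"
  moreover have "1 / (1 - q\<^sup>2) - q * (q / (1 - q\<^sup>2)) = (1 - q\<^sup>2) / (1 - q\<^sup>2)"
    by (simp only: diff_divide_distrib power2_eq_square times_divide_eq_right)
  ultimately have *: "1 / (1 - q\<^sup>2) - q * (q / (1 - q\<^sup>2)) = 1"
    by simp
  have "(Mq q ** (\<chi> i k. (if i = k then 1 else q) / (1 - q\<^sup>2))) $ i $ k = mat 1 $ i $ k" for i k
    using type2_cases[of i] type2_cases[of k] *
    by (elim disjE) (simp_all add: matrix_matrix_mult_def Mq_def mat_def UNIV_2)
  then have "Mq q ** (\<chi> i k. (if i = k then 1 else q) / (1 - q\<^sup>2)) = mat 1"
    by (simp add: vec_eq_iff)
  then show ?thesis by blast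
qed

subsection \<open>Macdonald polynomials are homogeneous\<close>

lemma homog_of_plethysm:
  fixes H :: "('i::finite) symf"
  assumes "H \<in> Sym" "M ** M' = mat 1" "homog d (plethysm M H)"
  shows "homog d H"
  using homog_plethysm[OF Sym_plethysm[OF assms(1)] assms(3), of M'] plethysm_inverse[OF assms(1,2)]
  by simp

lemma macdonald_eqI:
  assumes "\<And>H. is_macdonald \<nu> H \<longleftrightarrow> H = H'"
  shows "macdonald \<nu> = H'"
proof -
  have "\<exists>!H. is_macdonald \<nu> H" "(THE H. is_macdonald \<nu> H) = H'"
    by (simp_all add: assms)
  then show ?thesis
    by (simp only: macdonald_def if_True)
qed

lemma wreath_macdonald_eqI:
  assumes "\<And>H. is_wreath_macdonald \<alpha> H \<longleftrightarrow> H = H'"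
  shows "wreath_macdonald \<alpha> = H'"
proof -
  have "\<exists>!H. is_wreath_macdonald \<alpha> H" "(THE H. is_wreath_macdonald \<alpha> H) = H'"
    by (simp_all add: assms)
  then show ?thesis
    by (simp only: wreath_macdonald_def if_True)
qed

text \<open>\<open>dominates\<close> compares partitions of equal size only, so the first span
  condition makes the plethysm of a solution homogeneous, and the inverse plethysm preserves
  this.\<close>

lemma macdonald_Sym_homog: "macdonald \<nu> \<in> Sym \<and> homog (sum_list \<nu>) (macdonald \<nu>)"
proof (cases "\<exists>!H. is_macdonald \<nu> H")
  case True
  then have "is_macdonald \<nu> (macdonald \<nu>)"
    unfolding macdonald_def by (simp add: theI')
  then have *: "macdonald \<nu> \<in> Sym" "plethysm (mat (1 - zz)) (macdonald \<nu>)
       \<in> mseries.span {schur (\<lambda>_. \<mu>) | \<mu>. \<mu> \<in> Par \<and> dominates \<mu> \<nu>}"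
    by (auto simp: is_macdonald_def)
  have "homog (sum_list \<nu>) (plethysm (mat (1 - zz)) (macdonald \<nu>))"
    by (rule homog_span[OF _ *(2)]) (auto simp: dominates_def dest: homog_schur_unit)
  then show ?thesis
    using homog_of_plethysm[OF *(1) mat_inverse_unit[OF zz_facts(3)]] *(1) by blast
qed (auto simp: macdonald_def)

lemma wreath_macdonald_Sym_homog: "wreath_macdonald \<alpha> \<in> Sym \<and> homog (size2 \<alpha>) (wreath_macdonald \<alpha>)"
proof (cases "\<exists>!H. is_wreath_macdonald \<alpha> H")
  case True
  then have "is_wreath_macdonald \<alpha> (wreath_macdonald \<alpha>)"
    unfolding wreath_macdonald_def by (simp add: theI')
  then have *: "wreath_macdonald \<alpha> \<in> Sym" "plethysm (Mq zz) (wreath_macdonald \<alpha>)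
       \<in> mseries.span {schur \<beta> | \<beta>. \<beta> \<in> Par2 \<and> dominates2 \<beta> \<alpha>}"
    by (auto simp: is_wreath_macdonald_def Mz_Mq)
  have "homog (size2 \<alpha>) (plethysm (Mq zz) (wreath_macdonald \<alpha>))"
    by (rule homog_span[OF _ *(2)]) (auto simp: dominates2_def dest: homog_schur_2)
  then show ?thesis
    using homog_of_plethysm[OF *(1)] Mq_inverse[OF zz_facts(4)] *(1) by blast
qed (auto simp: wreath_macdonald_def)

subsection \<open>Degree 0\<close>

lemma hall_1:
  fixes F :: "'i symf"
  shows "symmetric F \<Longrightarrow> hall F 1 = coeff_of F {#}"
proof -
  \<comment> \<open>\<open>row 0\<close> is empty, so \<open>hall_row\<close> applies with an
    arbitrary alphabet.\<close>
  have "(\<lambda>i :: 'i. if i = undefined then row 0 else []) = (\<lambda>_ :: 'i. [])"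
    by (auto simp: row_def)
  then have "schur (\<lambda>i. if i = undefined then row 0 else []) = schur (\<lambda>_ :: 'i. [])"
    by (rule arg_cong)
  also have "\<dots> = 1"
    by (simp add: schur_def)
  finally have "schur (\<lambda>i :: 'i. if i = undefined then row 0 else []) = 1" .
  then show "symmetric F \<Longrightarrow> hall F 1 = coeff_of F {#}"
    using hall_row[of F undefined 0] by simp
qed

lemma macdonald_Nil: "macdonald [] = 1"
proof (rule macdonald_eqI)
  fix H :: "unit symf"
  have "{schur (\<lambda>_ :: unit. \<mu>) | \<mu>. \<mu> \<in> Par \<and> dominates \<mu> []} = {1}"
  proof -
    have "\<mu> \<in> Par \<and> dominates \<mu> [] \<longleftrightarrow> \<mu> = []" for \<mu>
      using Par_sum_list_0[of \<mu>] by (auto simp: dominates_def simp del: sum_list_eq_0_iff)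
    then show ?thesis
      by (simp add: schur_unit schur1_Nil)
  qed
  then have iff: "is_macdonald [] H \<longleftrightarrow> H \<in> Sym \<and> plethysm (mat (1 - zz)) H \<in> mseries.span {1} \<and>
     plethysm (mat (1 - ww)) H \<in> mseries.span {1} \<and> hall H (schur (\<lambda>_. row 0)) = 1"
    by (simp add: is_macdonald_def)
  show "is_macdonald [] H \<longleftrightarrow> H = 1"
  proof
    assume H: "is_macdonald [] H"
    then have "H \<in> Sym" "plethysm (mat (1 - zz)) H \<in> mseries.span {1}"
      by (simp_all only: iff)
    moreover have "plethysm (mat (1 - zz)) 1 = mscale 1 (1 :: unit symf)"
      by (simp add: plethysm_1)
    ultimately obtain c where c: "H = mscale c 1"
      using plethysm_span_singleton[OF _ Sym_1 mat_inverse_unit[OF zz_facts(3)] _ one_neq_zero] by metis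
    have "hall H (schur (\<lambda>_. row 0)) = 1"
      using H by (simp only: iff)
    then have "c = 1"
      by (simp add: c hall_row_unit symmetric_mscale coeff_of_1)
    then show "H = 1"
      using c by simp
  next
    assume "H = 1"
    then show "is_macdonald [] H"
      unfolding iff by (simp add: plethysm_1 mseries.span_base hall_row_unit coeff_of_1)
  qed
qed

lemma schur_par00: "schur par00 = 1"
  by (simp add: schur_def par00_def)

lemma wreath_macdonald_par00: "wreath_macdonald par00 = 1"
proof (rule wreath_macdonald_eqI)
  fix H :: "2 symf"
  have "\<beta> \<in> Par2 \<and> dominates2 \<beta> par00 \<longleftrightarrow> \<beta> = par00" for \<beta>
    using dominates2_par00[of \<beta>] by auto
  then have "{schur \<beta> | \<beta>. \<beta> \<in> Par2 \<and> dominates2 \<beta> par00} = {1}"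
    by (simp add: schur_par00)
  then have iff: "is_wreath_macdonald par00 H \<longleftrightarrow> H \<in> Sym \<and> plethysm (Mq zz) H \<in> mseries.span {1} \<and>
     plethysm (Mq ww) H \<in> mseries.span {1} \<and> hall H (schur (\<lambda>i. if i = 0 then row 0 else [])) = 1"
    unfolding is_wreath_macdonald_def dual2_small Mz_Mq Mw_Mq size2_small by (simp only:)
  obtain M' where M': "Mq zz ** M' = mat 1"
    using Mq_inverse[OF zz_facts(4)] by blast
  show "is_wreath_macdonald par00 H \<longleftrightarrow> H = 1"
  proof
    assume H: "is_wreath_macdonald par00 H"
    then have "H \<in> Sym" "plethysm (Mq zz) H \<in> mseries.span {1}"
      by (simp_all only: iff)
    moreover have "plethysm (Mq zz) 1 = mscale 1 (1 :: 2 symf)"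
      by (simp add: plethysm_1)
    ultimately obtain c where c: "H = mscale c 1"
      using plethysm_span_singleton[OF _ Sym_1 M' _ one_neq_zero] by metis
    have "hall H (schur (\<lambda>i. if i = 0 then row 0 else [])) = 1"
      using H by (simp only: iff)
    then have "c = 1"
      by (simp add: c hall_row symmetric_mscale coeff_of_1)
    then show "H = 1"
      using c by simp
  next
    assume "H = 1"
    then show "is_wreath_macdonald par00 H"
      unfolding iff by (simp add: plethysm_1 mseries.span_base hall_row coeff_of_1)
  qed
qed

subsection \<open>Degree 1\<close>

lemma schur1_1: "schur1 [1] = power_sum 1"
proof (rule symmetric_eqI[OF symmetric_schur1 symmetric_power_sum])
  fix \<beta> :: "unit \<Rightarrow> partition"
  assume \<beta>: "\<beta> \<in> Par_family"
  show "coeff_of (schur1 [1]) (cont \<beta>) = coeff_of (power_sum 1) (cont \<beta>)"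
  proof (cases "size (cont \<beta>) = 1")
    case True
    then obtain n where n: "cont \<beta> = {#((), n)#}"
      by (metis (full_types) One_nat_def old.unit.exhaust size_1_singleton_mset surj_pair)
    moreover from this have "n = 0"
      using decreasing_cont[OF \<beta>] by (cases n) (auto simp: decreasing_def split: if_splits dest: spec[of _ "n - 1"])
    ultimately have "coeff_of (schur1 [1]) (cont \<beta>) = 1"
      by (intro coeff_of_schur1_leading) (auto simp: nth_default_def)
    then show ?thesis
      using n by (auto simp: power_sum_def)
  next
    case False
    then show ?thesis
      using coeff_of_schur1_nonzero(1)[of "[1]" "cont \<beta>"] by (auto simp: power_sum_def)
  qed
qed simp

lemma macdonald_1: "macdonald [1] = power_sum 1"
proof (rule macdonald_eqI)
  fix H :: "unit symf"
  let ?p = "power_sum 1"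
  have "{schur (\<lambda>_ :: unit. \<mu>) | \<mu>. \<mu> \<in> Par \<and> dominates \<mu> [1]} = {?p}"
  proof -
    have "\<mu> \<in> Par \<and> dominates \<mu> [1] \<longleftrightarrow> \<mu> = [1]" for \<mu>
      using Par_sum_list_1[of \<mu>] by (auto simp: dominates_def)
    then show ?thesis
      by (simp add: schur_unit schur1_1 del: One_nat_def)
  qed
  then have iff: "is_macdonald [1] H \<longleftrightarrow> H \<in> Sym \<and> plethysm (mat (1 - zz)) H \<in> mseries.span {?p} \<and>
     plethysm (mat (1 - ww)) H \<in> mseries.span {?p} \<and> hall H (schur (\<lambda>_. row 1)) = 1"
    by (simp add: is_macdonald_def)
  have p: "?p \<in> Sym" "symmetric ?p" "coeff_of ?p (replicate_mset 1 ((), 0)) = 1"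
    using Sym_power_sum[of "()" 1] by (auto simp: in_alphabet_unit Sym_iff power_sum_def)
  have pl: "plethysm (mat a) ?p = mscale a ?p" for a
    using plethysm_power_sum[of 1 "mat a" "()"]
    by (simp add: in_alphabet_unit plethysm_psum_def UNIV_unit mat_def adams_rf_one[unfolded One_nat_def])
  show "is_macdonald [1] H \<longleftrightarrow> H = ?p"
  proof
    assume H: "is_macdonald [1] H"
    then have "H \<in> Sym" "plethysm (mat (1 - zz)) H \<in> mseries.span {?p}"
      by (simp_all only: iff)
    then obtain c where c: "H = mscale c ?p"
      using plethysm_span_singleton[OF _ p(1) mat_inverse_unit[OF zz_facts(3)] pl zz_facts(3)] by metis
    have "hall H (schur (\<lambda>_. row 1)) = 1"
      using H by (simp only: iff)
    then have "c = 1"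
      using p by (simp add: c hall_row_unit symmetric_mscale)
    then show "H = ?p"
      using c by simp
  next
    assume "H = ?p"
    then show "is_macdonald [1] H"
      unfolding iff unfolding \<open>H = ?p\<close> pl using p by (simp add: mseries.span_base mseries.span_scale hall_row_unit)
  qed
qed

abbreviation x0 :: "2 symf" where "x0 \<equiv> in_alphabet 0 (power_sum (Suc 0))"
abbreviation x1 :: "2 symf" where "x1 \<equiv> in_alphabet 1 (power_sum (Suc 0))"

lemma schur_par10: "schur par10 = x0" and schur_par01: "schur par01 = x1"
proof -
  have "i \<noteq> 0 \<longleftrightarrow> i = 1" for i :: 2
    using type2_cases[of i] by auto
  then have "{i :: 2. i \<noteq> 0} = {1}"
    by simp
  then show "schur par10 = x0" "schur par01 = x1"
    by (simp_all add: schur_def par10_def par01_def schur1_1[unfolded One_nat_def] cong: if_cong)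
qed

lemma coeff_x [simp]:
  "coeff_of x0 {#(e, n)#} = (if e = 0 then 1 else 0)" "coeff_of x1 {#(e, n)#} = (if e = 1 then 1 else 0)"
  by (auto simp: coeff_of_power_sum)

lemma plethysm_x:
  "plethysm M x0 = mscale (M $ 0 $ 0) x0 + mscale (M $ 0 $ 1) x1"
  "plethysm M x1 = mscale (M $ 1 $ 0) x0 + mscale (M $ 1 $ 1) x1"
  by (simp_all add: plethysm_power_sum plethysm_psum_def UNIV_2 adams_rf_one[unfolded One_nat_def])

definition linear_form :: "rf \<Rightarrow> 2 symf" where
  "linear_form q = x0 + mscale q x1"

lemma linear_form_facts:
  "linear_form q \<in> Sym" "symmetric (linear_form q)"
  "coeff_of (linear_form q) {#(e, n)#} = (if e = 0 then 1 else q)"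
  "plethysm M (linear_form q) = mscale (M $ 0 $ 0 + q * M $ 1 $ 0) x0 + mscale (M $ 0 $ 1 + q * M $ 1 $ 1) x1"
proof -
  show "linear_form q \<in> Sym"
    unfolding linear_form_def by (intro Sym_add Sym_mscale Sym_power_sum)
  then show "symmetric (linear_form q)"
    by (simp add: Sym_iff)
  show "coeff_of (linear_form q) {#(e, n)#} = (if e = 0 then 1 else q)"
    using type2_cases[of e] by (auto simp: linear_form_def)
  show "plethysm M (linear_form q) = mscale (M $ 0 $ 0 + q * M $ 1 $ 0) x0 + mscale (M $ 0 $ 1 + q * M $ 1 $ 1) x1"
    unfolding linear_form_def plethysm_add[OF Sym_power_sum Sym_mscale[OF Sym_power_sum]]
      plethysm_mscale[OF Sym_power_sum] plethysm_x
    by (rule mseries_eqI) (simp add: algebra_simps)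
qed

text \<open>For each of the two 2-partitions one condition has the span of \<open>x0\<close> alone
  and determines the polynomial: the one for \<open>Mz\<close> in the case of \<open>par10\<close>,
  the one for \<open>Mw\<close> in the case of \<open>par01\<close>, whose dual is
  \<open>par10\<close>. The other span is all of degree 1.\<close>

lemma wreath_macdonald_small:
  "wreath_macdonald par10 = linear_form zz" "wreath_macdonald par01 = linear_form ww"
proof -
  have spans: "{schur \<beta> | \<beta>. \<beta> \<in> Par2 \<and> dominates2 \<beta> par10} = {x0}"
    "{schur \<beta> | \<beta>. \<beta> \<in> Par2 \<and> dominates2 \<beta> par01} = {x0, x1}"
  proof -
    have "\<beta> \<in> Par2 \<and> dominates2 \<beta> par10 \<longleftrightarrow> \<beta> = par10"
      "\<beta> \<in> Par2 \<and> dominates2 \<beta> par01 \<longleftrightarrow> \<beta> = par10 \<or> \<beta> = par01" for \<beta>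
      using dominates2_par10[of \<beta>] dominates2_par01[of \<beta>] by auto
    then show "{schur \<beta> | \<beta>. \<beta> \<in> Par2 \<and> dominates2 \<beta> par10} = {x0}"
      "{schur \<beta> | \<beta>. \<beta> \<in> Par2 \<and> dominates2 \<beta> par01} = {x0, x1}"
      by (auto simp: schur_par10[symmetric] schur_par01[symmetric])
  qed
  have pl: "plethysm (Mq q) (linear_form q) = mscale (1 - q\<^sup>2) x0" for q
    by (rule mseries_eqI) (simp add: linear_form_facts Mq_def power2_eq_square)
  have unique: "H \<in> Sym \<Longrightarrow> plethysm (Mq q) H \<in> mseries.span {x0} \<Longrightarrow>
      hall H (schur (\<lambda>i. if i = 0 then row 1 else [])) = 1 \<Longrightarrow> H = linear_form q" if nz: "1 - q\<^sup>2 \<noteq> 0" for H q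
  proof -
    assume H: "H \<in> Sym" "plethysm (Mq q) H \<in> mseries.span {x0}" "hall H (schur (\<lambda>i. if i = 0 then row 1 else [])) = 1"
    obtain M' where M': "Mq q ** M' = mat 1"
      using Mq_inverse[OF \<open>1 - q\<^sup>2 \<noteq> 0\<close>] by blast
    obtain c where c: "H = mscale c (linear_form q)"
      by (rule plethysm_span_singleton[OF H(1) linear_form_facts(1) M' pl nz H(2)])
    then have "c = 1"
      using H(3) by (simp add: hall_row symmetric_mscale linear_form_facts)
    then show ?thesis
      using c by simp
  qed
  have hall: "hall (linear_form q) (schur (\<lambda>i. if i = 0 then row 1 else [])) = 1" for q
    by (simp add: hall_row linear_form_facts)
  have in_span: "mscale a x0 + mscale b x1 \<in> mseries.span {x0, x1}" for a b
    by (intro mseries.span_add mseries.span_scale mseries.span_base) auto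
  have in_span1: "mscale a x0 \<in> mseries.span {x0}" for a
    by (intro mseries.span_scale mseries.span_base) auto
  show "wreath_macdonald par10 = linear_form zz"
  proof (rule wreath_macdonald_eqI)
    fix H
    show "is_wreath_macdonald par10 H \<longleftrightarrow> H = linear_form zz"
      unfolding is_wreath_macdonald_def dual2_small spans Mz_Mq Mw_Mq size2_small
      using unique[OF zz_facts(4)] hall pl[of zz] in_span1 in_span linear_form_facts(1,4) by metis
  qed
  show "wreath_macdonald par01 = linear_form ww"
  proof (rule wreath_macdonald_eqI)
    fix H
    show "is_wreath_macdonald par01 H \<longleftrightarrow> H = linear_form ww"
      unfolding is_wreath_macdonald_def dual2_small spans Mz_Mq Mw_Mq size2_small
      using unique[OF ww_facts(4)] hall pl[of ww] in_span1 in_span linear_form_facts(1,4) by metis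
  qed
qed

subsection \<open>Degree 2\<close>

abbreviation mon20 :: "(unit \<times> nat) multiset" where "mon20 \<equiv> {#((), 0), ((), 0)#}"
abbreviation mon11 :: "(unit \<times> nat) multiset" where "mon11 \<equiv> {#((), 0), ((), Suc 0)#}"

lemma symmetric_eqI_degree_2:
  fixes F G :: "(unit \<times> nat, 'a::zero) mseries"
  assumes "symmetric F" "symmetric G" "homog 2 F" "homog 2 G"
    and "coeff_of F mon20 = coeff_of G mon20" "coeff_of F mon11 = coeff_of G mon11"
  shows "F = G"
proof (rule symmetric_eqI[OF assms(1,2)])
  fix \<beta> :: "unit \<Rightarrow> partition"
  assume \<beta>: "\<beta> \<in> Par_family"
  show "coeff_of F (cont \<beta>) = coeff_of G (cont \<beta>)"
  proof (cases "size (cont \<beta>) = 2")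
    case True
    moreover have "size (cont \<beta>) = sum_list (\<beta> ())"
      using msize_cont[OF \<beta>, of "()"] by (simp add: msize_def)
    ultimately have "\<beta> () = [2] \<or> \<beta> () = [1, 1]"
      using \<beta> Par_sum_list_2[of "\<beta> ()"] by (simp add: Par_family_def)
    then have "cont \<beta> = mon20 \<or> cont \<beta> = mon11"
    proof
      assume "\<beta> () = [2]"
      then have "count (cont \<beta>) ((), n) = count mon20 ((), n)" for n
        by (cases n) (simp_all add: count_cont[OF \<beta>])
      then have "count (cont \<beta>) v = count mon20 v" for v
        by (metis old.unit.exhaust surj_pair)
      then have "cont \<beta> = mon20"
        by (rule multiset_eqI)
      then show ?thesis ..
    next
      assume "\<beta> () = [1, 1]"
      then have "count (cont \<beta>) ((), n) = count mon11 ((), n)" for n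
        by (cases n; cases "n - 1") (simp_all add: count_cont[OF \<beta>])
      then have "count (cont \<beta>) v = count mon11 v" for v
        by (metis old.unit.exhaust surj_pair)
      then have "cont \<beta> = mon11"
        by (rule multiset_eqI)
      then show ?thesis ..
    qed
    then show ?thesis
      using assms by auto
  next
    case False
    then show ?thesis
      using assms(3,4) by (simp add: homogD)
  qed
qed

lemma coeff_of_mult_pair:
  fixes F G :: "('v, 'a::comm_ring_1) mseries"
  assumes "homog 1 F" "homog 1 G"
  shows "coeff_of (F * G) {#a, b#} = (if a = b then coeff_of F {#a#} * coeff_of G {#a#}
    else coeff_of F {#a#} * coeff_of G {#b#} + coeff_of F {#b#} * coeff_of G {#a#})"
proof -
  have "coeff_of (F * G) {#a, b#} = (\<Sum>(A, B)\<in>{({#a#}, {#b#}), ({#b#}, {#a#})}. coeff_of F A * coeff_of G B)"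
    unfolding coeff_of_mult
  proof (rule sum.mono_neutral_right)
    show "{({#a#}, {#b#}), ({#b#}, {#a#})} \<subseteq> splits {#a, b#}"
      by (auto simp: splits_iff)
    show "\<forall>x\<in>splits {#a, b#} - {({#a#}, {#b#}), ({#b#}, {#a#})}. (case x of (A, B) \<Rightarrow> coeff_of F A * coeff_of G B) = 0"
    proof
      fix x assume x: "x \<in> splits {#a, b#} - {({#a#}, {#b#}), ({#b#}, {#a#})}"
      obtain A B where AB: "x = (A, B)" by (cases x)
      have "coeff_of F A = 0 \<or> coeff_of G B = 0"
      proof (rule ccontr)
        assume "\<not> ?thesis"
        then have "size A = 1" "size B = 1"
          using assms by (auto simp: homog_def)
        then obtain u v where uv: "A = {#u#}" "B = {#v#}"
          by (metis size_1_singleton_mset)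
        moreover have "A + B = {#a, b#}"
          using x AB by (simp add: splits_iff)
        ultimately have "u = a \<and> v = b \<or> u = b \<and> v = a"
          by (auto simp: add_eq_conv_diff)
        then show False
          using x AB uv by auto
      qed
      then show "(case x of (A, B) \<Rightarrow> coeff_of F A * coeff_of G B) = 0"
        using AB by auto
    qed
  qed simp
  then show ?thesis
    by auto
qed

lemma coeff_schur1_degree_2:
  "coeff_of (schur1 [2]) mon20 = 1" "coeff_of (schur1 [2]) mon11 = 1"
  "coeff_of (schur1 [Suc 0, Suc 0]) mon20 = 0" "coeff_of (schur1 [Suc 0, Suc 0]) mon11 = 1"
proof -
  show "coeff_of (schur1 [2]) mon20 = 1"
    by (rule coeff_of_schur1_leading) (auto simp: nth_default_def)
  have "count mon11 ((), i) = part [Suc 0, Suc 0] i" for i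
    by (cases i; cases "i - 1") auto
  then show "coeff_of (schur1 [Suc 0, Suc 0]) mon11 = 1"
    by (intro coeff_of_schur1_leading) auto
  show "coeff_of (schur1 [Suc 0, Suc 0]) mon20 = 0"
  proof (rule ccontr)
    assume "coeff_of (schur1 [Suc 0, Suc 0]) mon20 \<noteq> 0"
    from coeff_of_schur1_nonzero(2)[OF Par_11 this, of 1] show False
      by simp
  qed
  have content: "tableau_content [2] T = {#((), T (0, 0)), ((), T (0, 1))#}" for T
    by (simp add: tableau_content_def diagram_small)
  have "{T. semistandard [2] T \<and> tableau_content [2] T = mon11} = {\<lambda>x. if x = (0, 1) then 1 else 0}"
  proof (intro equalityI subsetI)
    fix T assume "T \<in> {T. semistandard [2] T \<and> tableau_content [2] T = mon11}"
    then have T: "semistandard [2] T" "{#((), T (0, 0)), ((), T (0, 1))#} = mon11"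
      by (auto simp: content)
    from T(2) have "set_mset {#((), T (0, 0)), ((), T (0, 1))#} = set_mset mon11"
      by (rule arg_cong)
    then have "T (0, 0) = 0 \<and> T (0, 1) = 1 \<or> T (0, 0) = 1 \<and> T (0, 1) = 0"
      by (auto simp: doubleton_eq_iff)
    moreover have "T (0, 0) \<le> T (0, 0 + 1)"
      using T(1) unfolding semistandard_def by (metis mem_diagram part_simps(2) one_add_one lessI Suc_eq_plus1 plus_nat.add_0 numeral_2_eq_2)
    ultimately have "T (0, 0) = 0" "T (0, 1) = 1" by auto
    moreover have "T x = 0" if "x \<noteq> (0, 0)" "x \<noteq> (0, 1)" for x
      using T(1) that unfolding semistandard_def diagram_small by blast
    ultimately have "T = (\<lambda>x. if x = (0, 1) then 1 else 0)"
      by (intro ext) metis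
    then show "T \<in> {\<lambda>x. if x = (0, 1) then 1 else 0}" by simp
  qed (auto simp: content semistandard_def nth_default_def split: if_splits)
  then show "coeff_of (schur1 [2]) mon11 = 1"
    by (simp add: coeff_of_schur1)
qed

abbreviation p1 :: "unit symf" where "p1 \<equiv> power_sum (Suc 0)"
abbreviation p2 :: "unit symf" where "p2 \<equiv> power_sum 2"
abbreviation s2 :: "unit symf" where "s2 \<equiv> schur1 [2]"
abbreviation s11 :: "unit symf" where "s11 \<equiv> schur1 [Suc 0, Suc 0]"

lemma degree_2_facts:
  "symmetric (p1 * p1)" "symmetric p2" "symmetric s2" "symmetric s11"
  "homog 2 (p1 * p1)" "homog 2 p2" "homog 2 s2" "homog 2 s11"
  "coeff_of (p1 * p1) mon20 = 1" "coeff_of (p1 * p1) mon11 = 2" "coeff_of p2 mon20 = 1" "coeff_of p2 mon11 = 0"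
proof -
  have p1: "homog 1 p1"
    using homog_power_sum[of 1 "()"] by (simp add: in_alphabet_unit)
  show "symmetric (p1 * p1)" "symmetric p2" "symmetric s2" "symmetric s11"
    by (simp_all add: symmetric_mult symmetric_power_sum symmetric_schur1)
  show "homog 2 (p1 * p1)"
    using homog_mult[OF p1 p1] by (simp add: numeral_2_eq_2)
  show "homog 2 p2"
    using homog_power_sum[of 2 "()"] by (simp add: in_alphabet_unit)
  show "homog 2 s2" "homog 2 s11"
    using homog_schur_unit[OF Par_2] homog_schur_unit[OF Par_11] by (simp_all add: schur_unit numeral_2_eq_2)
  have "coeff_of p1 {#v#} = 1" for v
    by (cases v) (auto simp: power_sum_def)
  then show "coeff_of (p1 * p1) mon20 = 1" "coeff_of (p1 * p1) mon11 = 2"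
    by (simp_all add: coeff_of_mult_pair[OF p1 p1])
  show "coeff_of p2 mon20 = 1"
    by (auto simp: power_sum_def numeral_2_eq_2)
  have "mon11 \<noteq> replicate_mset 2 ((), n)" for n
    by (auto simp: numeral_2_eq_2 add_eq_conv_diff)
  then show "coeff_of p2 mon11 = 0"
    by (simp add: power_sum_def)
qed

definition H2 :: "rf \<Rightarrow> unit symf" where
  "H2 q = s2 + mscale q s11"

lemma H2_facts:
  "symmetric (H2 q)" "homog 2 (H2 q)" "H2 q \<in> Sym"
  "coeff_of (H2 q) mon20 = 1" "coeff_of (H2 q) mon11 = 1 + q"
proof -
  show "symmetric (H2 q)" "homog 2 (H2 q)"
    unfolding H2_def by (intro symmetric_add symmetric_mscale homog_add homog_mscale degree_2_facts)+
  then show "H2 q \<in> Sym"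
    by (rule homog_Sym)
  show "coeff_of (H2 q) mon20 = 1" "coeff_of (H2 q) mon11 = 1 + q"
    by (simp_all add: H2_def coeff_schur1_degree_2)
qed

lemma H2_power_sums: "H2 q = mscale ((1 + q) / 2) (p1 * p1) + mscale ((1 - q) / 2) p2"
  by (rule symmetric_eqI_degree_2)
     (auto intro!: symmetric_add symmetric_mscale homog_add homog_mscale degree_2_facts H2_facts
       simp: degree_2_facts H2_facts field_simps)

text \<open>In power sums the plethysm multiplies p_1^2 by (1 - q)^2 and p_2 by 1 - q^2. Both
  coefficients become (1 - q)(1 - q^2)/2, and p_1^2 + p_2 = 2 s_2.\<close>

lemma plethysm_H2:
  assumes "adams_rf 2 q = q\<^sup>2"
  shows "plethysm (mat (1 - q)) (H2 q) = mscale ((1 - q) * (1 - q\<^sup>2)) s2"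
proof -
  have Sym: "p1 \<in> Sym" "p2 \<in> Sym"
    using Sym_power_sum[of "()" 1] Sym_power_sum[of "()" 2] by (simp_all add: in_alphabet_unit)
  have "adams_rf 2 (1 - q) = 1 - q\<^sup>2"
    by (simp add: adams_rf_diff assms)
  then have "plethysm (mat (1 - q)) p1 = mscale (1 - q) p1" "plethysm (mat (1 - q)) p2 = mscale (1 - q\<^sup>2) p2"
    using plethysm_power_sum[of 1 "mat (1 - q)" "()"] plethysm_power_sum[of 2 "mat (1 - q)" "()"]
    by (simp_all add: in_alphabet_unit plethysm_psum_def UNIV_unit mat_def adams_rf_one[unfolded One_nat_def])
  then have "plethysm (mat (1 - q)) (H2 q) = mscale ((1 + q) / 2 * (1 - q)\<^sup>2) (p1 * p1) + mscale ((1 - q) / 2 * (1 - q\<^sup>2)) p2"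
    by (simp add: H2_power_sums plethysm_add Sym_mscale Sym Sym_mult plethysm_mscale plethysm_mult mscale_mult_left
        mscale_mult_right power2_eq_square)
  also have "\<dots> = mscale ((1 - q) * (1 - q\<^sup>2)) s2"
    by (rule symmetric_eqI_degree_2)
      (intro symmetric_add symmetric_mscale homog_add homog_mscale degree_2_facts(1-8) |
       simp add: degree_2_facts coeff_schur1_degree_2 field_simps power2_eq_square)+
  finally show ?thesis .
qed

lemma degree_2_in_span:
  assumes "symmetric F" "homog 2 F"
  shows "F \<in> mseries.span {s2, s11}"
proof -
  have "F = mscale (coeff_of F mon20) s2 + mscale (coeff_of F mon11 - coeff_of F mon20) s11"
    by (rule symmetric_eqI_degree_2)
       (auto intro!: symmetric_add symmetric_mscale homog_add homog_mscale degree_2_facts assms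
       simp: coeff_schur1_degree_2)
  moreover have "\<dots> \<in> mseries.span {s2, s11}"
    by (intro mseries.span_add mseries.span_scale mseries.span_base) auto
  ultimately show ?thesis
    by simp
qed

text \<open>As in the wreath case, one condition confines the plethysm to multiples of s_2, the
  other allows all of degree 2; passing to the dual partition exchanges z and w.\<close>

lemma macdonald_degree_2:
  "macdonald [2] = H2 zz" "macdonald [Suc 0, Suc 0] = H2 ww"
proof -
  have spans: "{schur (\<lambda>_ :: unit. \<mu>) | \<mu>. \<mu> \<in> Par \<and> dominates \<mu> [2]} = {s2}"
    "{schur (\<lambda>_ :: unit. \<mu>) | \<mu>. \<mu> \<in> Par \<and> dominates \<mu> [Suc 0, Suc 0]} = {s2, s11}"
  proof -
    have "\<mu> \<in> Par \<and> dominates \<mu> [2] \<longleftrightarrow> \<mu> = [2]"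
      "\<mu> \<in> Par \<and> dominates \<mu> [Suc 0, Suc 0] \<longleftrightarrow> \<mu> = [2] \<or> \<mu> = [Suc 0, Suc 0]" for \<mu>
      using dominates_row_iff[of \<mu>] dominates_column_iff[of \<mu>] by auto
    then show "{schur (\<lambda>_ :: unit. \<mu>) | \<mu>. \<mu> \<in> Par \<and> dominates \<mu> [2]} = {s2}"
      "{schur (\<lambda>_ :: unit. \<mu>) | \<mu>. \<mu> \<in> Par \<and> dominates \<mu> [Suc 0, Suc 0]} = {s2, s11}"
      by (auto simp: schur_unit)
  qed
  have rows: "row (sum_list [2]) = row 2" "row (sum_list [Suc 0, Suc 0]) = row 2"
    by (simp_all add: numeral_2_eq_2)
  have unique: "H \<in> Sym \<Longrightarrow> plethysm (mat (1 - q)) H \<in> mseries.span {s2} \<Longrightarrow>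
      hall H (schur (\<lambda>_. row 2)) = 1 \<Longrightarrow> H = H2 q"
    if q: "1 - q \<noteq> 0" "1 - q\<^sup>2 \<noteq> 0" "adams_rf 2 q = q\<^sup>2" for H q
  proof -
    assume H: "H \<in> Sym" "plethysm (mat (1 - q)) H \<in> mseries.span {s2}" "hall H (schur (\<lambda>_. row 2)) = 1"
    have nz: "(1 - q) * (1 - q\<^sup>2) \<noteq> 0"
      using q by simp
    obtain c where c: "H = mscale c (H2 q)"
      by (rule plethysm_span_singleton[OF H(1) H2_facts(3) mat_inverse_unit[OF q(1)] plethysm_H2[OF q(3)] nz H(2)])
    then have "c = 1"
      using H(3) by (simp add: hall_row_unit symmetric_mscale H2_facts numeral_2_eq_2)
    then show ?thesis
      using c by simp
  qed
  have hall: "hall (H2 q) (schur (\<lambda>_. row 2)) = 1" for q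
    using H2_facts(4)[of q] by (simp add: hall_row_unit H2_facts(1) numeral_2_eq_2)
  have in_span: "plethysm M (H2 q) \<in> mseries.span {s2, s11}" for M q
    using Sym_plethysm[OF H2_facts(3), of M q] homog_plethysm[OF H2_facts(3) H2_facts(2), of M q]
    by (intro degree_2_in_span) (simp_all add: Sym_iff)
  have in_span1: "mscale a s2 \<in> mseries.span {s2}" for a
    by (intro mseries.span_scale mseries.span_base) auto
  have zz: "adams_rf 2 zz = zz\<^sup>2" and ww: "adams_rf 2 ww = ww\<^sup>2"
    by (simp_all add: adams_rf_zz adams_rf_ww)
  show "macdonald [2] = H2 zz"
  proof (rule macdonald_eqI)
    fix H
    show "is_macdonald [2] H \<longleftrightarrow> H = H2 zz"
      unfolding is_macdonald_def dual_2 spans rows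
      using unique[OF zz_facts(3,4) zz] hall plethysm_H2[OF zz] in_span1 in_span H2_facts(3) by metis
  qed
  show "macdonald [Suc 0, Suc 0] = H2 ww"
  proof (rule macdonald_eqI)
    fix H
    show "is_macdonald [Suc 0, Suc 0] H \<longleftrightarrow> H = H2 ww"
      unfolding is_macdonald_def dual_11 spans rows
      using unique[OF ww_facts(3,4) ww] hall plethysm_H2[OF ww] in_span1 in_span H2_facts(3) by metis
  qed
qed

section \<open>Inverses and plethystic logarithms\<close>

definition low :: "nat \<Rightarrow> ('v, 'a::zero) mseries \<Rightarrow> bool" where
  "low n F \<longleftrightarrow> (\<forall>M. size M < n \<longrightarrow> coeff_of F M = 0)"

definition agree :: "nat \<Rightarrow> ('v, 'a::zero) mseries \<Rightarrow> ('v, 'a) mseries \<Rightarrow> bool" where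
  "agree n F G \<longleftrightarrow> (\<forall>M. size M < n \<longrightarrow> coeff_of F M = coeff_of G M)"

lemma low_mono: "low n F \<Longrightarrow> m \<le> n \<Longrightarrow> low m F"
  by (auto simp: low_def)

lemma homog_imp_low: "homog n F \<Longrightarrow> low n F"
  by (auto simp: low_def homog_def)

lemma low_1_iff: "low 1 F \<longleftrightarrow> coeff_of F {#} = 0"
  by (auto simp: low_def)

lemma low_mult:
  fixes F G :: "('v, 'a::comm_ring_1) mseries"
  assumes "low a F" "low b G"
  shows "low (a + b) (F * G)"
  unfolding low_def
proof (intro allI impI, rule ccontr)
  fix M assume "size M < a + b" "coeff_of (F * G) M \<noteq> 0"
  from this(2) obtain A B where "A + B = M" "coeff_of F A \<noteq> 0" "coeff_of G B \<noteq> 0"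
    by (rule coeff_of_mult_nonzero)
  moreover from this have "\<not> size A < a" "\<not> size B < b"
    using assms by (auto simp: low_def)
  ultimately show False
    using \<open>size M < a + b\<close> by auto
qed

lemma low_add:
  fixes F G :: "('v, 'a::comm_ring_1) mseries"
  shows "low a F \<Longrightarrow> low a G \<Longrightarrow> low a (F + G)"
  by (simp add: low_def)

lemma low_diff:
  fixes F G :: "('v, 'a::comm_ring_1) mseries"
  shows "low a F \<Longrightarrow> low a G \<Longrightarrow> low a (F - G)"
  by (simp add: low_def)

lemma low_mscale: "low a F \<Longrightarrow> low a (mscale c F)"
  by (simp add: low_def)

lemma low_power:
  fixes F :: "('v, 'a::comm_ring_1) mseries"
  shows "low a F \<Longrightarrow> low (k * a) (F ^ k)"
  by (induction k) (auto simp: low_def[of 0] intro: low_mult)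

lemma agree_trans: "agree n F G \<Longrightarrow> agree n G H \<Longrightarrow> agree n F H"
  and agree_sym: "agree n F G \<Longrightarrow> agree n G F"
  and agree_refl [simp]: "agree n F F"
  by (auto simp: agree_def)

lemma agree_diff_low:
  fixes F G :: "('v, 'a::comm_ring_1) mseries"
  shows "agree n F G \<longleftrightarrow> low n (F - G)"
  by (simp add: agree_def low_def)

lemma agree_mult:
  fixes F G :: "('v, 'a::comm_ring_1) mseries"
  assumes "agree n F F'" "agree n G G'"
  shows "agree n (F * G) (F' * G')"
  unfolding agree_def coeff_of_mult
proof (intro allI impI sum.cong[OF refl])
  fix M :: "'v multiset" and x assume "size M < n" "x \<in> splits M"
  moreover obtain A B where "x = (A, B)" by (cases x)
  ultimately have "size A < n" "size B < n" "x = (A, B)"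
    by (auto simp: splits_iff)
  then show "(case x of (A, B) \<Rightarrow> coeff_of F A * coeff_of G B) = (case x of (A, B) \<Rightarrow> coeff_of F' A * coeff_of G' B)"
    using assms by (simp add: agree_def)
qed

lemma agree_power:
  fixes F :: "('v, 'a::comm_ring_1) mseries"
  shows "agree n F F' \<Longrightarrow> agree n (F ^ k) (F' ^ k)"
  by (induction k) (auto intro: agree_mult)

text \<open>Without constant terms both factors of a splitting are smaller than the product, so one
  degree of agreement is gained. Thus the nonlinear terms of \<open>Exp\<close> depend only on
  coefficients of smaller monomials.\<close>

lemma agree_mult_Suc:
  fixes F G :: "('v, 'a::comm_ring_1) mseries"
  assumes "agree n F F'" "agree n G G'" "low 1 F" "low 1 F'" "low 1 G" "low 1 G'"
  shows "agree (Suc n) (F * G) (F' * G')"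
  unfolding agree_def coeff_of_mult
proof (intro allI impI sum.cong[OF refl])
  fix M :: "'v multiset" and x assume M: "size M < Suc n" "x \<in> splits M"
  obtain A B where x: "x = (A, B)" by (cases x)
  show "(case x of (A, B) \<Rightarrow> coeff_of F A * coeff_of G B) = (case x of (A, B) \<Rightarrow> coeff_of F' A * coeff_of G' B)"
  proof (cases "A = {#} \<or> B = {#}")
    case True
    then show ?thesis
      using assms(3-6) unfolding low_1_iff x by auto
  next
    case False
    then have "0 < size A" "0 < size B"
      by (auto simp: nonempty_has_size)
    moreover have "size A + size B < Suc n"
      using M x by (auto simp: splits_iff)
    ultimately have "size A < n" "size B < n"
      by auto
    then show ?thesis
      using assms(1,2) by (simp add: x agree_def)
  qed
qed

text \<open>An operator that differs from the identity only by contributions of coefficients of smaller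
  monomials is invertible.\<close>

lemma triangular_operator_surj:
  fixes \<Phi> :: "('v, 'a::comm_ring_1) mseries \<Rightarrow> ('v, 'a) mseries"
  assumes "\<And>V V' M. agree (size M) V V' \<Longrightarrow> coeff_of (\<Phi> V) M - coeff_of V M = coeff_of (\<Phi> V') M - coeff_of V' M"
  shows "\<exists>V. \<Phi> V = F"
proof -
  \<comment> \<open>Successive approximation: stage n is final on monomials of size below n, and on
    the others it is corrected by the value of the operator at the previous stage.\<close>
  define W where "W = rec_nat 0 (\<lambda>n w. Series (\<lambda>M. if size M < n then coeff_of w M
      else coeff_of F M - (coeff_of (\<Phi> w) M - coeff_of w M)))"
  have W_Suc: "coeff_of (W (Suc n)) M = (if size M < n then coeff_of (W n) M
      else coeff_of F M - (coeff_of (\<Phi> (W n)) M - coeff_of (W n) M))" for n M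
    by (simp add: W_def)
  define V where "V = Series (\<lambda>M. coeff_of (W (Suc (size M))) M)"
  have WV: "agree n (W n) V" for n
  proof (induction n)
    case (Suc n)
    then show ?case
      by (auto simp: agree_def V_def W_Suc less_Suc_eq)
  qed (simp add: agree_def)
  have "\<Phi> V = F"
  proof (rule mseries_eqI)
    fix M
    have "coeff_of (\<Phi> V) M - coeff_of V M = coeff_of (\<Phi> (W (size M))) M - coeff_of (W (size M)) M"
      using assms[OF WV] ..
    moreover have "coeff_of V M = coeff_of F M - (coeff_of (\<Phi> (W (size M))) M - coeff_of (W (size M)) M)"
      by (simp add: V_def W_Suc)
    ultimately show "coeff_of (\<Phi> V) M = coeff_of F M"
      by (simp add: algebra_simps)
  qed
  then show ?thesis ..
qed

subsection \<open>Inverses\<close>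

lemma right_inverse_unique:
  fixes F :: "'a::comm_ring_1"
  assumes "F * G = 1" "F * G' = 1"
  shows "G' = G"
proof -
  have "G' = G' * (F * G)"
    by (simp add: assms)
  also have "\<dots> = G * (F * G')"
    by (simp add: mult_ac)
  finally show ?thesis
    by (simp add: assms)
qed

lemma mseries_inverse_right:
  fixes F :: "('v, 'a::comm_ring_1) mseries"
  assumes "coeff_of F {#} = 1"
  shows "F * mseries_inverse F = 1"
proof -
  have "\<exists>G. F * G = 1"
  proof (rule triangular_operator_surj)
    fix V V' :: "('v, 'a) mseries" and M :: "'v multiset"
    assume *: "agree (size M) V V'"
    have "({#}, M) \<in> splits M"
      by (simp add: splits_iff)
    then have split: "coeff_of (F * G) M = coeff_of G M + (\<Sum>(A, B)\<in>splits M - {({#}, M)}. coeff_of F A * coeff_of G B)" for G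
      unfolding coeff_of_mult by (subst sum.remove[of _ "({#}, M)"]) (auto simp: assms)
    have "(\<Sum>(A, B)\<in>splits M - {({#}, M)}. coeff_of F A * coeff_of V B)
      = (\<Sum>(A, B)\<in>splits M - {({#}, M)}. coeff_of F A * coeff_of V' B)"
    proof (rule sum.cong[OF refl])
      fix x assume x: "x \<in> splits M - {({#}, M)}"
      obtain A B where AB: "x = (A, B)" by (cases x)
      have "A \<noteq> {#}" "A + B = M"
        using x AB by (auto simp: splits_iff)
      then have "size B < size M"
        by (auto simp: nonempty_has_size)
      then show "(case x of (A, B) \<Rightarrow> coeff_of F A * coeff_of V B) = (case x of (A, B) \<Rightarrow> coeff_of F A * coeff_of V' B)"
        using * by (simp add: AB agree_def)
    qed
    then show "coeff_of (F * V) M - coeff_of V M = coeff_of (F * V') M - coeff_of V' M"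
      by (simp add: split)
  qed
  then obtain G where G: "F * G = 1" ..
  have "(THE G. F * G = 1) = G"
  proof (rule the_equality, rule G)
    fix G' assume "F * G' = 1"
    with G show "G' = G"
      by (rule right_inverse_unique)
  qed
  then show ?thesis
    using G by (simp add: mseries_inverse_def)
qed

text \<open>The geometric series cut after its linear term: \<open>A * A\<close> starts in degree
  2n, which is at least n + 1.\<close>

lemma agree_mseries_inverse:
  fixes F A :: "('v, 'a::comm_ring_1) mseries"
  assumes "0 < n" "homog n A" "agree (Suc n) F (1 + A)"
  shows "agree (Suc n) (mseries_inverse F) (1 - A)"
proof -
  have "coeff_of A {#} = 0"
    using assms(1,2) by (simp add: homogD)
  moreover have "coeff_of F {#} = coeff_of (1 + A) {#}"
    using assms(3) by (simp add: agree_def)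
  ultimately have "coeff_of F {#} = 1"
    by (simp add: coeff_of_1)
  note inv = mseries_inverse_right[OF this]
  have "agree (Suc n) (F * (1 - A)) ((1 + A) * (1 - A))"
    by (intro agree_mult assms(3) agree_refl)
  moreover have "agree (Suc n) ((1 + A) * (1 - A)) 1"
  proof -
    have "(1 + A) * (1 - A) - 1 = 0 - A * A"
      by (simp add: algebra_simps)
    moreover have "low (n + n) (A * A)"
      by (intro low_mult homog_imp_low assms)
    then have "low (Suc n) (A * A)"
      by (rule low_mono) (use assms(1) in simp)
    then have "low (Suc n) (0 - A * A)"
      by (intro low_diff) (simp_all add: low_def)
    ultimately show ?thesis
      by (simp add: agree_diff_low)
  qed
  ultimately have "agree (Suc n) (F * (1 - A)) 1"
    by (rule agree_trans)
  then have "agree (Suc n) (mseries_inverse F * (F * (1 - A))) (mseries_inverse F * 1)"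
    by (intro agree_mult agree_refl)
  moreover have "mseries_inverse F * (F * (1 - A)) = F * mseries_inverse F * (1 - A)"
    by (simp only: mult_ac)
  then have "mseries_inverse F * (F * (1 - A)) = 1 - A"
    by (simp add: inv)
  ultimately show ?thesis
    by (simp add: agree_sym)
qed

subsection \<open>The Adams operations\<close>

lemma repeat_mset_inj: "r > 0 \<Longrightarrow> repeat_mset r L = repeat_mset r L' \<longleftrightarrow> L = L'"
  by (auto simp: multiset_eq_iff)

lemma coeff_of_adams_repeat:
  assumes "r > 0"
  shows "coeff_of (adams r F) (repeat_mset r L) = adams_rf r (coeff_of F L)"
proof -
  have "(THE L'. repeat_mset r L = repeat_mset r L') = L"
    by (intro the_equality) (simp_all add: repeat_mset_inj[OF assms])
  moreover have "\<exists>L'. repeat_mset r L = repeat_mset r L'"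
    by blast
  ultimately show ?thesis
    by (simp add: adams_def)
qed

lemma coeff_of_adams_nonzero:
  assumes "r > 0" "coeff_of (adams r F) M \<noteq> 0"
  obtains L where "M = repeat_mset r L" "coeff_of F L \<noteq> 0"
proof -
  obtain L where L: "M = repeat_mset r L"
    using assms by (auto simp: adams_def split: if_splits)
  moreover from this have "coeff_of F L \<noteq> 0"
    using assms by (auto simp: coeff_of_adams_repeat)
  ultimately show ?thesis
    by (rule that)
qed

lemma size_repeat_mset [simp]: "size (repeat_mset r L) = r * size L"
  by (induction r) auto

lemma adams_1: "adams 1 F = F"
proof (rule mseries_eqI)
  fix M
  show "coeff_of (adams 1 F) M = coeff_of F M"
    using coeff_of_adams_repeat[of 1 F M] by (simp add: adams_rf_one[unfolded One_nat_def])
qed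

lemma adams_add: "r > 0 \<Longrightarrow> adams r (F + G) = adams r F + adams r G"
  by (rule mseries_eqI) (auto simp: adams_def adams_rf_add)

lemma low_adams: "r > 0 \<Longrightarrow> low n F \<Longrightarrow> low (r * n) (adams r F)"
  unfolding low_def
proof (intro allI impI, rule ccontr)
  fix M assume *: "r > 0" "\<forall>M. size M < n \<longrightarrow> coeff_of F M = 0" "size M < r * n" "coeff_of (adams r F) M \<noteq> 0"
  from *(1,4) obtain L where "M = repeat_mset r L" "coeff_of F L \<noteq> 0"
    by (rule coeff_of_adams_nonzero)
  then show False
    using * by auto
qed

definition adams_sum :: "('v, rf) mseries \<Rightarrow> ('v, rf) mseries" where
  "adams_sum V = formal_sum {1..} (\<lambda>r. mscale (1 / of_nat r) (adams r V))"

lemma coeff_of_adams_sum: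
  assumes "low 1 V" "size M \<le> m"
  shows "coeff_of (adams_sum V) M = (\<Sum>r=1..m. 1 / of_nat r * coeff_of (adams r V) M)"
proof -
  have "coeff_of (adams_sum V) M = (\<Sum>r=1..m. coeff_of (mscale (1 / of_nat r) (adams r V)) M)"
    unfolding adams_sum_def
  proof (rule coeff_of_formal_sum)
    fix r assume r: "r \<in> {1..} - {1..m}"
    then have "low (r * 1) (adams r V)"
      using assms(1) by (intro low_adams) auto
    then show "coeff_of (mscale (1 / of_nat r) (adams r V)) M = 0"
      using r assms(2) by (auto simp: low_def)
  qed auto
  then show ?thesis by simp
qed

lemma low_adams_sum: "low 1 V \<Longrightarrow> low 1 (adams_sum V)"
  using coeff_of_adams_sum[of V "{#}" 0] by (simp add: low_1_iff[unfolded One_nat_def])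

lemma coeff_of_mseries_exp:
  assumes "low 1 U" "size M \<le> m"
  shows "coeff_of (mseries_exp U) M = (\<Sum>n\<le>m. 1 / of_nat (fact n) * coeff_of (U ^ n) M)"
proof -
  have "coeff_of (mseries_exp U) M = (\<Sum>n\<le>m. coeff_of (mscale (1 / of_nat (fact n)) (U ^ n)) M)"
    unfolding mseries_exp_def
  proof (rule coeff_of_formal_sum)
    fix n assume n: "n \<in> UNIV - {..m}"
    have "low (n * 1) (U ^ n)"
      by (rule low_power[OF assms(1)])
    then show "coeff_of (mscale (1 / of_nat (fact n)) (U ^ n)) M = 0"
      using n assms(2) by (auto simp: low_def)
  qed auto
  then show ?thesis by simp
qed

lemma Exp_eq: "Exp V = mseries_exp (adams_sum V)"
  by (simp add: Exp_def adams_sum_def)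

text \<open>For r > 1 the coefficient of \<open>adams r V\<close> at M comes from a monomial L with
  M = rL, which is smaller than M.\<close>

lemma adams_sum_difference:
  assumes "low 1 V" "low 1 V'" "agree (size M) V V'"
  shows "coeff_of (adams_sum V) M - coeff_of V M = coeff_of (adams_sum V') M - coeff_of V' M"
proof (cases "M = {#}")
  case True
  then show ?thesis
    using assms(1,2) low_adams_sum[OF assms(1)] low_adams_sum[OF assms(2)] by (simp add: low_def)
next
  case False
  define m where "m = size M"
  have m: "1 \<le> m" "size M \<le> m"
    using False by (auto simp: m_def Suc_le_eq nonempty_has_size)
  have eq: "coeff_of (adams_sum V) M - coeff_of V M = (\<Sum>r=2..m. 1 / of_nat r * coeff_of (adams r V) M)"
    if "low 1 V" for V
    using m unfolding coeff_of_adams_sum[OF that m(2)]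
    by (subst sum.atLeast_Suc_atMost) (simp_all add: adams_1[unfolded One_nat_def] numeral_2_eq_2)
  have "coeff_of (adams r V) M = coeff_of (adams r V') M" if "r \<in> {2..m}" for r
  proof (cases "\<exists>L. M = repeat_mset r L")
    case True
    then obtain L where L: "M = repeat_mset r L" ..
    then have "L \<noteq> {#}"
      using False by auto
    then have "size L < r * size L"
      using that by (auto simp: nonempty_has_size)
    then have "coeff_of V L = coeff_of V' L"
      using assms(3) L by (simp add: agree_def)
    then show ?thesis
      using that by (simp add: L coeff_of_adams_repeat)
  qed (simp add: adams_def)
  then have "(\<Sum>r=2..m. 1 / of_nat r * coeff_of (adams r V) M) = (\<Sum>r=2..m. 1 / of_nat r * coeff_of (adams r V') M)"
    by (intro sum.cong) auto
  then show ?thesis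
    by (simp only: eq[OF assms(1)] eq[OF assms(2)])
qed

text \<open>The coefficient of \<open>V\<close> at M enters only through the linear term of the
  exponential and the summand r = 1 in it; powers from the second on involve smaller monomials by
  \<open>agree_mult_Suc\<close>. So \<open>Exp\<close> is triangular, hence injective and surjective
  in the appropriate sense.\<close>

lemma Exp_difference:
  assumes "low 1 V" "low 1 V'" "agree (size M) V V'"
  shows "coeff_of (Exp V) M - coeff_of V M = coeff_of (Exp V') M - coeff_of V' M"
proof (cases "M = {#}")
  case True
  then show ?thesis
    using assms(1,2) coeff_of_mseries_exp[OF low_adams_sum[OF assms(1)], of "{#}" 0]
      coeff_of_mseries_exp[OF low_adams_sum[OF assms(2)], of "{#}" 0]
    by (simp add: Exp_eq low_def)
next
  case False
  let ?U = "adams_sum V" and ?U' = "adams_sum V'"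
  obtain m where m: "size M = Suc m"
    using False by (cases "size M") auto
  have U: "low 1 ?U" "low 1 ?U'"
    using assms low_adams_sum by auto
  have agree: "agree (size M) ?U ?U'"
    unfolding agree_def
  proof (intro allI impI)
    fix L :: "'a multiset"
    assume L: "size L < size M"
    then have "agree (size L) V V'" "coeff_of V L = coeff_of V' L"
      using assms(3) by (auto simp: agree_def)
    then show "coeff_of ?U L = coeff_of ?U' L"
      using adams_sum_difference[OF assms(1,2), of L] by simp
  qed
  have eq: "coeff_of (mseries_exp U) M = coeff_of U M + (\<Sum>n=2..Suc m. 1 / of_nat (fact n) * coeff_of (U ^ n) M)"
    if "low 1 U" for U
  proof -
    have "coeff_of (mseries_exp U) M = (\<Sum>n=0..Suc m. 1 / of_nat (fact n) * coeff_of (U ^ n) M)"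
      using coeff_of_mseries_exp[OF that, of M "Suc m"] by (simp add: m atLeast0AtMost del: sum.atMost_Suc)
    also have "\<dots> = (\<Sum>n=1..Suc m. 1 / of_nat (fact n) * coeff_of (U ^ n) M)"
      using False by (subst sum.atLeast_Suc_atMost) (simp_all add: coeff_of_1 del: sum.cl_ivl_Suc)
    also have "\<dots> = coeff_of U M + (\<Sum>n=2..Suc m. 1 / of_nat (fact n) * coeff_of (U ^ n) M)"
      by (subst sum.atLeast_Suc_atMost) (simp_all add: numeral_2_eq_2 del: sum.cl_ivl_Suc)
    finally show ?thesis .
  qed
  have "coeff_of (?U ^ n) M = coeff_of (?U' ^ n) M" if "n \<in> {2..Suc m}" for n
  proof -
    define k where "k = n - 2"
    have k: "n = Suc (Suc k)"
      using that by (auto simp: k_def)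
    have low: "low 1 (U * U ^ k)" if "low 1 U" for U :: "('a, rf) mseries"
    proof -
      have "low (1 + k * 1) (U * U ^ k)"
        using that by (intro low_mult low_power)
      then show ?thesis
        by (rule low_mono) simp
    qed
    have "agree (Suc (size M)) (?U * (?U * ?U ^ k)) (?U' * (?U' * ?U' ^ k))"
      by (intro agree_mult_Suc agree_mult agree_power agree low U)
    then show ?thesis
      by (simp add: k agree_def)
  qed
  then have "(\<Sum>n=2..Suc m. 1 / of_nat (fact n) * coeff_of (?U ^ n) M)
      = (\<Sum>n=2..Suc m. 1 / of_nat (fact n) * coeff_of (?U' ^ n) M)"
    by (intro sum.cong) auto
  then show ?thesis
    using adams_sum_difference[OF assms] unfolding Exp_eq eq[OF U(1)] eq[OF U(2)] by simp
qed

lemma coeff_of_Exp_empty: "low 1 V \<Longrightarrow> coeff_of (Exp V) {#} = 1"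
  using coeff_of_mseries_exp[OF low_adams_sum, of V "{#}" 0] by (simp add: Exp_eq coeff_of_1)

lemma Exp_agree_imp:
  assumes "low 1 V" "low 1 V'" "agree n (Exp V) (Exp V')"
  shows "agree n V V'"
proof -
  have "coeff_of V M = coeff_of V' M" if "size M < n" for M
    using that
  proof (induction "size M" arbitrary: M rule: less_induct)
    case less
    then have "agree (size M) V V'"
      by (auto simp: agree_def)
    from Exp_difference[OF assms(1,2) this] show ?case
      using assms(3) less.prems by (simp add: agree_def)
  qed
  then show ?thesis
    by (simp add: agree_def)
qed

text \<open>Exponentials that agree everywhere have arguments that agree in every degree; this
  settles the description in \<open>Log_def\<close>.\<close>

lemma Log_eqI:
  assumes "low 1 V" "Exp V = F"
  shows "Log F = V"
  unfolding Log_def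
proof (rule the_equality)
  fix V' assume V': "coeff_of V' {#} = 0 \<and> Exp V' = F"
  show "V' = V"
  proof (rule mseries_eqI)
    fix M :: "'a multiset"
    have "agree (Suc (size M)) V' V"
      by (rule Exp_agree_imp) (use V' assms in \<open>auto simp: low_1_iff[unfolded One_nat_def]\<close>)
    then show "coeff_of V' M = coeff_of V M"
      by (simp add: agree_def)
  qed
qed (use assms in \<open>simp add: low_1_iff[unfolded One_nat_def]\<close>)

lemma Exp_Log:
  fixes F :: "('v, rf) mseries"
  assumes "coeff_of F {#} = 1"
  shows "low 1 (Log F)" "Exp (Log F) = F"
proof -
  \<comment> \<open>\<open>triangular_operator_surj\<close> asks for an operator on all series,
    whereas \<open>Exp\<close> is controlled only without constant term. So the constant term is
    removed before \<open>Exp\<close> is applied and passed through separately.\<close>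
  define trunc where "trunc V = Series (\<lambda>M. if M = {#} then 0 else coeff_of V M)" for V :: "('v, rf) mseries"
  define \<Phi> where "\<Phi> V = Series (\<lambda>M. if M = {#} then coeff_of V M else coeff_of (Exp (trunc V)) M)" for V
  have trunc: "low 1 (trunc V)" for V
    by (simp add: low_1_iff[unfolded One_nat_def] trunc_def)
  have "\<exists>V. \<Phi> V = trunc F"
  proof (rule triangular_operator_surj)
    fix V V' :: "('v, rf) mseries" and M :: "'v multiset"
    assume "agree (size M) V V'"
    then have "agree (size M) (trunc V) (trunc V')"
      by (auto simp: agree_def trunc_def)
    from Exp_difference[OF trunc trunc this]
    show "coeff_of (\<Phi> V) M - coeff_of V M = coeff_of (\<Phi> V') M - coeff_of V' M"
      by (auto simp: \<Phi>_def trunc_def)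
  qed
  then obtain V where V: "\<Phi> V = trunc F" ..
  have \<Phi>V: "coeff_of (\<Phi> V) M = coeff_of (trunc F) M" for M
    by (simp add: V)
  have "coeff_of V {#} = 0"
    using \<Phi>V[of "{#}"] by (simp add: \<Phi>_def trunc_def)
  then have "trunc V = V"
    by (intro mseries_eqI) (auto simp: trunc_def)
  have low: "low 1 V"
    using trunc[of V] by (simp only: \<open>trunc V = V\<close>)
  have "Exp V = F"
  proof (rule mseries_eqI)
    fix M
    show "coeff_of (Exp V) M = coeff_of F M"
      using \<Phi>V[of M] coeff_of_Exp_empty[OF low] assms
      by (cases "M = {#}") (auto simp: \<Phi>_def \<open>trunc V = V\<close> trunc_def[of F])
  qed
  with low Log_eqI[of V F] show "low 1 (Log F)" "Exp (Log F) = F"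
    by auto
qed

text \<open>The candidate is checked by applying \<open>Exp\<close>. Up to degree 2n its
  \<open>adams_sum\<close> is A + B - A^2/2, the subtracted half of \<open>adams 2 A\<close> being
  restored, and the exponential of this is 1 + A + B; terms with r or k at least 3 start in degree
  3n. Then \<open>Exp_agree_imp\<close> applies.\<close>

lemma agree_Log:
  fixes F A B :: "('v, rf) mseries"
  assumes "0 < n" "homog n A" "homog (2 * n) B" "agree (Suc (2 * n)) F (1 + A + B)"
  shows "agree (Suc (2 * n)) (Log F) (A + (B - mscale (1 / 2) (A * A) - mscale (1 / 2) (adams 2 A)))"
proof -
  let ?N = "Suc (2 * n)"
  define C where "C = B - mscale (1 / 2) (A * A) - mscale (1 / 2) (adams 2 A)"
  define V where "V = A + C"
  define U where "U = A + (B - mscale (1 / 2) (A * A))"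
  have A: "low n A" and A2: "low (2 * n) (A * A)" and B: "low (2 * n) B"
    using assms(2,3) homog_imp_low low_mult[of n A n A] by (auto simp: mult_2)
  have C: "low (2 * n) C"
    unfolding C_def by (intro low_diff low_mscale A2 B low_adams A) simp
  have D: "low (2 * n) (B - mscale (1 / 2) (A * A))"
    by (intro low_diff low_mscale A2 B)
  have Vn: "low n V"
    unfolding V_def using A C by (auto intro!: low_add intro: low_mono)
  then have V: "low 1 V"
    using assms(1) by (auto intro: low_mono)
  have Un: "low n U"
    unfolding U_def using A D by (auto intro!: low_add intro: low_mono)
  have adams_U: "agree ?N (adams_sum V) U"
    unfolding agree_def
  proof (intro allI impI)
    fix M :: "'v multiset"
    assume M: "size M < ?N"
    then have "coeff_of (adams_sum V) M = (\<Sum>r=1..2 * n. 1 / of_nat r * coeff_of (adams r V) M)"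
      by (intro coeff_of_adams_sum V) simp
    also have "\<dots> = (\<Sum>r\<in>{1, 2}. 1 / of_nat r * coeff_of (adams r V) M)"
    proof (rule sum.mono_neutral_right)
      show "\<forall>r\<in>{1..2 * n} - {1, 2}. 1 / of_nat r * coeff_of (adams r V) M = 0"
      proof
        fix r assume r: "r \<in> {1..2 * n} - {1, 2}"
        then have "r \<ge> 3" by auto
        then have "3 * n \<le> r * n"
          by simp
        moreover have "low (r * n) (adams r V)"
          by (rule low_adams[OF _ Vn]) (use r in auto)
        moreover have "size M < r * n"
          using M assms(1) \<open>3 * n \<le> r * n\<close> by linarith
        ultimately show "1 / of_nat r * coeff_of (adams r V) M = 0"
          by (simp add: low_def)
      qed
    qed (use assms(1) in auto)
    also have "\<dots> = coeff_of V M + 1 / 2 * coeff_of (adams 2 V) M"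
      by (simp add: adams_1[unfolded One_nat_def])
    \<comment> \<open>\<open>adams 2 C\<close> starts in degree 4n, beyond the range
      considered.\<close>
    also have "coeff_of (adams 2 V) M = coeff_of (adams 2 A) M"
      using low_adams[of 2, OF _ C] M assms(1) by (simp add: V_def adams_add low_def)
    also have "coeff_of V M + 1 / 2 * coeff_of (adams 2 A) M = coeff_of U M"
      by (simp add: V_def U_def C_def)
    finally show "coeff_of (adams_sum V) M = coeff_of U M" .
  qed
  have Exp_V: "agree ?N (Exp V) F"
    unfolding agree_def
  proof (intro allI impI)
    fix M :: "'v multiset"
    assume M: "size M < ?N"
    have "coeff_of (Exp V) M = (\<Sum>k\<le>2 * n. 1 / of_nat (fact k) * coeff_of (adams_sum V ^ k) M)"
      unfolding Exp_eq by (rule coeff_of_mseries_exp[OF low_adams_sum[OF V]]) (use M in simp)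
    also have "\<dots> = (\<Sum>k\<le>2 * n. 1 / of_nat (fact k) * coeff_of (U ^ k) M)"
      using agree_power[OF adams_U] M by (simp add: agree_def)
    also have "\<dots> = (\<Sum>k\<in>{0, 1, 2}. 1 / of_nat (fact k) * coeff_of (U ^ k) M)"
    proof (rule sum.mono_neutral_right)
      show "\<forall>k\<in>{..2 * n} - {0, 1, 2}. 1 / of_nat (fact k) * coeff_of (U ^ k) M = 0"
      proof
        fix k assume k: "k \<in> {..2 * n} - {0, 1, 2}"
        then have "k \<ge> 3" by auto
        then have "3 * n \<le> k * n"
          by simp
        moreover have "low (k * n) (U ^ k)"
          by (rule low_power[OF Un])
        moreover have "size M < k * n"
          using M assms(1) \<open>3 * n \<le> k * n\<close> by linarith
        ultimately show "1 / of_nat (fact k) * coeff_of (U ^ k) M = 0"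
          by (simp add: low_def)
      qed
    qed (use assms(1) in auto)
    also have "\<dots> = coeff_of 1 M + coeff_of U M + 1 / 2 * coeff_of (U * U) M"
      by (simp add: power2_eq_square)
    also have "coeff_of (U * U) M = coeff_of (A * A) M"
    proof -
      let ?D = "B - mscale (1 / 2) (A * A)"
      have "U * U = A * A + (A * ?D + ?D * (A + ?D))"
        unfolding U_def by (simp add: algebra_simps)
      moreover have "low (n + 2 * n) (A * ?D)" "low (2 * n + n) (?D * (A + ?D))"
        by (intro low_mult A D; use Un in \<open>simp add: U_def\<close>)+
      then have "coeff_of (A * ?D) M = 0" "coeff_of (?D * (A + ?D)) M = 0"
        using M assms(1) unfolding low_def by auto
      ultimately show ?thesis
        by simp
    qed
    also have "coeff_of 1 M + coeff_of U M + 1 / 2 * coeff_of (A * A) M = coeff_of (1 + A + B) M"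
      by (simp add: U_def)
    also have "\<dots> = coeff_of F M"
      using assms(4) M by (simp add: agree_def)
    finally show "coeff_of (Exp V) M = coeff_of F M" .
  qed
  have "coeff_of A {#} = 0" "coeff_of B {#} = 0"
    using homogD[OF assms(2), of "{#}"] homogD[OF assms(3), of "{#}"] assms(1) by simp_all
  moreover have "coeff_of F {#} = coeff_of (1 + A + B) {#}"
    using assms(4) unfolding agree_def by (rule allE[of _ "{#}"]) simp
  ultimately have "coeff_of F {#} = 1"
    by (simp add: coeff_of_1)
  note Log = Exp_Log[OF this]
  have "agree ?N V (Log F)"
    by (rule Exp_agree_imp[OF V Log(1)]) (simp only: Log(2) Exp_V)
  then show ?thesis
    unfolding V_def C_def by (rule agree_sym)
qed

subsection \<open>Symmetry\<close>

definition act :: "('v \<Rightarrow> 'v) \<Rightarrow> ('v, 'a) mseries \<Rightarrow> ('v, 'a) mseries" where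
  "act \<sigma> F = Series (\<lambda>M. coeff_of F (image_mset \<sigma> M))"

lemma coeff_of_act [simp]: "coeff_of (act \<sigma> F) M = coeff_of F (image_mset \<sigma> M)"
  by (simp add: act_def)

lemma symmetric_act: "symmetric F \<longleftrightarrow> (\<forall>\<pi>. (\<forall>i. bij (\<pi> i)) \<longrightarrow> act (permute_vars \<pi>) F = F)"
proof
  assume "symmetric F"
  then show "\<forall>\<pi>. (\<forall>i. bij (\<pi> i)) \<longrightarrow> act (permute_vars \<pi>) F = F"
    by (auto intro!: mseries_eqI symmetricD)
next
  assume *: "\<forall>\<pi>. (\<forall>i. bij (\<pi> i)) \<longrightarrow> act (permute_vars \<pi>) F = F"
  show "symmetric F"
    unfolding symmetric_def by (metis * coeff_of_act)
qed

lemma act_mult: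
  fixes F G :: "('v, 'a::comm_ring_1) mseries"
  shows "inj \<sigma> \<Longrightarrow> act \<sigma> (F * G) = act \<sigma> F * act \<sigma> G"
  by (rule mseries_eqI) (simp add: coeff_of_mult_image, simp add: coeff_of_mult)

lemma act_1: "act \<sigma> 1 = 1"
  by (rule mseries_eqI) (simp add: coeff_of_1)

lemma act_mscale: "act \<sigma> (mscale c F) = mscale c (act \<sigma> F)"
  by (rule mseries_eqI) simp

lemma act_power:
  fixes F :: "('v, 'a::comm_ring_1) mseries"
  shows "inj \<sigma> \<Longrightarrow> act \<sigma> (F ^ k) = act \<sigma> F ^ k"
  by (induction k) (simp_all add: act_1 act_mult)

lemma act_formal_sum: "act \<sigma> (formal_sum I f) = formal_sum I (\<lambda>i. act \<sigma> (f i))"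
  by (rule mseries_eqI) (simp add: formal_sum_def)

lemma act_adams:
  assumes "inj \<sigma>" "r > 0"
  shows "act \<sigma> (adams r F) = adams r (act \<sigma> F)"
proof (rule mseries_eqI)
  fix M
  have repeat: "image_mset f (repeat_mset r L) = repeat_mset r (image_mset f L)" for f :: "'a \<Rightarrow> 'a" and L
    by (induction L) simp_all
  show "coeff_of (act \<sigma> (adams r F)) M = coeff_of (adams r (act \<sigma> F)) M"
  proof (cases "\<exists>L. M = repeat_mset r L")
    case True
    then obtain L where "M = repeat_mset r L" ..
    then show ?thesis
      by (simp add: repeat coeff_of_adams_repeat[OF assms(2)])
  next
    case False
    have "coeff_of (adams r F) (image_mset \<sigma> M) = 0"
    proof (rule ccontr)
      assume "coeff_of (adams r F) (image_mset \<sigma> M) \<noteq> 0"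
      then obtain L where "image_mset \<sigma> M = repeat_mset r L"
        by (rule coeff_of_adams_nonzero[OF assms(2)])
      then have "image_mset (inv \<sigma>) (image_mset \<sigma> M) = repeat_mset r (image_mset (inv \<sigma>) L)"
        by (simp add: repeat)
      then have "M = repeat_mset r (image_mset (inv \<sigma>) L)"
        using assms(1) by (simp add: image_mset.compositionality o_def)
      then show False
        using False by blast
    qed
    then show ?thesis
      using False by (simp add: adams_def)
  qed
qed

lemma act_Exp:
  assumes "inj \<sigma>"
  shows "act \<sigma> (Exp V) = Exp (act \<sigma> V)"
proof -
  have "act \<sigma> (adams_sum V) = adams_sum (act \<sigma> V)"
    unfolding adams_sum_def act_formal_sum
    by (rule mseries_eqI, simp add: formal_sum_def act_mscale act_adams[OF assms] cong: conj_cong)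
  then show ?thesis
    by (simp add: Exp_eq mseries_exp_def act_formal_sum act_mscale act_power assms)
qed

text \<open>\<open>Exp\<close> commutes with permutations of the variables, so a permuted logarithm
  of a symmetric series is again a logarithm of it; uniqueness gives equality.\<close>

lemma symmetric_Log:
  assumes "symmetric F" "coeff_of F {#} = 1"
  shows "symmetric (Log F)"
  unfolding symmetric_act
proof (intro allI impI)
  fix \<pi> :: "'a \<Rightarrow> nat \<Rightarrow> nat"
  assume \<pi>: "\<forall>i. bij (\<pi> i)"
  then have inj: "inj (permute_vars \<pi>)"
    by (simp add: inj_permute_vars)
  note Log = Exp_Log[OF assms(2)]
  have "Exp (act (permute_vars \<pi>) (Log F)) = F"
    using assms(1) \<pi> by (simp add: Log symmetric_act flip: act_Exp[OF inj])
  moreover have "low 1 (act (permute_vars \<pi>) (Log F))"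
    using Log(1) by (simp add: low_def)
  ultimately show "act (permute_vars \<pi>) (Log F) = Log F"
    using Log_eqI by metis
qed

lemma symmetric_mseries_inverse:
  fixes F :: "('i \<times> nat, 'a::comm_ring_1) mseries"
  assumes "symmetric F" "coeff_of F {#} = 1"
  shows "symmetric (mseries_inverse F)"
  unfolding symmetric_act
proof (intro allI impI)
  fix \<pi> :: "'i \<Rightarrow> nat \<Rightarrow> nat"
  assume \<pi>: "\<forall>i. bij (\<pi> i)"
  then have inj: "inj (permute_vars \<pi>)"
    by (simp add: inj_permute_vars)
  note inv = mseries_inverse_right[OF assms(2)]
  have "act (permute_vars \<pi>) (F * mseries_inverse F) = 1"
    by (simp add: inv act_1)
  then have "F * act (permute_vars \<pi>) (mseries_inverse F) = 1"
    using assms(1) \<pi> by (simp add: act_mult[OF inj] symmetric_act)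
  with inv show "act (permute_vars \<pi>) (mseries_inverse F) = mseries_inverse F"
    by (rule right_inverse_unique)
qed

section \<open>The generating functions in low degrees\<close>

lemma agree_formal_sum:
  assumes "\<And>i. i \<in> I \<Longrightarrow> homog (s i) (f i)" "finite S" "S \<subseteq> I" "\<And>i. i \<in> I - S \<Longrightarrow> n \<le> s i"
  shows "agree n (formal_sum I f) (\<Sum>i\<in>S. f i)"
  unfolding agree_def
proof (intro allI impI)
  fix M :: "'b multiset"
  assume M: "size M < n"
  have "coeff_of (formal_sum I f) M = (\<Sum>i\<in>S. coeff_of (f i) M)"
  proof (rule coeff_of_formal_sum[OF assms(2,3)])
    fix i assume i: "i \<in> I - S"
    then have "homog (s i) (f i)" "size M \<noteq> s i"
      using assms(1)[of i] assms(4)[of i] M by auto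
    then show "coeff_of (f i) M = 0"
      by (rule homogD)
  qed
  then show "coeff_of (formal_sum I f) M = coeff_of (\<Sum>i\<in>S. f i) M"
    by simp
qed

lemma filter_mset_blocks:
  assumes "finite J" "\<And>i v. i \<in> J \<Longrightarrow> v \<in># m i \<Longrightarrow> b v = i"
  shows "{#v \<in># (\<Sum>i\<in>J. m i). b v = j#} = (if j \<in> J then m j else {#})"
  using assms
proof (induction J rule: finite_induct)
  case (insert i J)
  have "{#v \<in># m i. b v = j#} = (if i = j then m i else {#})"
    using insert.prems[of i] by (auto simp: filter_mset_eq_conv)
  then show ?case
    using insert by auto
qed simp

lemma coeff_of_prod_monomials:
  fixes G :: "'j \<Rightarrow> ('v, 'a::comm_ring_1) mseries"
  assumes "finite J"
    and "\<And>j M v. j \<in> J \<Longrightarrow> coeff_of (G j) M \<noteq> 0 \<Longrightarrow> v \<in># M \<Longrightarrow> b v = j"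
    and "\<And>j v. j \<in> J \<Longrightarrow> v \<in># m j \<Longrightarrow> b v = j"
  shows "coeff_of (\<Prod>j\<in>J. G j) (\<Sum>j\<in>J. m j) = (\<Prod>j\<in>J. coeff_of (G j) (m j))"
proof -
  have filter: "{#v \<in># (\<Sum>i\<in>J. m i). b v = j#} = (if j \<in> J then m j else {#})" for j
    by (rule filter_mset_blocks[OF assms(1,3)])
  have "\<forall>v\<in>#(\<Sum>j\<in>J. m j). b v \<in> J"
  proof
    fix v assume "v \<in># (\<Sum>j\<in>J. m j)"
    then have "v \<in># {#u \<in># (\<Sum>i\<in>J. m i). b u = b v#}"
      by simp
    then show "b v \<in> J"
      by (simp only: filter) (auto split: if_splits)
  qed
  then show ?thesis
    by (subst coeff_of_prod_blocks[where b = b, OF assms(1,2)]) (simp_all add: filter)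
qed

lemma symmetric_complete_h: "symmetric (complete_h r)"
  by (simp add: symmetric_def complete_h_def)

lemma complete_h_1: "complete_h 1 = power_sum 1"
proof (rule mseries_eqI)
  fix M :: "(unit \<times> nat) multiset"
  have "size M = 1 \<longleftrightarrow> (\<exists>n. M = {#((), n)#})"
    by (metis One_nat_def old.unit.exhaust size_1_singleton_mset size_single surj_pair)
  then show "coeff_of (complete_h 1) M = coeff_of (power_sum 1) M"
    by (simp add: complete_h_def power_sum_def)
qed

lemma monomial_dual1_1: "monomial_dual1 {#((), 0)#} = power_sum 1"
proof -
  have "{\<nu>. \<nu> \<in> Par \<and> sum_list \<nu> = size {#((), 0 :: nat)#}} = {[1]}"
    using Par_sum_list_1 by auto
  moreover have "coeff_of (schur1 [1]) {#((), 0)#} = 1"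
    by (rule coeff_of_schur1_leading) (auto simp: nth_default_def)
  ultimately show ?thesis
    by (simp add: monomial_dual1_def schur1_1[unfolded One_nat_def])
qed

lemma monomial_dual1_degree_2: "monomial_dual1 mon20 = complete_h_part [2]" "monomial_dual1 mon11 = complete_h_part [1, 1]"
proof -
  have Par: "{\<nu>. \<nu> \<in> Par \<and> sum_list \<nu> = Suc (Suc 0)} = {[2], [Suc 0, Suc 0]}"
    using Par_sum_list_2 Par_2 Par_11 by (auto simp: numeral_2_eq_2)
  have d: "monomial_dual1 mon20 = s2" "monomial_dual1 mon11 = s2 + s11"
    unfolding monomial_dual1_def by (simp_all add: Par coeff_schur1_degree_2)
  have "complete_h 2 = s2"
    by (rule symmetric_eqI_degree_2)
       (auto simp: degree_2_facts coeff_schur1_degree_2 symmetric_complete_h, auto simp: homog_def complete_h_def)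
  then show "monomial_dual1 mon20 = complete_h_part [2]"
    by (simp add: complete_h_part_def d)
  have "p1 * p1 = s2 + s11"
    by (rule symmetric_eqI_degree_2)
       (auto intro!: symmetric_add homog_add simp: degree_2_facts coeff_schur1_degree_2)
  then show "monomial_dual1 mon11 = complete_h_part [1, 1]"
    by (simp add: complete_h_part_def d complete_h_1[unfolded One_nat_def])
qed

lemma inj_in_x: "inj (\<lambda>(i, n). ((j, i), n))"
  by (auto simp: inj_on_def)

lemma homog_in_x: "homog d F \<Longrightarrow> homog d (in_x j F)"
  unfolding in_x_def by (rule homog_rename[OF inj_in_x])

lemma homog_in_x_union: "homog d F \<Longrightarrow> homog d (in_x_union j F)"
  unfolding in_x_union_def by (rule homog_rename[OF inj_union_vars])

lemma homog_in_alphabet: "homog d F \<Longrightarrow> homog d (in_alphabet i F)"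
  unfolding in_alphabet_def by (rule homog_rename) (auto simp: inj_on_def)

lemma in_x_support:
  assumes "coeff_of (in_x j F) M \<noteq> 0" "v \<in># M"
  shows "fst (fst v) = j"
proof -
  obtain L where "M = image_mset (\<lambda>(i, n). ((j, i), n)) L"
    using assms(1) unfolding in_x_def by (rule coeff_of_rename_nonzero[OF inj_in_x])
  then show ?thesis
    using assms(2) by auto
qed

lemma in_x_union_support:
  assumes "coeff_of (in_x_union j F) M \<noteq> 0" "v \<in># M"
  shows "fst (fst v) = j"
proof -
  obtain L where "M = image_mset (\<lambda>(_ :: unit, n :: nat). ((j, if even n then 0 else 1 :: 2), n div 2)) L"
    using assms(1) unfolding in_x_union_def by (rule coeff_of_rename_nonzero[OF inj_union_vars])
  then show ?thesis
    using assms(2) by auto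
qed

lemma coeff_of_in_x: "coeff_of (in_x j F) {#((j, e), n)#} = coeff_of F {#(e, n)#}"
  using coeff_of_rename_image[OF inj_in_x, of j F "{#(e, n)#}"] by (simp add: in_x_def)

lemma in_x_union_power_sum: "in_x_union j (power_sum 1) = (\<Sum>e\<in>UNIV. in_alphabet (j, e) (power_sum 1))"
proof (rule mseries_eqI)
  fix M :: "((nat \<times> 2) \<times> nat) multiset"
  let ?f = "\<lambda>(_ :: unit, n :: nat). ((j, if even n then 0 else 1 :: 2), n div 2)"
  have one: "coeff_of (in_x_union j (power_sum 1)) {#((j, e), n)#} = 1" for e n
  proof -
    have "image_mset ?f {#((), 2 * n + (if e = 0 then 0 else 1))#} = {#((j, e), n)#}"
      using type2_cases[of e] by auto
    moreover have "coeff_of (power_sum 1) {#((), m)#} = 1" for m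
      by (auto simp: power_sum_def)
    ultimately show ?thesis
      using coeff_of_rename_image[OF inj_union_vars, of j "power_sum 1" "{#((), 2 * n + (if e = 0 then 0 else 1))#}"]
      by (simp add: in_x_union_def)
  qed
  show "coeff_of (in_x_union j (power_sum 1)) M = coeff_of (\<Sum>e\<in>UNIV. in_alphabet (j, e) (power_sum 1)) M"
  proof (cases "\<exists>e n. M = {#((j, e), n)#}")
    case True
    then obtain e n where M: "M = {#((j, e), n)#}" by blast
    then show ?thesis
      unfolding M one using type2_cases[of e] by (auto simp: UNIV_2 coeff_of_power_sum)
  next
    case False
    have "coeff_of (in_x_union j (power_sum 1)) M = 0"
    proof (rule ccontr)
      assume "coeff_of (in_x_union j (power_sum 1)) M \<noteq> 0"
      then obtain L where "M = image_mset ?f L" "coeff_of (power_sum 1) L \<noteq> 0"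
        unfolding in_x_union_def by (rule coeff_of_rename_nonzero[OF inj_union_vars])
      then show False
        using False by (auto simp: power_sum_def split: if_splits)
    qed
    then show ?thesis
      using False by (auto simp: UNIV_2 coeff_of_power_sum)
  qed
qed

lemma map_coeffs_power_sum: "map_coeffs (adams_rf 2) (power_sum r) = power_sum r"
  by (rule mseries_eqI) (simp add: power_sum_def)

lemma map_coeffs_1: "map_coeffs (adams_rf 2) 1 = 1"
  by (rule mseries_eqI) (simp add: coeff_of_1)

lemma in_x_1: "in_x j 1 = 1" and in_x_union_1: "in_x_union j 1 = 1" and in_alphabet_1: "in_alphabet i 1 = 1"
  by (simp_all add: in_x_def in_x_union_def in_alphabet_def rename_1)

subsection \<open>The coefficients\<close>

lemma hall_linear:
  assumes "symmetric F"
  shows "hall F (mscale a x0 + mscale b x1) = a * coeff_of F {#(0, 0)#} + b * coeff_of F {#(1, 0)#}"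
proof -
  have P: "par10 \<in> Par_family" "par01 \<in> Par_family"
    by (auto simp: Par_family_def par10_def par01_def)
  have "schur (\<lambda>i. if i = 0 then row 1 else []) = x0" "schur (\<lambda>i. if i = 1 then row 1 else []) = x1"
  proof -
    have "(\<lambda>i. if i = 0 then row 1 else []) = par10" "(\<lambda>i. if i = 1 then row 1 else []) = par01"
      using type2_cases by (auto simp: fun_eq_iff par10_def par01_def row_def)
    then show "schur (\<lambda>i. if i = 0 then row 1 else []) = x0" "schur (\<lambda>i. if i = 1 then row 1 else []) = x1"
      by (simp_all only: schur_par10 schur_par01)
  qed
  then have c: "hall F x0 = coeff_of F {#(0, 0)#}" "hall F x1 = coeff_of F {#(1, 0)#}"
    using hall_row[OF assms, of 0 1] hall_row[OF assms, of 1 1] by simp_all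
  have "hall F x0 = schur_coeffs F par10" "hall F x1 = schur_coeffs F par01"
    using hall_schur_sum[of "{par10}" F "\<lambda>_. 1"] hall_schur_sum[of "{par01}" F "\<lambda>_. 1"] P
    by (simp_all add: schur_par10 schur_par01)
  moreover have "hall F (mscale a x0 + mscale b x1) = schur_coeffs F par10 * a + schur_coeffs F par01 * b"
    using hall_schur_sum[of "{par10, par01}" F "\<lambda>\<alpha>. if \<alpha> = par10 then a else b"] P par_distinct
    by (simp add: schur_par10 schur_par01)
  ultimately show ?thesis
    by (simp add: c mult.commute)
qed

lemma pairing_matrix:
  "(neg_swap ** Mz ** Mw) $ 0 $ 0 = zz + ww" "(neg_swap ** Mz ** Mw) $ 0 $ 1 = - (1 + zz * ww)"
  "(neg_swap ** Mz ** Mw) $ 1 $ 0 = - (1 + zz * ww)" "(neg_swap ** Mz ** Mw) $ 1 $ 1 = zz + ww"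
  by (simp_all add: matrix_matrix_mult_def neg_swap_def Mz_def Mw_def UNIV_2 algebra_simps)

text \<open>The pairing of \<open>linear_form q\<close> with itself is (z + w)(1 + q^2) - 2q(1 +
  zw), which factors at q = z and at q = w.\<close>

lemma N_wreath_small:
  "N_wreath par00 = 1" "N_wreath par10 = (zz\<^sup>2 - 1) * (zz - ww)" "N_wreath par01 = (1 - ww\<^sup>2) * (zz - ww)"
proof -
  show "N_wreath par00 = 1"
    by (simp add: N_wreath_def wreath_pairing_def wreath_macdonald_par00 plethysm_1 hall_1 coeff_of_1)
  have pair: "wreath_pairing (linear_form q) (linear_form q)
      = ((zz + ww) + q * - (1 + zz * ww)) * 1 + (- (1 + zz * ww) + q * (zz + ww)) * q" for q
    unfolding wreath_pairing_def linear_form_facts(4) hall_linear[OF linear_form_facts(2)] pairing_matrix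
    by (simp add: linear_form_facts(3))
  show "N_wreath par10 = (zz\<^sup>2 - 1) * (zz - ww)" "N_wreath par01 = (1 - ww\<^sup>2) * (zz - ww)"
    unfolding N_wreath_def wreath_macdonald_small pair by (simp_all add: algebra_simps power2_eq_square)
qed

lemma ww_gt_zz: "zz < ww"
  using power_strict_increasing[OF _ zz_gt_1, of 1 3] ww_gt by simp

lemma nonzero_facts:
  "zz - ww \<noteq> 0" "zz\<^sup>2 - 1 \<noteq> 0" "1 - ww\<^sup>2 \<noteq> 0" "zz ^ 4 - 1 \<noteq> 0" "1 - ww ^ 4 \<noteq> 0" "zz\<^sup>2 - ww\<^sup>2 \<noteq> 0"
  "zz ^ 3 - ww \<noteq> 0" "zz - ww ^ 3 \<noteq> 0"
proof -
  show "zz - ww \<noteq> 0" "zz ^ 3 - ww \<noteq> 0"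
    using ww_gt_zz ww_gt by auto
  show "zz\<^sup>2 - 1 \<noteq> 0" "1 - ww\<^sup>2 \<noteq> 0" "zz ^ 4 - 1 \<noteq> 0" "1 - ww ^ 4 \<noteq> 0"
    using one_less_power[OF zz_gt_1, of 2] one_less_power[OF zz_gt_1, of 4]
      one_less_power[OF ww_gt_1, of 2] one_less_power[OF ww_gt_1, of 4] by auto
  show "zz\<^sup>2 - ww\<^sup>2 \<noteq> 0"
    using power_strict_mono[OF ww_gt_zz, of 2] zz_facts(2) by auto
  have "ww < ww ^ 3"
    using power_strict_increasing[OF _ ww_gt_1, of 1 3] by simp
  then show "zz - ww ^ 3 \<noteq> 0"
    using ww_gt_zz by auto
qed

text \<open>At u = zw, with z and w squared, a box with arm a and leg l contributes the square of
  z^(2a + 1) - w^(2l + 1).\<close>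

lemma N_values:
  "N [Suc 0] (zz * ww) (zz\<^sup>2) (ww\<^sup>2) = (zz - ww)\<^sup>2"
  "N [2] (zz * ww) (zz\<^sup>2) (ww\<^sup>2) = (zz ^ 3 - ww)\<^sup>2 * (zz - ww)\<^sup>2"
  "N [Suc 0, Suc 0] (zz * ww) (zz\<^sup>2) (ww\<^sup>2) = (zz - ww ^ 3)\<^sup>2 * (zz - ww)\<^sup>2"
  "N [Suc 0] 1 (zz\<^sup>2) (ww\<^sup>2) = (zz\<^sup>2 - 1) * (1 - ww\<^sup>2)"
  "N [2] 1 (zz\<^sup>2) (ww\<^sup>2) = ((zz ^ 4 - 1) * (zz\<^sup>2 - ww\<^sup>2)) * ((zz\<^sup>2 - 1) * (1 - ww\<^sup>2))"
  "N [Suc 0, Suc 0] 1 (zz\<^sup>2) (ww\<^sup>2) = ((zz\<^sup>2 - ww\<^sup>2) * (1 - ww ^ 4)) * ((zz\<^sup>2 - 1) * (1 - ww\<^sup>2))"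
proof -
  have u: "inverse (zz * ww) * ww\<^sup>2 = ww / zz" "inverse (zz * ww) * (ww\<^sup>2)\<^sup>2 = ww ^ 3 / zz"
    using zz_facts(1) ww_facts(1) by (simp_all add: field_simps power2_eq_square power3_eq_cube)
  have f: "(zz\<^sup>2 - zz * ww) * (1 - ww / zz) = (zz - ww)\<^sup>2"
    "((zz\<^sup>2)\<^sup>2 - zz * ww) * (zz\<^sup>2 - ww / zz) = (zz ^ 3 - ww)\<^sup>2"
    "(zz\<^sup>2 - zz * ww * ww\<^sup>2) * (1 - ww ^ 3 / zz) = (zz - ww ^ 3)\<^sup>2"
    using zz_facts(1) by (simp_all add: field_simps power2_eq_square power3_eq_cube)
  show "N [Suc 0] (zz * ww) (zz\<^sup>2) (ww\<^sup>2) = (zz - ww)\<^sup>2"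
    "N [2] (zz * ww) (zz\<^sup>2) (ww\<^sup>2) = (zz ^ 3 - ww)\<^sup>2 * (zz - ww)\<^sup>2"
    "N [Suc 0, Suc 0] (zz * ww) (zz\<^sup>2) (ww\<^sup>2) = (zz - ww ^ 3)\<^sup>2 * (zz - ww)\<^sup>2"
    by (simp_all only: N_small u f)
  show "N [Suc 0] 1 (zz\<^sup>2) (ww\<^sup>2) = (zz\<^sup>2 - 1) * (1 - ww\<^sup>2)"
    "N [2] 1 (zz\<^sup>2) (ww\<^sup>2) = ((zz ^ 4 - 1) * (zz\<^sup>2 - ww\<^sup>2)) * ((zz\<^sup>2 - 1) * (1 - ww\<^sup>2))"
    "N [Suc 0, Suc 0] 1 (zz\<^sup>2) (ww\<^sup>2) = ((zz\<^sup>2 - ww\<^sup>2) * (1 - ww ^ 4)) * ((zz\<^sup>2 - 1) * (1 - ww\<^sup>2))"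
    by (simp_all add: N_small flip: power_mult)
qed

text \<open>In size 1 \<open>N_nabla\<close> is 1, so only the box of even hook length remains. The
  value is obtained by dividing the norm of the partition of 2 by the factor (z - w)^2 of its other
  box.\<close>

lemma N_wreath_u_values:
  "N_wreath_u 2 par00 u = 1" "N_wreath_u 2 par10 (zz * ww) = (zz ^ 3 - ww)\<^sup>2"
  "N_wreath_u 2 par01 (zz * ww) = (zz - ww ^ 3)\<^sup>2"
proof -
  have cot00: "N_cot par00 u z w = 1" for u z w
    by (simp add: N_cot_def from_quotient_small diagram_small)
  then show "N_wreath_u 2 par00 u = 1"
    by (simp add: N_wreath_u_def N_nabla_def N_wreath_small)
  have nabla: "N_nabla par10 = 1" "N_nabla par01 = 1"
    using nonzero_facts by (simp_all add: N_nabla_def N_wreath_small N_cot_small)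
  have "N_wreath_u 2 par10 (zz * ww) * (zz - ww)\<^sup>2 = N [2] (zz * ww) (zz\<^sup>2) (ww\<^sup>2)"
    "N_wreath_u 2 par01 (zz * ww) * (zz - ww)\<^sup>2 = N [Suc 0, Suc 0] (zz * ww) (zz\<^sup>2) (ww\<^sup>2)"
    unfolding N_values(1)[symmetric] by (simp_all add: N_wreath_u_def nabla N_cot_small N_small)
  then show "N_wreath_u 2 par10 (zz * ww) = (zz ^ 3 - ww)\<^sup>2" "N_wreath_u 2 par01 (zz * ww) = (zz - ww ^ 3)\<^sup>2"
    using nonzero_facts(1) by (simp_all add: N_values)
qed

lemma adams_N_wreath:
  "adams_rf 2 (N_wreath par00) = 1" "adams_rf 2 (N_wreath par10) = (zz ^ 4 - 1) * (zz\<^sup>2 - ww\<^sup>2)"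
  "adams_rf 2 (N_wreath par01) = (zz\<^sup>2 - ww\<^sup>2) * (1 - ww ^ 4)"
  by (simp_all add: N_wreath_small adams_rf_mult adams_rf_diff adams_rf_power adams_rf_zz adams_rf_ww flip: power_mult)

subsection \<open>The three generating functions\<close>

definition Omega_0_term :: "nat \<Rightarrow> nat \<Rightarrow> partition2 \<Rightarrow> (nat \<times> 2) symf" where
  "Omega_0_term g k \<alpha> = mscale (N (from_quotient \<alpha>) (zz * ww) (zz\<^sup>2) (ww\<^sup>2) ^ (g + k - 1) /
             (adams_rf 2 (N_wreath \<alpha>) * N_wreath_u 2 \<alpha> (zz * ww) ^ (k - 1)))
       (\<Prod>j=1..2*k. in_x j (map_coeffs (adams_rf 2) (wreath_macdonald \<alpha>)))"

definition Omega_star_term :: "nat \<Rightarrow> nat \<Rightarrow> partition \<Rightarrow> (nat \<times> 2) symf" where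
  "Omega_star_term g k \<nu> =
     mscale (N \<nu> (zz * ww) (zz\<^sup>2) (ww\<^sup>2) ^ (2 * g + k - 1) / N \<nu> 1 (zz\<^sup>2) (ww\<^sup>2))
       (\<Prod>j=1..2*k. in_x_union j (map_coeffs (adams_rf 2) (macdonald \<nu>)))"

definition Omega_HLRV_term :: "nat \<Rightarrow> nat \<Rightarrow> partition \<Rightarrow> nat symf" where
  "Omega_HLRV_term g k \<nu> =
     mscale (N \<nu> (zz * ww) (zz\<^sup>2) (ww\<^sup>2) ^ g / N \<nu> 1 (zz\<^sup>2) (ww\<^sup>2))
       (\<Prod>j=1..2*k. in_alphabet j (map_coeffs (adams_rf 2) (macdonald \<nu>)))"

lemma Omega_0_term_facts:
  "symmetric (Omega_0_term g k \<alpha>)" "homog (2 * k * size2 \<alpha>) (Omega_0_term g k \<alpha>)"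
proof -
  let ?H = "map_coeffs (adams_rf 2) (wreath_macdonald \<alpha>)"
  have H: "symmetric ?H" "homog (size2 \<alpha>) ?H"
    using wreath_macdonald_Sym_homog[of \<alpha>]
    by (auto simp: Sym_iff intro: symmetric_map_coeffs homog_map_coeffs)
  show "symmetric (Omega_0_term g k \<alpha>)"
    unfolding Omega_0_term_def by (intro symmetric_mscale symmetric_prod symmetric_in_x H)
  have "homog (\<Sum>j=1..2*k. size2 \<alpha>) (\<Prod>j=1..2*k. in_x j ?H)"
    by (intro homog_prod homog_in_x H)
  then show "homog (2 * k * size2 \<alpha>) (Omega_0_term g k \<alpha>)"
    unfolding Omega_0_term_def by (intro homog_mscale) simp
qed

lemma map_coeffs_macdonald:
  "symmetric (map_coeffs (adams_rf 2) (macdonald \<nu>))" "homog (sum_list \<nu>) (map_coeffs (adams_rf 2) (macdonald \<nu>))"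
  using macdonald_Sym_homog[of \<nu>]
  by (auto simp: Sym_iff intro: symmetric_map_coeffs homog_map_coeffs)

lemma Omega_star_term_facts:
  "symmetric (Omega_star_term g k \<nu>)" "homog (2 * k * sum_list \<nu>) (Omega_star_term g k \<nu>)"
proof -
  show "symmetric (Omega_star_term g k \<nu>)"
    unfolding Omega_star_term_def
    by (intro symmetric_mscale symmetric_prod symmetric_in_x_union map_coeffs_macdonald)
  have "homog (\<Sum>j=1..2*k. sum_list \<nu>) (\<Prod>j=1..2*k. in_x_union j (map_coeffs (adams_rf 2) (macdonald \<nu>)))"
    by (intro homog_prod homog_in_x_union map_coeffs_macdonald)
  then show "homog (2 * k * sum_list \<nu>) (Omega_star_term g k \<nu>)"
    unfolding Omega_star_term_def by (intro homog_mscale) simp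
qed

lemma Omega_HLRV_term_facts:
  "symmetric (Omega_HLRV_term g k \<nu>)" "homog (2 * k * sum_list \<nu>) (Omega_HLRV_term g k \<nu>)"
proof -
  show "symmetric (Omega_HLRV_term g k \<nu>)"
    unfolding Omega_HLRV_term_def
    by (intro symmetric_mscale symmetric_prod symmetric_in_alphabet map_coeffs_macdonald)
  have "homog (\<Sum>j=1..2*k. sum_list \<nu>) (\<Prod>j=1..2*k. in_alphabet j (map_coeffs (adams_rf 2) (macdonald \<nu>)))"
    by (intro homog_prod homog_in_alphabet map_coeffs_macdonald)
  then show "homog (2 * k * sum_list \<nu>) (Omega_HLRV_term g k \<nu>)"
    unfolding Omega_HLRV_term_def by (intro homog_mscale) simp
qed

lemma term_one:
  "Omega_0_term g k par00 = 1" "Omega_star_term g k [] = 1" "Omega_HLRV_term g k [] = 1"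
  by (simp_all add: Omega_0_term_def Omega_star_term_def Omega_HLRV_term_def wreath_macdonald_par00 macdonald_Nil
      map_coeffs_1 in_x_1 in_x_union_1 in_alphabet_1 N_small from_quotient_small adams_N_wreath N_wreath_u_values)

lemma symmetric_Omega:
  "symmetric (Omega_0 g k)" "symmetric (Omega_star g k)" "symmetric (Omega_HLRV g k)"
  using Omega_0_term_facts(1) Omega_star_term_facts(1) Omega_HLRV_term_facts(1)
  unfolding Omega_0_def Omega_star_def Omega_HLRV_def Omega_0_term_def Omega_star_term_def Omega_HLRV_term_def
  by (blast intro: symmetric_formal_sum)+

text \<open>The summand of \<alpha> has degree 2k times the size of \<alpha>, so size 2 and above
  starts in degree 4k.\<close>

lemma agree_Omega_0:
  assumes "k > 0"
  shows "agree (Suc (2 * k)) (Omega_0 g k) (1 + (Omega_0_term g k par10 + Omega_0_term g k par01))"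
proof -
  have "agree (Suc (2 * k)) (formal_sum Par2 (Omega_0_term g k)) (\<Sum>\<alpha>\<in>{par00, par10, par01}. Omega_0_term g k \<alpha>)"
  proof (rule agree_formal_sum[where s = "\<lambda>\<alpha>. 2 * k * size2 \<alpha>"])
    fix \<alpha> assume \<alpha>: "\<alpha> \<in> Par2 - {par00, par10, par01}"
    then have "size2 \<alpha> \<noteq> 0" "size2 \<alpha> \<noteq> 1"
      using Par2_size_0[of \<alpha>] Par2_size_1[of \<alpha>] by auto
    then have "2 \<le> size2 \<alpha>"
      by linarith
    then have "2 * k * 2 \<le> 2 * k * size2 \<alpha>"
      by (rule mult_le_mono2)
    then show "Suc (2 * k) \<le> 2 * k * size2 \<alpha>"
      using assms by linarith
  qed (auto simp: Omega_0_term_facts)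
  moreover have "Omega_0 g k = formal_sum Par2 (Omega_0_term g k)"
    by (simp add: Omega_0_def Omega_0_term_def[abs_def])
  ultimately show ?thesis
    using par_distinct by (simp add: term_one)
qed

lemma agree_Omega_star:
  assumes "k > 0"
  shows "agree (Suc (2 * k)) (Omega_star g k) (1 + Omega_star_term g k [1])"
proof -
  have "agree (Suc (2 * k)) (formal_sum Par (Omega_star_term g k)) (\<Sum>\<nu>\<in>{[], [1]}. Omega_star_term g k \<nu>)"
  proof (rule agree_formal_sum[where s = "\<lambda>\<nu>. 2 * k * sum_list \<nu>"])
    fix \<nu> assume \<nu>: "\<nu> \<in> Par - {[], [1]}"
    then have "sum_list \<nu> \<noteq> 0" "sum_list \<nu> \<noteq> 1"
      using Par_sum_list_0[of \<nu>] Par_sum_list_1[of \<nu>] by blast+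
    then have "2 \<le> sum_list \<nu>"
      by linarith
    then have "2 * k * 2 \<le> 2 * k * sum_list \<nu>"
      by (rule mult_le_mono2)
    then show "Suc (2 * k) \<le> 2 * k * sum_list \<nu>"
      using assms by linarith
  qed (auto simp: Omega_star_term_facts)
  moreover have "Omega_star g k = formal_sum Par (Omega_star_term g k)"
    by (simp add: Omega_star_def Omega_star_term_def[abs_def])
  ultimately show ?thesis
    by (simp add: term_one)
qed

lemma agree_Omega_HLRV:
  assumes "k > 0"
  shows "agree (Suc (2 * (2 * k))) (Omega_HLRV g k)
    (1 + Omega_HLRV_term g k [1] + (Omega_HLRV_term g k [2] + Omega_HLRV_term g k [1, 1]))"
proof -
  have "agree (Suc (2 * (2 * k))) (formal_sum Par (Omega_HLRV_term g k)) (\<Sum>\<nu>\<in>{[], [1], [2], [1, 1]}. Omega_HLRV_term g k \<nu>)"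
  proof (rule agree_formal_sum[where s = "\<lambda>\<nu>. 2 * k * sum_list \<nu>"])
    fix \<nu> assume \<nu>: "\<nu> \<in> Par - {[], [1], [2], [1, 1]}"
    then have "sum_list \<nu> \<noteq> 0" "sum_list \<nu> \<noteq> 1" "sum_list \<nu> \<noteq> 2"
      using Par_sum_list_0[of \<nu>] Par_sum_list_1[of \<nu>] Par_sum_list_2[of \<nu>] by blast+
    then have "3 \<le> sum_list \<nu>"
      by linarith
    then have "2 * k * 3 \<le> 2 * k * sum_list \<nu>"
      by (rule mult_le_mono2)
    then show "Suc (2 * (2 * k)) \<le> 2 * k * sum_list \<nu>"
      using assms by linarith
  qed (auto simp: Omega_HLRV_term_facts)
  moreover have "Omega_HLRV g k = formal_sum Par (Omega_HLRV_term g k)"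
    by (simp add: Omega_HLRV_def Omega_HLRV_term_def[abs_def])
  ultimately show ?thesis
    by (simp add: term_one add.assoc)
qed

lemma agree_constant_term:
  fixes A :: "('v, 'a::comm_ring_1) mseries"
  assumes "agree (Suc n) F (1 + A)" "low 1 A"
  shows "coeff_of F {#} = 1"
proof -
  have "coeff_of F {#} = coeff_of (1 + A) {#}"
    using assms(1) unfolding agree_def by (rule allE[of _ "{#}"]) simp
  then show ?thesis
    using assms(2) by (simp add: coeff_of_1 low_def)
qed

lemma Omega_quotient:
  assumes "k > 0"
  shows "symmetric ((Omega_0 g k)\<^sup>2 * mseries_inverse (Omega_star g k))"
    and "size M = 2 * k \<Longrightarrow> coeff_of ((Omega_0 g k)\<^sup>2 * mseries_inverse (Omega_star g k)) M =
      2 * (coeff_of (Omega_0_term g k par10) M + coeff_of (Omega_0_term g k par01) M)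
        - coeff_of (Omega_star_term g k [1]) M"
proof -
  let ?A = "Omega_0_term g k par10 + Omega_0_term g k par01" and ?B = "Omega_star_term g k [1]"
  have A: "homog (2 * k) ?A"
    using Omega_0_term_facts(2)[of k par10 g] Omega_0_term_facts(2)[of k par01 g] by (intro homog_add) auto
  have B: "homog (2 * k) ?B"
    using Omega_star_term_facts(2)[of k "[1]" g] by simp
  note low = homog_imp_low[OF A] homog_imp_low[OF B]
  have low1: "low 1 ?B"
    by (rule low_mono[OF low(2)]) (use assms in simp)
  note const = agree_constant_term[OF agree_Omega_star[OF assms] low1]
  show "symmetric ((Omega_0 g k)\<^sup>2 * mseries_inverse (Omega_star g k))"
    unfolding power2_eq_square by (intro symmetric_mult symmetric_Omega symmetric_mseries_inverse const)
  assume M: "size M = 2 * k"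
  have "agree (Suc (2 * k)) (Omega_0 g k * Omega_0 g k * mseries_inverse (Omega_star g k)) ((1 + ?A) * (1 + ?A) * (1 - ?B))"
    by (intro agree_mult agree_Omega_0 assms agree_mseries_inverse[OF _ B] agree_Omega_star) (use assms in simp)
  then have "coeff_of ((Omega_0 g k)\<^sup>2 * mseries_inverse (Omega_star g k)) M = coeff_of ((1 + ?A) * (1 + ?A) * (1 - ?B)) M"
    using M by (simp add: agree_def power2_eq_square)
  \<comment> \<open>The bracket collects the products of at least two of the series of degree 2k; it
    starts in degree 4k and vanishes at M.\<close>
  also have "(1 + ?A) * (1 + ?A) * (1 - ?B) = 1 + ?A + ?A - ?B + (?A * ?A - ?A * ?B - ?A * (?B + ?A * ?B))"
    by (simp add: algebra_simps)
  also have "coeff_of \<dots> M = 2 * (coeff_of (Omega_0_term g k par10) M + coeff_of (Omega_0_term g k par01) M) - coeff_of ?B M"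
  proof -
    have AB: "low (2 * k) (?B + ?A * ?B)"
      using low low_mult[OF low] by (intro low_add) (auto intro: low_mono)
    have "low (2 * k + 2 * k) (?A * ?A - ?A * ?B - ?A * (?B + ?A * ?B))"
      by (intro low_diff low_mult low AB)
    then have "coeff_of (?A * ?A - ?A * ?B - ?A * (?B + ?A * ?B)) M = 0"
      using M assms by (simp add: low_def)
    moreover have "coeff_of 1 M = (0 :: rf)"
      using M assms by (auto simp: coeff_of_1)
    ultimately show ?thesis
      by (simp only: coeff_of_add coeff_of_diff) (simp add: algebra_simps)
  qed
  finally show "coeff_of ((Omega_0 g k)\<^sup>2 * mseries_inverse (Omega_star g k)) M =
      2 * (coeff_of (Omega_0_term g k par10) M + coeff_of (Omega_0_term g k par01) M) - coeff_of ?B M" .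
qed

subsection \<open>The left-hand side\<close>

text \<open>One variable for each j, where \<epsilon> says from which of the two alphabets of x_j it
  is taken.\<close>

definition x_monomial :: "nat \<Rightarrow> (nat \<Rightarrow> 2) \<Rightarrow> ((nat \<times> 2) \<times> nat) multiset" where
  "x_monomial k \<epsilon> = (\<Sum>j=1..2*k. {#((j, \<epsilon> j), 0)#})"

lemma size_x_monomial: "size (x_monomial k \<epsilon>) = 2 * k"
proof -
  have "size (\<Sum>j\<in>J. {#((j, \<epsilon> j), 0)#}) = card J" if "finite J" for J
    using that by (induction J rule: finite_induct) auto
  then show ?thesis
    by (simp add: x_monomial_def)
qed

definition coeff10 :: "nat \<Rightarrow> nat \<Rightarrow> rf" where
  "coeff10 g k = ((zz ^ 3 - ww)\<^sup>2 * (zz - ww)\<^sup>2) ^ (g + k - 1) /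
     ((zz ^ 4 - 1) * (zz\<^sup>2 - ww\<^sup>2) * ((zz ^ 3 - ww)\<^sup>2) ^ (k - 1))"

definition coeff01 :: "nat \<Rightarrow> nat \<Rightarrow> rf" where
  "coeff01 g k = ((zz - ww ^ 3)\<^sup>2 * (zz - ww)\<^sup>2) ^ (g + k - 1) /
     ((zz\<^sup>2 - ww\<^sup>2) * (1 - ww ^ 4) * ((zz - ww ^ 3)\<^sup>2) ^ (k - 1))"

definition coeff_star :: "nat \<Rightarrow> nat \<Rightarrow> rf" where
  "coeff_star g k = ((zz - ww)\<^sup>2) ^ (2 * g + k - 1) / ((zz\<^sup>2 - 1) * (1 - ww\<^sup>2))"

lemma coeff_Omega_0_term:
  "coeff_of (Omega_0_term g k par10) (x_monomial k \<epsilon>) = coeff10 g k * (\<Prod>j=1..2*k. if \<epsilon> j = 0 then 1 else zz\<^sup>2)"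
  "coeff_of (Omega_0_term g k par01) (x_monomial k \<epsilon>) = coeff01 g k * (\<Prod>j=1..2*k. if \<epsilon> j = 0 then 1 else ww\<^sup>2)"
proof -
  have prod: "coeff_of (\<Prod>j=1..2*k. in_x j (map_coeffs (adams_rf 2) (linear_form q))) (x_monomial k \<epsilon>)
      = (\<Prod>j=1..2*k. if \<epsilon> j = 0 then 1 else adams_rf 2 q)" for q
    unfolding x_monomial_def
    by (subst coeff_of_prod_monomials[where b = "\<lambda>v. fst (fst v)"])
       (auto simp: coeff_of_in_x linear_form_facts intro: in_x_support intro!: prod.cong)
  show "coeff_of (Omega_0_term g k par10) (x_monomial k \<epsilon>) = coeff10 g k * (\<Prod>j=1..2*k. if \<epsilon> j = 0 then 1 else zz\<^sup>2)"
    "coeff_of (Omega_0_term g k par01) (x_monomial k \<epsilon>) = coeff01 g k * (\<Prod>j=1..2*k. if \<epsilon> j = 0 then 1 else ww\<^sup>2)"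
    unfolding Omega_0_term_def coeff_of_mscale wreath_macdonald_small prod from_quotient_small N_values adams_N_wreath
      N_wreath_u_values coeff10_def coeff01_def
    by (simp_all only: adams_rf_zz[of 2, simplified] adams_rf_ww[of 2, simplified])
qed

lemma coeff_Omega_star_term:
  "coeff_of (Omega_star_term g k [1]) (x_monomial k \<epsilon>) = coeff_star g k"
proof -
  have "coeff_of (in_x_union j (power_sum 1)) {#((j, e), 0)#} = 1" for j e
    unfolding in_x_union_power_sum using type2_cases[of e] by (auto simp: UNIV_2 coeff_of_power_sum)
  then have "coeff_of (\<Prod>j=1..2*k. in_x_union j (power_sum 1)) (x_monomial k \<epsilon>) = 1"
    unfolding x_monomial_def
    by (subst coeff_of_prod_monomials[where b = "\<lambda>v. fst (fst v)"])
       (auto intro: in_x_union_support)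
  then show ?thesis
    unfolding Omega_star_term_def macdonald_1 map_coeffs_power_sum coeff_of_mscale
    by (simp add: N_values coeff_star_def)
qed

lemma prod_x_monomial_dual:
  "(\<Prod>j=1..2*k. in_alphabet (j, \<epsilon> j) (power_sum 1)) = monomial_dual (x_monomial k \<epsilon>)"
proof -
  let ?J = "(\<lambda>j. (j, \<epsilon> j)) ` {1..2*k}"
  have "(\<Prod>i\<in>?J. in_alphabet i (monomial_dual1 {#((), 0)#})) = monomial_dual (x_monomial k \<epsilon>)"
  proof (rule prod_monomial_dual1)
    fix i :: "nat \<times> 2"
    have "{#v \<in># x_monomial k \<epsilon>. fst v = i#} = (if i \<in> ?J then {#(i, 0)#} else {#})"
    proof -
      have "x_monomial k \<epsilon> = (\<Sum>i\<in>?J. {#(i, 0)#})"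
        unfolding x_monomial_def by (subst sum.reindex) (auto simp: inj_on_def)
      then show ?thesis
        by (simp only:) (rule filter_mset_blocks, auto)
    qed
    then show "section_at i (x_monomial k \<epsilon>) = (if i \<in> ?J then {#((), 0)#} else {#})"
      by (simp add: section_at_def)
  qed simp
  then show ?thesis
    by (subst (asm) prod.reindex) (auto simp: inj_on_def monomial_dual1_1)
qed

text \<open>Each \<open>h_beta\<close> is a sum of h_1 over the alphabets in \<open>E j\<close>, so
  the pairing is a sum of coefficients over the choices \<epsilon>. Such a sum factors over j: an
  index with two alphabets contributes 1 + z^2, 1 + w^2 or 2, one with a single alphabet contributes
  1.\<close>

lemma H_B_formula:
  assumes "k > 0" "\<And>j. j \<in> {1..2*k} \<Longrightarrow> a j \<noteq> 0 \<and> C j = sigma_class (diag (a j))"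
  defines "m \<equiv> card {j \<in> {1..2*k}. (a j)\<^sup>2 \<noteq> 1}"
  shows "H_B g k C = 2 * (coeff10 g k * (1 + zz\<^sup>2) ^ m + coeff01 g k * (1 + ww\<^sup>2) ^ m) - coeff_star g k * 2 ^ m"
proof -
  define F where "F = (Omega_0 g k)\<^sup>2 * mseries_inverse (Omega_star g k)"
  note F = Omega_quotient[OF assms(1), where g = g, folded F_def]
  define E :: "nat \<Rightarrow> 2 set" where "E j = (if (a j)\<^sup>2 = 1 then {0} else UNIV)" for j
  let ?J = "{1..2*k}"
  have sum_weights: "(\<Sum>\<epsilon>\<in>PiE ?J E. \<Prod>j\<in>?J. if \<epsilon> j = 0 then 1 else q) = (1 + q) ^ m" for q :: rf
  proof -
    have "(\<Sum>\<epsilon>\<in>PiE ?J E. \<Prod>j\<in>?J. if \<epsilon> j = 0 then 1 else q) = (\<Prod>j\<in>?J. \<Sum>e\<in>E j. if e = 0 then 1 else q)"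
      by (rule prod_sum_PiE[symmetric]) (auto simp: E_def)
    also have "\<dots> = (\<Prod>j\<in>?J. if (a j)\<^sup>2 \<noteq> 1 then 1 + q else 1)"
      by (rule prod.cong) (auto simp: E_def UNIV_2)
    also have "\<dots> = (1 + q) ^ m"
      by (simp add: prod.If_cases m_def Int_def)
    finally show ?thesis .
  qed
  have sum_ones: "(\<Sum>\<epsilon>\<in>PiE ?J E. \<Prod>j\<in>?J. 1) = (2 :: rf) ^ m"
  proof -
    have "(\<Sum>\<epsilon>\<in>PiE ?J E. \<Prod>j\<in>?J. 1) = (\<Prod>j\<in>?J. \<Sum>e\<in>E j. (1 :: rf))"
      by (rule prod_sum_PiE[symmetric]) (auto simp: E_def)
    also have "\<dots> = (\<Prod>j\<in>?J. if (a j)\<^sup>2 \<noteq> 1 then 2 else 1)"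
      by (rule prod.cong) (auto simp: E_def UNIV_2)
    also have "\<dots> = 2 ^ m"
      by (simp add: prod.If_cases m_def Int_def)
    finally show ?thesis .
  qed
  have "(\<Prod>j\<in>?J. h_beta j (C j)) = (\<Prod>j\<in>?J. \<Sum>e\<in>E j. in_alphabet (j, e) (power_sum 1))"
  proof (rule prod.cong[OF refl])
    fix j assume "j \<in> ?J"
    then have "a j \<noteq> 0" "C j = sigma_class (diag (a j))"
      using assms(2) by auto
    then show "h_beta j (C j) = (\<Sum>e\<in>E j. in_alphabet (j, e) (power_sum 1))"
      using h_beta_diag[of "a j" j]
      by (simp add: E_def complete_h_1[unfolded One_nat_def] in_x_union_power_sum[unfolded One_nat_def])
  qed
  also have "\<dots> = (\<Sum>\<epsilon>\<in>PiE ?J E. \<Prod>j\<in>?J. in_alphabet (j, \<epsilon> j) (power_sum 1))"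
    by (rule prod_sum_PiE) (auto simp: E_def)
  also have "\<dots> = (\<Sum>\<epsilon>\<in>PiE ?J E. monomial_dual (x_monomial k \<epsilon>))"
    by (simp only: prod_x_monomial_dual)
  finally have "H_B g k C = (\<Sum>\<epsilon>\<in>PiE ?J E. coeff_of F (x_monomial k \<epsilon>))"
    unfolding H_B_def F_def[symmetric]
    by (simp only:) (rule hall_sum_monomial_dual[OF F(1)], auto intro!: finite_PiE simp: E_def)
  also have "\<dots> = (\<Sum>\<epsilon>\<in>PiE ?J E. 2 * (coeff10 g k * (\<Prod>j\<in>?J. if \<epsilon> j = 0 then 1 else zz\<^sup>2)
      + coeff01 g k * (\<Prod>j\<in>?J. if \<epsilon> j = 0 then 1 else ww\<^sup>2)) - coeff_star g k * (\<Prod>j\<in>?J. 1))"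
    by (simp only: F(2)[OF size_x_monomial] coeff_Omega_0_term coeff_Omega_star_term prod.neutral_const mult_1_right)
  also have "\<dots> = 2 * (coeff10 g k * (\<Sum>\<epsilon>\<in>PiE ?J E. \<Prod>j\<in>?J. if \<epsilon> j = 0 then 1 else zz\<^sup>2)
      + coeff01 g k * (\<Sum>\<epsilon>\<in>PiE ?J E. \<Prod>j\<in>?J. if \<epsilon> j = 0 then 1 else ww\<^sup>2)) - coeff_star g k * (\<Sum>\<epsilon>\<in>PiE ?J E. \<Prod>j\<in>?J. 1)"
    by (simp only: sum_subtractf sum.distrib sum_distrib_left[symmetric])
  also have "\<dots> = 2 * (coeff10 g k * (1 + zz\<^sup>2) ^ m + coeff01 g k * (1 + ww\<^sup>2) ^ m) - coeff_star g k * 2 ^ m"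
    by (simp only: sum_weights sum_ones)
  finally show ?thesis .
qed

subsection \<open>The right-hand side\<close>

text \<open>The monomial dual to h_\<mu>; every partition other than \<open>[2]\<close> is treated
  as (1,1).\<close>

definition mu_monomial :: "partition \<Rightarrow> (unit \<times> nat) multiset" where
  "mu_monomial \<mu> = (if \<mu> = [2] then mon20 else mon11)"

definition z_monomial :: "nat \<Rightarrow> (nat \<Rightarrow> partition) \<Rightarrow> (nat \<times> nat) multiset" where
  "z_monomial k \<mu> = (\<Sum>j=1..2*k. image_mset (\<lambda>v. (j, snd v)) (mu_monomial (\<mu> j)))"

lemma size_z_monomial: "size (z_monomial k \<mu>) = 2 * (2 * k)"
proof -
  have "size (\<Sum>j\<in>J. image_mset (\<lambda>v. (j, snd v)) (mu_monomial (\<mu> j))) = 2 * card J" if "finite J" for J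
    using that by (induction J rule: finite_induct) (auto simp: mu_monomial_def)
  then show ?thesis
    by (simp add: z_monomial_def)
qed

lemma section_at_z_monomial:
  "section_at i (z_monomial k \<mu>) = (if i \<in> {1..2*k} then mu_monomial (\<mu> i) else {#})"
proof -
  have "{#v \<in># z_monomial k \<mu>. fst v = i#} = (if i \<in> {1..2*k} then image_mset (\<lambda>v. (i, snd v)) (mu_monomial (\<mu> i)) else {#})"
    unfolding z_monomial_def by (rule filter_mset_blocks) auto
  moreover have "(\<lambda>v :: unit \<times> nat. ((), snd v)) = (\<lambda>v. v)"
    by auto
  ultimately show ?thesis
    by (auto simp: section_at_def image_mset.compositionality o_def)
qed

lemma coeff_prod_z_monomial:
  "coeff_of (\<Prod>j=1..2*k. in_alphabet j G) (z_monomial k \<mu>) = (\<Prod>j=1..2*k. coeff_of G (mu_monomial (\<mu> j)))"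
proof -
  have "fst ` set_mset (z_monomial k \<mu>) \<subseteq> {1..2*k}"
  proof
    fix i assume "i \<in> fst ` set_mset (z_monomial k \<mu>)"
    then have "section_at i (z_monomial k \<mu>) \<noteq> {#}"
      by (auto simp: section_at_def filter_mset_eq_conv)
    then show "i \<in> {1..2*k}"
      unfolding section_at_z_monomial by (auto split: if_splits)
  qed
  then show ?thesis
    by (subst coeff_of_prod_in_alphabet) (simp_all add: section_at_z_monomial)
qed

lemma prod_z_monomial_dual:
  assumes "\<And>j. j \<in> {1..2*k} \<Longrightarrow> \<mu> j = [2] \<or> \<mu> j = [1, 1]"
  shows "(\<Prod>j=1..2*k. in_alphabet j (complete_h_part (\<mu> j))) = monomial_dual (z_monomial k \<mu>)"
proof -
  have "(\<Prod>j=1..2*k. in_alphabet j (monomial_dual1 (mu_monomial (\<mu> j)))) = monomial_dual (z_monomial k \<mu>)"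
    by (rule prod_monomial_dual1) (simp_all only: finite_atLeastAtMost section_at_z_monomial)
  moreover have "monomial_dual1 (mu_monomial (\<mu> j)) = complete_h_part (\<mu> j)" if "j \<in> {1..2*k}" for j
    using assms[OF that] monomial_dual1_degree_2 by (auto simp: mu_monomial_def)
  ultimately show ?thesis
    by simp
qed

text \<open>Pairing with the complete functions reads off the coefficient at one monomial of degree
  4k. There s_2 + q s_11 contributes 1 for \<open>[2]\<close> and 1 + q for \<open>[1, 1]\<close>,
  while p_1^2 contributes 1 and 2; this produces the m-th powers.\<close>

lemma H_mu_formula:
  fixes \<mu> :: "nat \<Rightarrow> partition"
  assumes "k > 0" "\<And>j. j \<in> {1..2*k} \<Longrightarrow> \<mu> j = [2] \<or> \<mu> j = [1, 1]"
    and "\<exists>j\<in>{1..2*k}. \<mu> j = [1, 1]"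
  defines "m \<equiv> card {j \<in> {1..2*k}. \<mu> j \<noteq> [2]}"
  shows "H_mu g k \<mu> =
      ((zz ^ 3 - ww)\<^sup>2 * (zz - ww)\<^sup>2) ^ g / ((zz ^ 4 - 1) * (zz\<^sup>2 - ww\<^sup>2)) * (1 + zz\<^sup>2) ^ m
      + ((zz - ww ^ 3)\<^sup>2 * (zz - ww)\<^sup>2) ^ g / ((zz\<^sup>2 - ww\<^sup>2) * (1 - ww ^ 4)) * (1 + ww\<^sup>2) ^ m
      - 1 / 2 * (((zz - ww)\<^sup>2) ^ g)\<^sup>2 / ((zz\<^sup>2 - 1) * (1 - ww\<^sup>2)) * 2 ^ m"
proof -
  let ?J = "{1..2*k}" and ?M = "z_monomial k \<mu>"
  let ?A = "Omega_HLRV_term g k [1]" and ?B1 = "Omega_HLRV_term g k [2]" and ?B2 = "Omega_HLRV_term g k [1, 1]"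
  let ?D = "(zz\<^sup>2 - 1) * (1 - ww\<^sup>2)"
  define c where "c = ((zz - ww)\<^sup>2) ^ g / ?D"
  have A: "homog (2 * k) ?A" and B: "homog (2 * (2 * k)) (?B1 + ?B2)"
    using Omega_HLRV_term_facts(2)[of k "[1]" g] Omega_HLRV_term_facts(2)[of k "[2]" g]
      Omega_HLRV_term_facts(2)[of k "[1, 1]" g]
    by (auto intro!: homog_add simp: mult_ac)
  note agree = agree_Omega_HLRV[OF assms(1), of g]
  have const: "coeff_of (Omega_HLRV g k) {#} = 1"
  proof -
    have "low 1 ?A" "low 1 (?B1 + ?B2)"
      by (rule low_mono[OF homog_imp_low[OF A]] low_mono[OF homog_imp_low[OF B]], use assms(1) in simp)+
    then have "low 1 (?A + (?B1 + ?B2))"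
      by (rule low_add)
    with agree show ?thesis
      by (simp only: add.assoc agree_constant_term)
  qed
  have pow: "(\<Prod>j\<in>?J. if \<mu> j = [2] then 1 else q) = q ^ m" for q :: rf
  proof -
    have "(\<Prod>j\<in>?J. if \<mu> j = [2] then 1 else q) = (\<Prod>j\<in>?J. if \<mu> j \<noteq> [2] then q else 1)"
      by (rule prod.cong) auto
    also have "\<dots> = q ^ m"
      by (simp add: prod.If_cases m_def Int_def)
    finally show ?thesis .
  qed
  have coeff_A: "coeff_of ?A ?M = 0"
    by (rule homogD[OF A]) (use assms(1) in \<open>simp add: size_z_monomial\<close>)
  have H2: "coeff_of (\<Prod>j\<in>?J. in_alphabet j (map_coeffs (adams_rf 2) (H2 q))) ?M = (1 + adams_rf 2 q) ^ m" for q
  proof -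
    have "coeff_of (\<Prod>j\<in>?J. in_alphabet j (map_coeffs (adams_rf 2) (H2 q))) ?M
        = (\<Prod>j\<in>?J. if \<mu> j = [2] then 1 else 1 + adams_rf 2 q)"
      unfolding coeff_prod_z_monomial
      by (rule prod.cong) (simp_all add: mu_monomial_def H2_facts adams_rf_add)
    then show ?thesis
      by (simp only: pow)
  qed
  have coeff_B1: "coeff_of ?B1 ?M = ((zz ^ 3 - ww)\<^sup>2 * (zz - ww)\<^sup>2) ^ g / (((zz ^ 4 - 1) * (zz\<^sup>2 - ww\<^sup>2)) * ?D) * (1 + zz\<^sup>2) ^ m"
    unfolding Omega_HLRV_term_def coeff_of_mscale macdonald_degree_2 H2 N_values
    by (simp add: adams_rf_zz)
  have coeff_B2: "coeff_of ?B2 ?M = ((zz - ww ^ 3)\<^sup>2 * (zz - ww)\<^sup>2) ^ g / (((zz\<^sup>2 - ww\<^sup>2) * (1 - ww ^ 4)) * ?D) * (1 + ww\<^sup>2) ^ m"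
  proof -
    have "[1, 1] = [Suc 0, Suc 0]"
      by simp
    then show ?thesis
      unfolding Omega_HLRV_term_def coeff_of_mscale
      by (simp only: macdonald_degree_2 H2 N_values) (simp add: adams_rf_ww)
  qed
  have A_eq: "?A = mscale c (\<Prod>j\<in>?J. in_alphabet j (power_sum 1))"
    unfolding Omega_HLRV_term_def macdonald_1 map_coeffs_power_sum by (simp add: N_values c_def)
  have coeff_AA: "coeff_of (?A * ?A) ?M = c\<^sup>2 * 2 ^ m"
  proof -
    let ?P = "\<lambda>j. in_alphabet j (power_sum 1)"
    have "?A * ?A = mscale (c\<^sup>2) (\<Prod>j\<in>?J. ?P j * ?P j)"
      unfolding A_eq by (simp add: mscale_mult_left mscale_mult_right prod.distrib power2_eq_square)
    moreover have "coeff_of (\<Prod>j\<in>?J. ?P j * ?P j) ?M = (\<Prod>j\<in>?J. if \<mu> j = [2] then 1 else 2)"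
    proof -
      have supp: "fst v = j" if nz: "coeff_of (?P j * ?P j) L \<noteq> 0" and v: "v \<in># L" for j L v
      proof -
        obtain X Y where "X + Y = L" "coeff_of (?P j) X \<noteq> 0" "coeff_of (?P j) Y \<noteq> 0"
          using nz by (rule coeff_of_mult_nonzero)
        then show ?thesis
          using v in_alphabet_support[of j "power_sum 1" X v] in_alphabet_support[of j "power_sum 1" Y v] by auto
      qed
      have "coeff_of (?P j * ?P j) (image_mset (\<lambda>v. (j, snd v)) (mu_monomial (\<mu> j))) = (if \<mu> j = [2] then 1 else 2)" for j
        by (simp add: mu_monomial_def coeff_of_mult_pair[OF homog_power_sum homog_power_sum, unfolded One_nat_def]
            coeff_of_power_sum)
      moreover have "coeff_of (\<Prod>j\<in>?J. ?P j * ?P j) ?M = (\<Prod>j\<in>?J. coeff_of (?P j * ?P j) (image_mset (\<lambda>v. (j, snd v)) (mu_monomial (\<mu> j))))"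
        unfolding z_monomial_def by (rule coeff_of_prod_monomials[where b = fst]) (auto intro: supp)
      ultimately show ?thesis
        by (simp only:)
    qed
    ultimately show ?thesis
      by (simp only: coeff_of_mscale pow)
  qed
  \<comment> \<open>\<open>adams 2\<close> produces only monomials with all exponents even, but an
    index with \<open>\<mu> j = [1, 1]\<close> puts a variable with exponent 1 into the
    monomial.\<close>
  have coeff_adams: "coeff_of (adams 2 ?A) ?M = 0"
  proof (rule ccontr)
    assume "coeff_of (adams 2 ?A) ?M \<noteq> 0"
    then obtain L where L: "?M = repeat_mset 2 L"
      by (rule coeff_of_adams_nonzero[rotated]) auto
    obtain j where j: "j \<in> ?J" "\<mu> j = [1, 1]"
      using assms(3) by blast
    have "count (section_at j ?M) ((), 0) = 1"
      unfolding section_at_z_monomial using j by (simp add: mu_monomial_def)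
    then have "count ?M (j, 0) = 1"
      by (simp add: count_section_at)
    then have "2 * count L (j, 0) = 1"
      by (simp add: L)
    then show False
      by presburger
  qed
  have prod: "(\<Prod>j\<in>?J. in_alphabet j (complete_h_part (\<mu> j))) = monomial_dual ?M"
    by (rule prod_z_monomial_dual) (use assms(2) in blast)
  have "coeff_of (Log (Omega_HLRV g k)) ?M
      = coeff_of (?A + (?B1 + ?B2 - mscale (1 / 2) (?A * ?A) - mscale (1 / 2) (adams 2 ?A))) ?M"
    using agree_Log[OF _ A B agree] assms(1) by (simp add: agree_def size_z_monomial)
  also have "\<dots> = coeff_of ?B1 ?M + coeff_of ?B2 ?M - 1 / 2 * (c\<^sup>2 * 2 ^ m)"
    by (simp only: coeff_of_add coeff_of_diff coeff_of_mscale coeff_A coeff_AA coeff_adams)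
  finally have "H_mu g k \<mu> = ?D * (coeff_of ?B1 ?M + coeff_of ?B2 ?M - 1 / 2 * (c\<^sup>2 * 2 ^ m))"
    unfolding H_mu_def prod hall_monomial_dual[OF symmetric_Log[OF symmetric_Omega(3) const]]
    by (simp only:)
  \<comment> \<open>The prefactor of \<open>H_mu\<close> is the contribution at u = 1 of the box
    with arm and leg 0, a common factor of the norms of both partitions of 2.\<close>
  moreover have "?D * (x / (y * ?D) * e) = x / y * e" for x y e
    using nonzero_facts(2,3) by simp
  moreover have "?D * (1 / 2 * (c\<^sup>2 * 2 ^ m)) = 1 / 2 * (((zz - ww)\<^sup>2) ^ g)\<^sup>2 / ?D * 2 ^ m"
    using nonzero_facts(2,3) by (simp add: c_def power_divide power2_eq_square[of ?D])
  ultimately show ?thesis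
    unfolding coeff_B1 coeff_B2 by (simp only: distrib_left right_diff_distrib)
qed

theorem mainTheorem4:
  fixes g k :: nat
    and a :: "nat \<Rightarrow> complex"
    and C :: "nat \<Rightarrow> (complex ^ 2 ^ 2) set"
    and \<mu> :: "nat \<Rightarrow> partition"
  assumes "1 \<le> k"
    and "\<forall>j\<in>{1..2*k}. a j \<noteq> 0 \<and> (a j)\<^sup>2 \<noteq> -1"
    and "\<forall>j\<in>{1..2*k}. C j = sigma_class (diag (a j))"
    and "\<forall>e :: nat \<Rightarrow> int. (\<forall>j\<in>{1..2*k}. e j \<in> {1, -1}) \<longrightarrow>
           (\<Prod>j=1..2*k. a j powi (2 * e j)) \<noteq> 1"
    and "\<forall>j\<in>{1..2*k}. ((a j)\<^sup>2 = 1 \<longrightarrow> \<mu> j = [2]) \<and> ((a j) ^ 4 \<noteq> 1 \<longrightarrow> \<mu> j = [1, 1])"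
  shows "H_B g k C = 2 * (zz - ww) ^ (2 * k - 2) * H_mu g k \<mu>"
proof -
  let ?J = "{1..2*k}"
  have k: "k > 0"
    using assms(1) by simp
  \<comment> \<open>The exclusion of (a_j)^2 = -1 leaves exactly two cases, so
    \<open>\<mu> j\<close> is determined for every j.\<close>
  have fourth: "(a j) ^ 4 \<noteq> 1" if "j \<in> ?J" "(a j)\<^sup>2 \<noteq> 1" for j
  proof
    assume "(a j) ^ 4 = 1"
    then have "((a j)\<^sup>2)\<^sup>2 = 1"
      by (simp flip: power_mult)
    then have "(a j)\<^sup>2 = 1 \<or> (a j)\<^sup>2 = -1"
      by (simp only: power2_eq_1_iff)
    then show False
      using that assms(2) by blast
  qed
  have \<mu>: "\<mu> j = (if (a j)\<^sup>2 = 1 then [2] else [1, 1])" if "j \<in> ?J" for j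
    using that assms(5) fourth[OF that] by auto
  \<comment> \<open>Otherwise the product with all signs equal to 1 would be 1, against
    genericity.\<close>
  have "\<exists>j\<in>?J. (a j)\<^sup>2 \<noteq> 1"
  proof (rule ccontr)
    assume "\<not> ?thesis"
    then have "(\<Prod>j\<in>?J. a j powi (2 * 1)) = 1"
      by (intro prod.neutral) (auto simp: power_int_def)
    then show False
      using assms(4)[rule_format, of "\<lambda>_. 1"] by simp
  qed
  then have ex: "\<exists>j\<in>?J. \<mu> j = [1, 1]"
    using \<mu> by fastforce
  have m: "{j \<in> ?J. \<mu> j \<noteq> [2]} = {j \<in> ?J. (a j)\<^sup>2 \<noteq> 1}"
    using \<mu> by auto
  obtain k' where k': "k = Suc k'"
    using k by (cases k) auto
  let ?d = "(zz - ww)\<^sup>2"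
  have d: "(zz - ww) ^ (2 * k - 2) = ?d ^ k'"
    by (simp add: k' power_mult)
  \<comment> \<open>\<open>p\<close> is the factor of the box of hook length 2 and \<open>D\<close>
    the norm at u = 1; k' = k - 1 copies of \<open>p\<close> cancel.\<close>
  have cancel: "(p * ?d) ^ (g + k - 1) / (D * p ^ (k - 1)) = ?d ^ k' * ((p * ?d) ^ g / D)" if "p \<noteq> 0" for p D :: rf
    using that by (simp add: k' power_add power_mult_distrib)
  have c: "coeff10 g k = ?d ^ k' * (((zz ^ 3 - ww)\<^sup>2 * ?d) ^ g / ((zz ^ 4 - 1) * (zz\<^sup>2 - ww\<^sup>2)))"
    "coeff01 g k = ?d ^ k' * (((zz - ww ^ 3)\<^sup>2 * ?d) ^ g / ((zz\<^sup>2 - ww\<^sup>2) * (1 - ww ^ 4)))"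
    "coeff_star g k = ?d ^ k' * ((?d ^ g)\<^sup>2 / ((zz\<^sup>2 - 1) * (1 - ww\<^sup>2)))"
  proof -
    show "coeff10 g k = ?d ^ k' * (((zz ^ 3 - ww)\<^sup>2 * ?d) ^ g / ((zz ^ 4 - 1) * (zz\<^sup>2 - ww\<^sup>2)))"
      unfolding coeff10_def by (rule cancel[OF power_not_zero[OF nonzero_facts(7)]])
    show "coeff01 g k = ?d ^ k' * (((zz - ww ^ 3)\<^sup>2 * ?d) ^ g / ((zz\<^sup>2 - ww\<^sup>2) * (1 - ww ^ 4)))"
      unfolding coeff01_def by (rule cancel[OF power_not_zero[OF nonzero_facts(8)]])
    have "x ^ (2 * g + k - 1) = x ^ k' * (x ^ g)\<^sup>2" for x :: rf
      by (simp add: k' power_add mult.commute flip: power_mult)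
    then show "coeff_star g k = ?d ^ k' * ((?d ^ g)\<^sup>2 / ((zz\<^sup>2 - 1) * (1 - ww\<^sup>2)))"
      unfolding coeff_star_def by (simp only: times_divide_eq_right)
  qed
  let ?m = "card {j \<in> ?J. (a j)\<^sup>2 \<noteq> 1}"
  have H_B: "H_B g k C = 2 * (coeff10 g k * (1 + zz\<^sup>2) ^ ?m + coeff01 g k * (1 + ww\<^sup>2) ^ ?m) - coeff_star g k * 2 ^ ?m"
    by (rule H_B_formula[OF k]) (use assms in blast)
  have \<mu>_cases: "\<mu> j = [2] \<or> \<mu> j = [1, 1]" if "j \<in> ?J" for j
    using \<mu>[OF that] by auto
  \<comment> \<open>Taking 2x out of the whole expression gives the contribution of
    \<open>Omega_star\<close> the coefficient 1/2 that A^2 has in the logarithm.\<close>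
  have "2 * (x * p * X + x * q * Y) - x * (s / D) * T = 2 * x * (p * X + q * Y - 1 / 2 * s / D * T)"
    for x p q s D X Y T :: rf
    by (simp add: algebra_simps)
  moreover have "H_mu g k \<mu> =
      ((zz ^ 3 - ww)\<^sup>2 * ?d) ^ g / ((zz ^ 4 - 1) * (zz\<^sup>2 - ww\<^sup>2)) * (1 + zz\<^sup>2) ^ ?m
      + ((zz - ww ^ 3)\<^sup>2 * ?d) ^ g / ((zz\<^sup>2 - ww\<^sup>2) * (1 - ww ^ 4)) * (1 + ww\<^sup>2) ^ ?m
      - 1 / 2 * (?d ^ g)\<^sup>2 / ((zz\<^sup>2 - 1) * (1 - ww\<^sup>2)) * 2 ^ ?m"
    unfolding m[symmetric] by (rule H_mu_formula[OF k \<mu>_cases ex])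
  ultimately show ?thesis
    by (simp only: H_B c d)
qed

end
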